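(* Let $\mathbf A_1,\mathbf A_2,\dots$ be random $p\times p$ matrices with complex entries, let $\hat{\mathbf A}_k$ be the entrywise modulus of $\mathbf A_k$, and let $(\mathbf Y_n)$ be the associated complex Mandelbrot martingale (full setting in the context). Let $\alpha>1$. If $\mathbb E\big\|\sum_{k=1}^N\hat{\mathbf A}_k\big\|^\alpha<\infty$ and either of the following holds: (i) $\alpha\in(1,2]$ and $p^{\alpha-1}\hat\rho(\alpha)<1$; (ii) $\alpha>2$ and $\max\{p^{\alpha-1}\hat\rho(\alpha),\ p^{\alpha/\beta}\hat\rho(\beta)\}<1$ for some $\beta\in(1,2]$, then $\sup_n\mathbb E\|\mathbf Y_n\|^\alpha<\infty$, and $(\mathbf Y_n)$ converges a.s. and in $L^\alpha$ to a random vector $\mathbf Y$, so that $\mathbb E\mathbf Y=\mathbf V$ and $0<\mathbb E\|\mathbf Y\|^\alpha<\infty$.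
   Context: Fix an integer $p\ge1$. $N$ is a random variable with values in $\{0,1,2,\dots\}$ and $\mathbf A_1,\mathbf A_2,\dots$ are random complex $p\times p$ matrices on the same probability space as $N$ (arbitrary dependence allowed; $\mathbf A_k$ is taken to be $0$ for $k>N$). A matrix is finite if all its entries are finite, and a matrix $\mathbf B$ is strictly positive if for some positive integer $n$ all entries of $\mathbf B^n$ are positive. Standing assumptions: (1) $\mathbf M:=\mathbb E\sum_{k=1}^N\mathbf A_k$ is finite and strictly positive with maximum-modulus eigenvalue $1$ and corresponding positive left and right eigenvectors $\mathbf U=(U_1,\dots,U_p)$, $\mathbf V=(V_1,\dots,V_p)$, normalized by $\sum_iU_i=\sum_iU_iV_i=1$. (2) $\hat{\mathbf M}:=\mathbb E\sum_{k=1}^N\hat{\mathbf A}_k$, where $(\hat{\mathbf A}_k)_{ij}=|(\mathbf A_k)_{ij}|$, is finite and strictly positive. For real $t$, $\hat{\mathbf M}(t)$ is the matrix with entries $\mathbb E\sum_{k=1}^N|(\mathbf A_k)_{ij}|^t$, and $\hat\rho(t)$ is its maximum-modulus (Perron-Frobenius) eigenvalue; under $\mathbb E\|\sum_{k=1}^N\hat{\mathbf A}_k\|^\alpha<\infty$ it exists for all $t\in[1,\alpha]$. Let $I=\bigcup_{n\ge0}\{1,2,\dots\}^n$ be the set of finite sequences, and let $(N_u,\mathbf A_{u1},\mathbf A_{u2},\dots)$, $u\in I$, be independent copies of $(N,\mathbf A_1,\mathbf A_2,\dots)$, the copy at the empty sequence $\emptyset$ being $(N,\mathbf A_1,\mathbf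 A_2,\dots)$ itself. Let $\mathbb T$ be the Galton-Watson tree with $\emptyset\in\mathbb T$ and, for $u\in\mathbb T$, $uk\in\mathbb T$ iff $1\le k\le N_u$; $\mathbb T_n$ is the set of elements of $\mathbb T$ of length $n$. For $u=u_1\cdots u_n$ put $\mathbf X_u=\mathbf A_{u_1}\mathbf A_{u_1u_2}\cdots\mathbf A_{u_1\cdots u_n}$. Define $\mathbf Y_0=\mathbf V$ and $\mathbf Y_n=\sum_{u\in\mathbb T_n}\mathbf X_u\mathbf V$ for $n\ge1$ ($\mathbf V$ as a column vector). For matrices $\|\cdot\|$ is any matrix norm; for vectors $\|\mathbf u\|=\sum_j|u_j|$. *)

theory Defs
  imports "HOL-Probability.Probability"
begin

text \<open>Matrices are elements of \<open>'a ^ 'p ^ 'p\<close>, so \<open>p = CARD('p)\<close> is an arbitrary positive integer.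
  The product is \<open>**\<close>; the power below is the iterated matrix product, since \<open>*\<close> on this type
  is entrywise.\<close>

definition mat_pow :: "'a::semiring_1 ^ 'p ^ 'p \<Rightarrow> nat \<Rightarrow> 'a ^ 'p ^ 'p" where
  "mat_pow B n = (((**) B) ^^ n) (mat 1)"

definition cvec :: "real ^ 'p \<Rightarrow> complex ^ 'p" where
  "cvec v = (\<chi> i. complex_of_real (v $ i))"

definition cmat :: "real ^ 'p ^ 'p \<Rightarrow> complex ^ 'p ^ 'p" where
  "cmat B = (\<chi> i j. complex_of_real (B $ i $ j))"

definition abs_mat :: "complex ^ 'p ^ 'p \<Rightarrow> real ^ 'p ^ 'p" where
  "abs_mat B = (\<chi> i j. cmod (B $ i $ j))"

definition l1_norm :: "complex ^ 'p \<Rightarrow> real" where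
  "l1_norm v = (\<Sum>j\<in>UNIV. cmod (v $ j))"

definition matrix_norm :: "(real ^ 'p ^ 'p \<Rightarrow> real) \<Rightarrow> bool" where
  "matrix_norm \<nu> \<longleftrightarrow>
     (\<forall>B. 0 \<le> \<nu> B) \<and> (\<forall>B. \<nu> B = 0 \<longleftrightarrow> B = 0) \<and>
     (\<forall>c B. \<nu> (c *\<^sub>R B) = \<bar>c\<bar> * \<nu> B) \<and>
     (\<forall>B C. \<nu> (B + C) \<le> \<nu> B + \<nu> C)"

text \<open>The entries of \<open>B\<close> itself may be non-real; only those of some power have to be positive reals.\<close>

definition strictly_positive :: "complex ^ 'p ^ 'p \<Rightarrow> bool" where
  "strictly_positive B \<longleftrightarrow>
     (\<exists>n\<ge>1. \<forall>i j. mat_pow B n $ i $ j \<in> \<real> \<and> 0 < Re (mat_pow B n $ i $ j))"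

definition is_eigenvalue :: "complex ^ 'p ^ 'p \<Rightarrow> complex \<Rightarrow> bool" where
  "is_eigenvalue B z \<longleftrightarrow> (\<exists>v. v \<noteq> 0 \<and> B *v v = z *s v)"

definition max_modulus_eigenvalue :: "complex ^ 'p ^ 'p \<Rightarrow> complex \<Rightarrow> bool" where
  "max_modulus_eigenvalue B z \<longleftrightarrow>
     is_eigenvalue B z \<and> (\<forall>\<mu>. is_eigenvalue B \<mu> \<longrightarrow> cmod \<mu> \<le> cmod z)"

text \<open>For a matrix with nonnegative entries the number described here exists by the
  Perron-Frobenius theorem; uniqueness is immediate.\<close>

definition pf_eigenvalue :: "real ^ 'p ^ 'p \<Rightarrow> real" where
  "pf_eigenvalue B = (THE r. 0 \<le> r \<and> max_modulus_eigenvalue (cmat B) (complex_of_real r))"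

text \<open>Finite sequences of positive integers are lists without the entry \<open>0\<close>; the child \<open>uk\<close> of \<open>u\<close>
  is \<open>u @ [k]\<close>. A family \<open>N u\<close>, \<open>A u\<close> is indexed by such sequences, and \<open>N\<close>, \<open>A\<^sub>k\<close> without a
  node index are \<open>N []\<close>, \<open>A [k]\<close>. The value \<open>A []\<close> is never used.\<close>

definition nodes :: "nat list set" where
  "nodes = {u. 0 \<notin> set u}"

definition mark_space :: "(nat \<times> (nat \<Rightarrow> complex ^ 'p ^ 'p)) measure" where
  "mark_space = count_space UNIV \<Otimes>\<^sub>M (\<Pi>\<^sub>M k\<in>{1..}. borel)"

definition mark ::
  "(nat list \<Rightarrow> 'w \<Rightarrow> nat) \<Rightarrow> (nat list \<Rightarrow> 'w \<Rightarrow> complex ^ 'p ^ 'p) \<Rightarrow>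
   nat list \<Rightarrow> 'w \<Rightarrow> nat \<times> (nat \<Rightarrow> complex ^ 'p ^ 'p)" where
  "mark N A u \<omega> = (N u \<omega>, \<lambda>k\<in>{1..}. A (u @ [k]) \<omega>)"

inductive_set gw_tree :: "(nat list \<Rightarrow> nat) \<Rightarrow> nat list set" for N where
  root: "[] \<in> gw_tree N"
| child: "u \<in> gw_tree N \<Longrightarrow> 1 \<le> k \<Longrightarrow> k \<le> N u \<Longrightarrow> u @ [k] \<in> gw_tree N"

definition generation :: "(nat list \<Rightarrow> nat) \<Rightarrow> nat \<Rightarrow> nat list set" where
  "generation N n = {u \<in> gw_tree N. length u = n}"

text \<open>\<open>branch_prod A u = A\<^bsub>u\<^sub>1\<^esub> ** A\<^bsub>u\<^sub>1u\<^sub>2\<^esub> ** \<dots> ** A\<^bsub>u\<^sub>1\<dots>u\<^sub>n\<^esub>\<close>, where \<open>n = length u\<close>.\<close>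

definition branch_prod :: "(nat list \<Rightarrow> 'a::semiring_1 ^ 'p ^ 'p) \<Rightarrow> nat list \<Rightarrow> 'a ^ 'p ^ 'p" where
  "branch_prod A u = foldr (\<lambda>j B. A (take j u) ** B) [1..<Suc (length u)] (mat 1)"

definition mandelbrot ::
  "(nat list \<Rightarrow> 'w \<Rightarrow> nat) \<Rightarrow> (nat list \<Rightarrow> 'w \<Rightarrow> complex ^ 'p ^ 'p) \<Rightarrow> real ^ 'p \<Rightarrow>
   nat \<Rightarrow> 'w \<Rightarrow> complex ^ 'p" where
  "mandelbrot N A V n \<omega> =
     (\<Sum>u\<in>generation (\<lambda>u. N u \<omega>) n. branch_prod (\<lambda>u. A u \<omega>) u *v cvec V)"

definition offspring_sum ::
  "(nat list \<Rightarrow> 'w \<Rightarrow> nat) \<Rightarrow> (nat list \<Rightarrow> 'w \<Rightarrow> complex ^ 'p ^ 'p) \<Rightarrow> 'w \<Rightarrow> complex ^ 'p ^ 'p" where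
  "offspring_sum N A \<omega> = (\<Sum>k=1..N [] \<omega>. A [k] \<omega>)"

definition offspring_abs_sum ::
  "(nat list \<Rightarrow> 'w \<Rightarrow> nat) \<Rightarrow> (nat list \<Rightarrow> 'w \<Rightarrow> complex ^ 'p ^ 'p) \<Rightarrow> 'w \<Rightarrow> real ^ 'p ^ 'p" where
  "offspring_abs_sum N A \<omega> = (\<Sum>k=1..N [] \<omega>. abs_mat (A [k] \<omega>))"

text \<open>Only used for \<open>t > 0\<close>, where \<open>0 powr t = 0\<close> is the intended value.\<close>

definition Mhat ::
  "'w measure \<Rightarrow> (nat list \<Rightarrow> 'w \<Rightarrow> nat) \<Rightarrow> (nat list \<Rightarrow> 'w \<Rightarrow> complex ^ 'p ^ 'p) \<Rightarrow>
   real \<Rightarrow> real ^ 'p ^ 'p" where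
  "Mhat P N A t =
     (\<chi> i j. integral\<^sup>L P (\<lambda>\<omega>. \<Sum>k=1..N [] \<omega>. cmod (A [k] \<omega> $ i $ j) powr t))"

definition rho_hat ::
  "'w measure \<Rightarrow> (nat list \<Rightarrow> 'w \<Rightarrow> nat) \<Rightarrow> (nat list \<Rightarrow> 'w \<Rightarrow> complex ^ 'p ^ 'p) \<Rightarrow>
   real \<Rightarrow> real" where
  "rho_hat P N A t = pf_eigenvalue (Mhat P N A t)"

end

theory Submission
  imports Defs
begin

text \<open>The increment \<open>Y\<^sub>n\<^sub>+\<^sub>1 - Y\<^sub>n\<close> is the sum over \<open>u\<close> in the \<open>n\<close>-th generation of \<open>X\<^sub>u D\<^sub>u\<close>, where, given
  the first \<open>n\<close> generations, the \<open>D\<^sub>u\<close> are independent copies of a centred vector. With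
  \<open>q = min \<alpha> 2\<close> its \<open>\<alpha>\<close>-th moment is therefore at most a constant times
  \<open>E (\<Sum>u. \<parallel>X\<^sub>u\<parallel>\<^sup>q)\<^bsup>\<alpha>/q\<^esup>\<close>, and everything follows once this decays geometrically.
  Convexity bounds \<open>\<bar>X\<^sub>u\<bar>\<^sup>t\<close> entrywise by a branch product of the matrices
  \<open>p\<^bsup>t-1\<^esup> \<bar>A\<^sub>u\<bar>\<^sup>t\<close>, whose expected sum over a generation grows like
  \<open>(p\<^bsup>t-1\<^esup> \<rho>(t))\<^sup>n\<close>. This settles \<open>\<alpha> \<le> 2\<close>. For \<open>\<alpha> > 2\<close> one bounds \<open>q = 2\<close> by
  \<open>\<beta>\<close> and needs the decay of the \<open>\<gamma> = \<alpha>/\<beta>\<close>-th moment of the nonnegative process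
  \<open>W\<^sub>n\<close> built from \<open>p\<^bsup>\<beta>-1\<^esup> \<bar>A\<^sub>u\<bar>\<^sup>\<beta>\<close> and its Perron eigenvector. As \<open>W\<^sub>n\<^sub>+\<^sub>1 - c W\<^sub>n\<close> is again a
  sum of independent centred terms, with \<open>c < 1\<close>, interpolating the \<open>min \<gamma> 2\<close>-norm between the
  \<open>1\<close>-norm and the \<open>\<gamma>\<close>-norm gives a contracting recursion for \<open>E \<parallel>W\<^sub>n\<parallel>\<^sup>\<gamma>\<close>.\<close>

section \<open>Moment inequalities for independent centred sums\<close>

text \<open>The bound for the increments involves a sum over a generation raised to the power
  \<alpha>/q. For \<alpha> <= 2 this power is 1 and only first moments occur, which the mean
  matrices govern linearly. For \<alpha> > 2 it exceeds 1, and the resulting moment is not a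
  function of \<open>Mhat\<close> alone: this is the reason for the auxiliary process. Its matrices
  are nonnegative, so nothing cancels and its norm controls the very sum that reappears on the right
  of the moment inequality; the recursion closes once interpolation has made the coefficient of that
  sum small. What is left over is a first moment with exponent \<beta> * \<gamma> = \<alpha>, where
  the condition on \<rho>(\<alpha>) enters. The increment estimate thus serves twice, for the given
  matrices with r = 1 and for the nonnegative ones with r = c < 1; hence the parameter r of
  \<open>dev\<close> and a locale that can be interpreted anew. A second obstacle is that a
  generation is a random set of nodes: conditioning is done on the finite sets
  \<open>level m n\<close>, and m tends to infinity by Fatou or dominated convergence with bounds
  free of m.\<close>

lemma one_plus_powr_le_quadratic:
  fixes s :: real
  assumes "0 < s"
  obtains C where "0 \<le> C" "\<And>t. \<bar>t\<bar> \<le> 9/16 \<Longrightarrow> (1 + t) powr s \<le> 1 + s * t + C * t\<^sup>2"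
proof
  \<comment> \<open>The bound 9/16 keeps 1 + t in [7/16, 25/16], away from the singularity at 0; it
    is the value of 9/4 * z at z = 1/4 in \<open>norm_add_powr_le\<close>. On this interval a power
    is largest at an end point, which one depends on the sign of s - 2, so \<open>B\<close> adds
    both values.\<close>
  define B where "B = (7/16) powr (s - 2) + (25/16::real) powr (s - 2)"
  show "0 \<le> \<bar>s * (s - 1)\<bar> * B"
    by (simp add: B_def)
  fix t :: real
  assume t: "\<bar>t\<bar> \<le> 9/16"
  show "(1 + t) powr s \<le> 1 + s * t + \<bar>s * (s - 1)\<bar> * B * t\<^sup>2"
  proof (cases "t = 0")
    case False
    define d :: "nat \<Rightarrow> real \<Rightarrow> real" where
      "d m = (if m = 0 then (\<lambda>x. x powr s) else if m = 1 then (\<lambda>x. s * x powr (s - 1))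
              else (\<lambda>x. s * (s - 1) * x powr (s - 2)))" for m
    have "\<exists>\<xi>. (if 1 + t < 1 then 1 + t < \<xi> \<and> \<xi> < 1 else 1 < \<xi> \<and> \<xi> < 1 + t) \<and>
      (1 + t) powr s = (\<Sum>m<2. (d m 1 / fact m) * (1 + t - 1) ^ m) + (d 2 \<xi> / fact 2) * (1 + t - 1)\<^sup>2"
    proof (rule Taylor[where a = "7/16" and b = "25/16"])
      show "\<forall>m x. m < 2 \<and> 7/16 \<le> x \<and> x \<le> 25/16 \<longrightarrow> (d m has_real_derivative d (Suc m) x) (at x)"
      proof (intro allI impI)
        fix m :: nat and x :: real
        assume *: "m < 2 \<and> 7/16 \<le> x \<and> x \<le> 25/16"
        then consider "m = 0" | "m = 1" by linarith
        then show "(d m has_real_derivative d (Suc m) x) (at x)"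
        proof cases
          case 1
          show ?thesis unfolding 1 d_def using * by (auto intro!: derivative_eq_intros)
        next
          case 2
          show ?thesis unfolding 2 d_def using * by (auto intro!: derivative_eq_intros simp: diff_diff_eq)
        qed
      qed
    qed (use t False in \<open>auto simp: d_def\<close>)
    then obtain \<xi> where \<xi>: "if t < 0 then 1 + t < \<xi> \<and> \<xi> < 1 else 1 < \<xi> \<and> \<xi> < 1 + t"
      and eq: "(1 + t) powr s = (\<Sum>m<2. (d m 1 / fact m) * t ^ m) + (d 2 \<xi> / fact 2) * t\<^sup>2"
      by auto
    have \<xi>': "7/16 \<le> \<xi>" "\<xi> \<le> 25/16"
      using \<xi> t by (auto split: if_splits)
    have "\<xi> powr (s - 2) \<le> B"
    proof (cases "s \<ge> 2")
      case True
      then have "\<xi> powr (s - 2) \<le> (25/16) powr (s - 2)"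
        using \<xi>' by (intro powr_mono2) auto
      moreover have "(7/16::real) powr (s - 2) \<ge> 0" by simp
      ultimately show ?thesis unfolding B_def by linarith
    next
      case False
      then have "\<xi> powr (s - 2) \<le> (7/16) powr (s - 2)"
        using \<xi>' by (intro powr_mono2') auto
      moreover have "(25/16::real) powr (s - 2) \<ge> 0" by simp
      ultimately show ?thesis unfolding B_def by linarith
    qed
    then have "\<bar>s * (s - 1)\<bar> * \<xi> powr (s - 2) \<le> \<bar>s * (s - 1)\<bar> * B"
      by (rule mult_left_mono) simp
    moreover have "s * (s - 1) * \<xi> powr (s - 2) \<le> \<bar>s * (s - 1)\<bar> * \<xi> powr (s - 2)"
      by (intro mult_right_mono) auto
    moreover have "0 \<le> \<bar>s * (s - 1)\<bar> * \<xi> powr (s - 2)" by simp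
    moreover have "d 2 \<xi> = s * (s - 1) * \<xi> powr (s - 2)" by (simp add: d_def)
    ultimately have "d 2 \<xi> / 2 \<le> \<bar>s * (s - 1)\<bar> * B" by linarith
    then have "(d 2 \<xi> / 2) * t\<^sup>2 \<le> \<bar>s * (s - 1)\<bar> * B * t\<^sup>2"
      by (intro mult_right_mono) auto
    then show ?thesis
      unfolding eq by (simp add: d_def numeral_2_eq_2)
  qed simp
qed

text \<open>If 4 |y| < |x|, expand the power \<gamma>/2 of |x + y|^2 around |x|^2; otherwise the
  left side and the linear term are both at most multiples of |y|^\<gamma>. The linear term is kept
  exact because it integrates to 0 for independent centred y.\<close>

lemma norm_add_powr_le:
  fixes \<gamma> q :: real
  assumes "1 < \<gamma>" and q: "q = min \<gamma> 2"
  obtains C where "0 \<le> C"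
    "\<And>x y :: 'a :: real_inner. norm (x + y) powr \<gamma> \<le> norm x powr \<gamma> + \<gamma> * norm x powr (\<gamma> - 2) * (x \<bullet> y)
        + C * (norm x powr (\<gamma> - q) * norm y powr q + norm y powr \<gamma>)"
proof -
  obtain C where C: "0 \<le> C" "\<And>t. \<bar>t\<bar> \<le> 9/16 \<Longrightarrow> (1 + t) powr (\<gamma>/2) \<le> 1 + \<gamma>/2 * t + C * t\<^sup>2"
    using one_plus_powr_le_quadratic[of "\<gamma>/2"] assms by auto
  \<comment> \<open>The first two summands pay for the left side and the linear term when |x| <= 4
    |y|; the last two are the quadratic remainder of the expansion, where t^2 <= 6 z^2.\<close>
  define D where "D = 5 powr \<gamma> + \<gamma> * 4 powr (\<gamma> - 1) + \<gamma>/2 + 6 * C"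
  have "0 \<le> D" using C assms by (simp add: D_def)
  moreover have "norm (x + y) powr \<gamma> \<le> norm x powr \<gamma> + \<gamma> * norm x powr (\<gamma> - 2) * (x \<bullet> y)
        + D * (norm x powr (\<gamma> - q) * norm y powr q + norm y powr \<gamma>)" for x y :: 'a
  proof (cases "norm x \<le> 4 * norm y")
    case True
    have "norm (x + y) powr \<gamma> \<le> (5 * norm y) powr \<gamma>"
      using norm_triangle_ineq[of x y] True assms by (intro powr_mono2) auto
    also have "\<dots> = 5 powr \<gamma> * norm y powr \<gamma>" by (simp add: powr_mult)
    finally have 1: "norm (x + y) powr \<gamma> \<le> 5 powr \<gamma> * norm y powr \<gamma>" .
    have "norm x powr (\<gamma> - 2) * (- (x \<bullet> y)) \<le> norm x powr (\<gamma> - 2) * (norm x * norm y)"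
      using Cauchy_Schwarz_ineq2[of x y] by (intro mult_left_mono) auto
    also have "\<dots> = norm x powr (\<gamma> - 1) * norm y"
      by (cases "x = 0") (auto simp: powr_mult_base mult.commute[of _ "norm x"] simp flip: mult.assoc)
    also have "\<dots> \<le> (4 * norm y) powr (\<gamma> - 1) * norm y"
      using True assms by (intro mult_right_mono powr_mono2) auto
    also have "\<dots> = 4 powr (\<gamma> - 1) * norm y powr \<gamma>"
      by (cases "y = 0") (auto simp: powr_mult powr_mult_base mult.commute[of _ "norm y"] mult.left_commute)
    finally have "\<gamma> * (norm x powr (\<gamma> - 2) * (- (x \<bullet> y))) \<le> \<gamma> * (4 powr (\<gamma> - 1) * norm y powr \<gamma>)"
      using assms by (intro mult_left_mono) auto
    then have 2: "0 \<le> \<gamma> * norm x powr (\<gamma> - 2) * (x \<bullet> y) + \<gamma> * 4 powr (\<gamma> - 1) * norm y powr \<gamma>"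
      by (simp add: algebra_simps)
    have 3: "0 \<le> D * (norm x powr (\<gamma> - q) * norm y powr q)" using \<open>0 \<le> D\<close> by simp
    have 4: "0 \<le> (\<gamma>/2 + 6*C) * norm y powr \<gamma>" using assms C by simp
    have 5: "0 \<le> norm x powr \<gamma>" by simp
    have "D * norm y powr \<gamma> = 5 powr \<gamma> * norm y powr \<gamma> + \<gamma> * 4 powr (\<gamma> - 1) * norm y powr \<gamma>
        + (\<gamma>/2 + 6*C) * norm y powr \<gamma>"
      by (simp add: D_def algebra_simps)
    with 1 2 3 4 5 show ?thesis
      unfolding distrib_left by linarith
  next
    case False
    then have x: "0 < norm x" "norm y \<le> norm x / 4" using norm_ge_zero[of y] by linarith+
    \<comment> \<open>\<open>t\<close> is the relative change of the squared norm and
      \<open>z\<close> the ratio of the norms. With z <= 1/4, the chain |t| <= 2 z + z^2 <= 9/4 z <=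
      9/16 makes the expansion applicable.\<close>
    define t where "t = (2 * (x \<bullet> y) + (norm y)\<^sup>2) / (norm x)\<^sup>2"
    define z where "z = norm y / norm x"
    have z: "0 \<le> z" "z \<le> 1/4" using x by (auto simp: z_def field_simps)
    define w where "w = (x \<bullet> y) / (norm x)\<^sup>2"
    have "\<bar>w\<bar> \<le> z"
      using x Cauchy_Schwarz_ineq2[of x y] by (simp add: w_def z_def field_simps power2_eq_square)
    moreover have teq: "t = 2 * w + z\<^sup>2"
      using x by (simp add: w_def t_def z_def field_simps power2_eq_square)
    moreover have zz: "z\<^sup>2 \<le> z / 4" using mult_left_mono[OF z(2) z(1)] by (simp add: power2_eq_square)
    ultimately have t: "\<bar>t\<bar> \<le> 9/4 * z" 
      using z zero_le_power2[of z] by linarith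
    then have t2: "t\<^sup>2 \<le> 6 * z\<^sup>2"
    proof -
      have "t\<^sup>2 \<le> (9/4 * z)\<^sup>2" using t z by (metis abs_le_square_iff abs_of_nonneg mult_nonneg_nonneg order_trans abs_ge_zero)
      then have "t\<^sup>2 \<le> 81/16 * z\<^sup>2" by (simp add: power2_eq_square)
      then show ?thesis using zero_le_power2[of z] by linarith
    qed
    have "norm (x + y) powr \<gamma> = ((norm (x + y))\<^sup>2) powr (\<gamma>/2)"
      by (cases "x + y = 0") (auto simp: powr_powr simp flip: powr_numeral)
    also have "(norm (x + y))\<^sup>2 = (norm x)\<^sup>2 + (2 * (x \<bullet> y) + (norm y)\<^sup>2)"
      by (simp add: power2_norm_eq_inner algebra_simps inner_commute)
    also have "\<dots> = (norm x)\<^sup>2 * (1 + t)"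
      using x by (simp add: t_def ring_distribs(1)[of "(norm x)\<^sup>2" 1] del: distrib_left_numeral)
    also have "\<dots> powr (\<gamma>/2) = norm x powr \<gamma> * (1 + t) powr (\<gamma>/2)"
      using t z x by (subst powr_mult) (auto simp: powr_powr simp flip: powr_numeral)
    also have "\<dots> \<le> norm x powr \<gamma> * (1 + \<gamma>/2 * t + C * t\<^sup>2)"
      using t z by (intro mult_left_mono C) auto
    also have "\<dots> \<le> norm x powr \<gamma> * (1 + \<gamma>/2 * t + C * (6 * z\<^sup>2))"
      using t2 C by (intro mult_left_mono add_left_mono) auto
    also have "\<dots> = norm x powr \<gamma> + \<gamma> * (norm x powr \<gamma> / (norm x)\<^sup>2) * (x \<bullet> y)
        + (\<gamma>/2 + 6 * C) * (norm x powr \<gamma> * z\<^sup>2)"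
      unfolding teq w_def by (simp add: field_simps)
    also have "norm x powr \<gamma> / (norm x)\<^sup>2 = norm x powr (\<gamma> - 2)"
      using x by (simp add: powr_diff)
    finally have 1: "norm (x + y) powr \<gamma> \<le> norm x powr \<gamma> + \<gamma> * norm x powr (\<gamma> - 2) * (x \<bullet> y)
        + (\<gamma>/2 + 6 * C) * (norm x powr \<gamma> * z\<^sup>2)" .
    have "z\<^sup>2 \<le> z powr q"
    proof (cases "z = 0")
      case False
      then have "z powr 2 \<le> z powr q" using z q by (intro powr_mono') auto
      then show ?thesis using z False by (simp add: powr_numeral)
    qed simp
    then have "norm x powr \<gamma> * z\<^sup>2 \<le> norm x powr \<gamma> * z powr q" by (intro mult_left_mono) auto
    also have "\<dots> = norm x powr (\<gamma> - q) * norm y powr q"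
      using x by (simp add: z_def powr_divide powr_diff)
    finally have "(\<gamma>/2 + 6 * C) * (norm x powr \<gamma> * z\<^sup>2) \<le> (\<gamma>/2 + 6 * C) * (norm x powr (\<gamma> - q) * norm y powr q)"
      using assms C by (intro mult_left_mono) auto
    also have "\<dots> \<le> D * (norm x powr (\<gamma> - q) * norm y powr q)"
      using assms by (intro mult_right_mono) (auto simp: D_def)
    also have "\<dots> \<le> D * (norm x powr (\<gamma> - q) * norm y powr q + norm y powr \<gamma>)"
      using \<open>0 \<le> D\<close> by (intro mult_left_mono) auto
    finally show ?thesis using 1 by linarith
  qed
  ultimately show ?thesis using that by blast
qed

text \<open>Closes the induction over the number of summands: \<open>s\<close> stands for the sum so
  far and \<open>b\<close> for the new term. The gain of (s + b)^r over s^r is at least half of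
  s^(r-1) b + b^r, and 2 * C <= K lets it absorb the error term.\<close>

lemma powr_add_ge:
  fixes s b r K C :: real
  assumes "0 \<le> s" "0 \<le> b" "1 \<le> r" "1 \<le> K" "2 * C \<le> K" "0 \<le> C"
  shows "(K * s) powr r + C * ((K * s) powr (r - 1) * b + b powr r) \<le> (K * (s + b)) powr r"
proof -
  have base: "x powr (r - 1) * x = x powr r" if "0 \<le> x" for x :: real
    using that by (cases "x = 0") (auto simp: powr_mult_base mult.commute)
  have "s powr r + (s powr (r - 1) * b + b powr r) / 2 =
      s powr (r - 1) * s + (s powr (r - 1) * b) / 2 + (b powr (r - 1) * b) / 2"
    using assms by (simp add: base)
  also have "\<dots> \<le> (s + b) powr (r - 1) * s + ((s + b) powr (r - 1) * b) / 2 + ((s + b) powr (r - 1) * b) / 2"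
    using assms by (intro add_mono mult_right_mono divide_right_mono powr_mono2) auto
  also have "\<dots> = (s + b) powr (r - 1) * (s + b)" by (simp add: algebra_simps)
  also have "\<dots> = (s + b) powr r" using assms by (simp add: base)
  finally have 1: "s powr r + (s powr (r - 1) * b + b powr r) / 2 \<le> (s + b) powr r" .
  have K: "C * K powr (r - 1) \<le> K powr r / 2"
    using mult_right_mono[of "2*C" K "K powr (r - 1)"] assms base[of K]
    by (simp add: mult.commute[of K] mult.assoc)
  have "1 powr (r - 1) \<le> K powr (r - 1)" using assms by (intro powr_mono2) auto
  then have "C * 1 \<le> C * K powr (r - 1)" using assms by (intro mult_left_mono) auto
  with K have K2: "C \<le> K powr r / 2" by simp
  have "(K * s) powr r + C * ((K * s) powr (r - 1) * b + b powr r)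
     = K powr r * s powr r + (C * K powr (r - 1)) * (s powr (r - 1) * b) + C * b powr r"
    using assms by (simp add: powr_mult algebra_simps)
  also have "\<dots> \<le> K powr r * s powr r + (K powr r / 2) * (s powr (r - 1) * b) + (K powr r / 2) * b powr r"
    using assms K K2 by (intro add_mono mult_right_mono) auto
  also have "\<dots> = K powr r * (s powr r + (s powr (r - 1) * b + b powr r) / 2)" by (simp add: algebra_simps)
  also have "\<dots> \<le> K powr r * (s + b) powr r" using 1 by (intro mult_left_mono) auto
  finally show ?thesis using assms by (simp add: powr_mult)
qed

lemma (in prob_space) lyapunov_inequality:
  fixes X :: "'a \<Rightarrow> 'b :: {real_normed_vector, second_countable_topology}"
  assumes [measurable]: "X \<in> borel_measurable M"
    and int: "integrable M (\<lambda>w. norm (X w) powr \<gamma>)"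
    and p: "0 \<le> p" "p \<le> \<gamma>" "0 < \<gamma>"
  shows "integrable M (\<lambda>w. norm (X w) powr p)" (is ?int)
    and "(\<integral>w. norm (X w) powr p \<partial>M) \<le> (\<integral>w. norm (X w) powr \<gamma> \<partial>M) powr (p / \<gamma>)" (is ?le)
proof -
  show ?int
  proof (rule Bochner_Integration.integrable_bound)
    show "integrable M (\<lambda>w. 1 + norm (X w) powr \<gamma>)" using int by simp
    show "AE w in M. norm (norm (X w) powr p) \<le> norm (1 + norm (X w) powr \<gamma>)"
    proof (rule AE_I2)
      fix w
      show "norm (norm (X w) powr p) \<le> norm (1 + norm (X w) powr \<gamma>)"
      proof (cases "norm (X w) \<le> 1")
        case True
        then have "norm (X w) powr p \<le> 1 powr p" using p by (intro powr_mono2) auto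
        moreover have "0 \<le> norm (X w) powr \<gamma>" by simp
        ultimately have "norm (X w) powr p \<le> 1 + norm (X w) powr \<gamma>" unfolding powr_one_eq_one by linarith
        then show ?thesis by simp
      next
        case False
        then have "norm (X w) powr p \<le> norm (X w) powr \<gamma>" using p by (intro powr_mono) auto
        then show ?thesis by simp
      qed
    qed
  qed simp
  let ?m = "\<integral>w. norm (X w) powr \<gamma> \<partial>M"
  have "0 \<le> ?m" by simp
  show ?le
  proof (cases "?m = 0")
    case True
    then have "AE w in M. norm (X w) powr \<gamma> = 0"
      using int by (subst (asm) integral_nonneg_eq_0_iff_AE) auto
    then have "AE w in M. norm (X w) powr p = 0" by eventually_elim auto
    then have "(\<integral>w. norm (X w) powr p \<partial>M) = (\<integral>w. 0 \<partial>M)"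
      by (intro integral_cong_AE) auto
    then show ?thesis by simp
  next
    case False
    then have m: "0 < ?m" using \<open>0 \<le> ?m\<close> by linarith
    define \<theta> where "\<theta> = p / \<gamma>"
    have \<theta>: "0 \<le> \<theta>" "\<theta> \<le> 1" "\<gamma> * \<theta> = p" using p by (auto simp: \<theta>_def)
    have le: "norm (X w) powr p \<le> ?m powr \<theta> * (\<theta> * (norm (X w) powr \<gamma> / ?m) + (1 - \<theta>))" for w
    proof (cases "X w = 0")
      case False
      have "(norm (X w) powr \<gamma> / ?m) powr \<theta> * 1 powr (1 - \<theta>) \<le> \<theta> * (norm (X w) powr \<gamma> / ?m) + (1 - \<theta>) * 1"
        using \<theta> m False by (intro Youngs_inequality_0) auto
      then have "norm (X w) powr p / ?m powr \<theta> \<le> \<theta> * (norm (X w) powr \<gamma> / ?m) + (1 - \<theta>)"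
        using m \<theta> by (simp add: powr_divide powr_powr)
      then show ?thesis using m by (simp add: field_simps)
    qed (use m \<theta> in auto)
    have "(\<integral>w. norm (X w) powr p \<partial>M) \<le> (\<integral>w. ?m powr \<theta> * (\<theta> * (norm (X w) powr \<gamma> / ?m) + (1 - \<theta>)) \<partial>M)"
      using \<open>?int\<close> int le by (intro integral_mono) auto
    also have "\<dots> = ?m powr \<theta> * (\<theta> * (?m / ?m) + (1 - \<theta>))"
      using int by (simp add: prob_space)
    also have "\<dots> = ?m powr \<theta>" using m by simp
    finally show ?thesis by (simp add: \<theta>_def)
  qed
qed

lemma (in prob_space) integrable_inner_indep:
  fixes X Z :: "'a \<Rightarrow> 'b :: euclidean_space"
  assumes ind: "indep_var borel X borel Z" and X: "integrable M X" and Z: "integrable M Z"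
  shows "integrable M (\<lambda>w. X w \<bullet> Z w)"
    and "(\<integral>w. X w \<bullet> Z w \<partial>M) = (\<integral>w. X w \<partial>M) \<bullet> (\<integral>w. Z w \<partial>M)"
proof -
  have ind': "indep_var borel (\<lambda>w. X w \<bullet> b) borel (\<lambda>w. Z w \<bullet> b)" for b
    using indep_var_compose[OF ind, of "\<lambda>x. x \<bullet> b" borel "\<lambda>x. x \<bullet> b" borel] by (simp add: comp_def)
  have int: "integrable M (\<lambda>w. X w \<bullet> b)" "integrable M (\<lambda>w. Z w \<bullet> b)" for b
    using X Z by auto
  have eq: "(\<lambda>w. X w \<bullet> Z w) = (\<lambda>w. \<Sum>b\<in>Basis. (X w \<bullet> b) * (Z w \<bullet> b))"
    by (rule ext, rule euclidean_inner)
  have prod: "integrable M (\<lambda>w. (X w \<bullet> b) * (Z w \<bullet> b))"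
    "(\<integral>w. (X w \<bullet> b) * (Z w \<bullet> b) \<partial>M) = ((\<integral>w. X w \<partial>M) \<bullet> b) * ((\<integral>w. Z w \<partial>M) \<bullet> b)" for b
    using indep_var_integrable[OF ind'[of b] int[of b]] indep_var_lebesgue_integral[OF ind'[of b] int[of b]] X Z
    by auto
  show "integrable M (\<lambda>w. X w \<bullet> Z w)"
    unfolding eq by (rule Bochner_Integration.integrable_sum) (rule prod(1))
  show "(\<integral>w. X w \<bullet> Z w \<partial>M) = (\<integral>w. X w \<partial>M) \<bullet> (\<integral>w. Z w \<partial>M)"
    unfolding eq
    by (subst Bochner_Integration.integral_sum, rule prod(1), simp only: prod(2),
        rule euclidean_inner[symmetric])
qed

text \<open>The constant enters through a hypothesis so that every step of the induction over the
  summands uses the same one. The linear term has mean 0; the mixed term factorises by independence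
  and is then bounded by \<open>lyapunov_inequality\<close>.\<close>

lemma (in prob_space) moment_add_indep_le:
  fixes X Z :: "'a \<Rightarrow> 'b :: euclidean_space" and \<gamma> q :: real
  assumes \<gamma>: "1 < \<gamma>" and q: "q = min \<gamma> 2" and C0: "0 \<le> C"
    and C: "\<And>x y :: 'b. norm (x + y) powr \<gamma> \<le> norm x powr \<gamma> + \<gamma> * norm x powr (\<gamma> - 2) * (x \<bullet> y)
        + C * (norm x powr (\<gamma> - q) * norm y powr q + norm y powr \<gamma>)"
    and ind: "indep_var borel X borel Z"
    and X: "integrable M (\<lambda>w. norm (X w) powr \<gamma>)" and Z: "integrable M (\<lambda>w. norm (Z w) powr \<gamma>)"
    and Z0: "(\<integral>w. Z w \<partial>M) = 0"
  shows "integrable M (\<lambda>w. norm (X w + Z w) powr \<gamma>)" (is ?int)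
    and "(\<integral>w. norm (X w + Z w) powr \<gamma> \<partial>M) \<le> (\<integral>w. norm (X w) powr \<gamma> \<partial>M)
      + C * ((\<integral>w. norm (X w) powr \<gamma> \<partial>M) powr (1 - q / \<gamma>) * (\<integral>w. norm (Z w) powr \<gamma> \<partial>M) powr (q / \<gamma>)
        + (\<integral>w. norm (Z w) powr \<gamma> \<partial>M))" (is ?le)
proof -
  let ?x = "\<integral>w. norm (X w) powr \<gamma> \<partial>M"
  let ?z = "\<integral>w. norm (Z w) powr \<gamma> \<partial>M"
  have mX [measurable]: "X \<in> borel_measurable M" and mZ [measurable]: "Z \<in> borel_measurable M"
    using ind by (auto dest: indep_var_rv1 indep_var_rv2)
  have "integrable M (\<lambda>w. norm (Z w) powr 1)"
    by (rule lyapunov_inequality(1)[OF mZ Z]) (use \<gamma> in auto)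
  then have "integrable M (\<lambda>w. norm (Z w))" by simp
  then have Z1: "integrable M Z" by (rule integrable_norm_cancel) simp
  \<comment> \<open>Up to the factor \<gamma>, this is the gradient of the \<gamma>-th power of the
    norm. Its norm is |x|^(\<gamma>-1), also at 0, so the exponent \<gamma> - 2 does no harm when it
    is negative.\<close>
  let ?G = "\<lambda>x :: 'b. norm x powr (\<gamma> - 2) *\<^sub>R x"
  have G: "norm (?G x) = norm x powr (\<gamma> - 1)" for x
    by (cases "x = 0") (auto simp: powr_mult_base mult.commute)
  have "integrable M (\<lambda>w. norm (?G (X w)))"
    unfolding G using \<gamma> by (intro lyapunov_inequality(1)[OF mX X]) auto
  then have GX: "integrable M (\<lambda>w. ?G (X w))" by (rule integrable_norm_cancel) measurable
  have indG: "indep_var borel (\<lambda>w. ?G (X w)) borel Z"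
    by (rule indep_var_compose[OF ind, of ?G borel "\<lambda>x. x" borel, unfolded comp_def]) measurable
  have mid: "integrable M (\<lambda>w. norm (X w) powr (\<gamma> - 2) * (X w \<bullet> Z w))"
    "(\<integral>w. norm (X w) powr (\<gamma> - 2) * (X w \<bullet> Z w) \<partial>M) = 0"
    using integrable_inner_indep[OF indG GX Z1] Z0 by auto
  have qq: "0 \<le> q" "q \<le> \<gamma>" "0 \<le> \<gamma> - q" using q \<gamma> by auto
  have Xq: "integrable M (\<lambda>w. norm (X w) powr (\<gamma> - q))"
    "(\<integral>w. norm (X w) powr (\<gamma> - q) \<partial>M) \<le> ?x powr (1 - q / \<gamma>)"
    using lyapunov_inequality[OF mX X, of "\<gamma> - q"] qq \<gamma> by (auto simp: diff_divide_distrib)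
  have Zq: "integrable M (\<lambda>w. norm (Z w) powr q)"
    "(\<integral>w. norm (Z w) powr q \<partial>M) \<le> ?z powr (q / \<gamma>)"
    using lyapunov_inequality[OF mZ Z, of q] qq \<gamma> by auto
  have indq: "indep_var borel (\<lambda>w. norm (X w) powr (\<gamma> - q)) borel (\<lambda>w. norm (Z w) powr q)"
    by (rule indep_var_compose[OF ind, of "\<lambda>x. norm x powr (\<gamma> - q)" borel "\<lambda>x. norm x powr q" borel,
        unfolded comp_def]) measurable
  note prodq = indep_var_integrable[OF indq Xq(1) Zq(1)] indep_var_lebesgue_integral[OF indq Xq(1) Zq(1)]
  let ?R = "\<lambda>w. norm (X w) powr \<gamma> + \<gamma> * (norm (X w) powr (\<gamma> - 2) * (X w \<bullet> Z w))
        + C * (norm (X w) powr (\<gamma> - q) * norm (Z w) powr q + norm (Z w) powr \<gamma>)"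
  have R: "integrable M ?R"
    by (intro Bochner_Integration.integrable_add integrable_mult_right X Z mid(1) prodq(1))
  have le: "norm (X w + Z w) powr \<gamma> \<le> ?R w" for w
    using C[of "X w" "Z w"] by (simp add: mult.assoc)
  show ?int
  proof (rule Bochner_Integration.integrable_bound[OF R])
    show "(\<lambda>w. norm (X w + Z w) powr \<gamma>) \<in> borel_measurable M" by measurable
    show "AE w in M. norm (norm (X w + Z w) powr \<gamma>) \<le> norm (?R w)"
    proof (rule AE_I2)
      fix w
      show "norm (norm (X w + Z w) powr \<gamma>) \<le> norm (?R w)"
        unfolding real_norm_def using le[of w] powr_ge_zero[of "norm (X w + Z w)" \<gamma>] by linarith
    qed
  qed
  have "(\<integral>w. norm (X w + Z w) powr \<gamma> \<partial>M) \<le> (\<integral>w. ?R w \<partial>M)"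
    by (rule integral_mono[OF \<open>?int\<close> R le])
  also have "\<dots> = ?x
      + C * ((\<integral>w. norm (X w) powr (\<gamma> - q) \<partial>M) * (\<integral>w. norm (Z w) powr q \<partial>M) + ?z)"
    by (simp only: Bochner_Integration.integral_add Bochner_Integration.integrable_add integrable_mult_right
        X Z mid prodq integral_mult_right_zero mult_zero_right add_0_right)
  also have "\<dots> \<le> ?x
      + C * (?x powr (1 - q / \<gamma>) * ?z powr (q / \<gamma>)
        + ?z)"
    using C0 by (intro add_mono mult_left_mono mult_mono order_refl Xq(2) Zq(2)) auto
  finally show ?le .
qed

text \<open>With \<open>q = min \<gamma> 2\<close> this contains both the von Bahr-Esseen inequality (\<open>\<gamma> \<le> 2\<close>) and the
  Marcinkiewicz-Zygmund-type inequality that follows from Rosenthal's (\<open>\<gamma> > 2\<close>).\<close>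

lemma sum_indep_centred_moment_le:
  fixes \<gamma> q :: real
  assumes \<gamma>: "1 < \<gamma>" and q: "q = min \<gamma> 2"
  obtains K :: real where "1 \<le> K"
    "\<And>(M :: 'w measure) J (\<xi> :: 'i \<Rightarrow> 'w \<Rightarrow> 'b :: euclidean_space).
      prob_space M \<Longrightarrow> finite J \<Longrightarrow> prob_space.indep_vars M (\<lambda>_. borel) \<xi> J \<Longrightarrow>
      (\<And>j. j \<in> J \<Longrightarrow> integrable M (\<lambda>w. norm (\<xi> j w) powr \<gamma>)) \<Longrightarrow>
      (\<And>j. j \<in> J \<Longrightarrow> (\<integral>w. \<xi> j w \<partial>M) = 0) \<Longrightarrow>
      integrable M (\<lambda>w. norm (\<Sum>j\<in>J. \<xi> j w) powr \<gamma>) \<and>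
      (\<integral>w. norm (\<Sum>j\<in>J. \<xi> j w) powr \<gamma> \<partial>M)
        \<le> (K * (\<Sum>j\<in>J. (\<integral>w. norm (\<xi> j w) powr \<gamma> \<partial>M) powr (q / \<gamma>))) powr (\<gamma> / q)"
proof -
  obtain C where C: "0 \<le> C"
    "\<And>x y :: 'b. norm (x + y) powr \<gamma> \<le> norm x powr \<gamma> + \<gamma> * norm x powr (\<gamma> - 2) * (x \<bullet> y)
        + C * (norm x powr (\<gamma> - q) * norm y powr q + norm y powr \<gamma>)"
    using norm_add_powr_le[OF assms] by metis
  \<comment> \<open>\<open>K\<close> is fixed before the measure space and the index set are chosen,
    so the bound is uniform in the number of summands; 2 * C is what \<open>powr_add_ge\<close> asks
    for.\<close>
  define K where "K = max 1 (2 * C)"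
  have qq: "0 < q" "q \<le> \<gamma>" using q \<gamma> by auto
  define r where "r = \<gamma> / q"
  have r: "1 \<le> r" "q / \<gamma> = 1 / r" using qq by (auto simp: r_def)
  show ?thesis
  proof (rule that)
    show "1 \<le> K" by (simp add: K_def)
  next
    fix M :: "'w measure" and J :: "'i set" and \<xi> :: "'i \<Rightarrow> 'w \<Rightarrow> 'b"
    assume "prob_space M"
    then interpret prob_space M .
    assume "finite J" "indep_vars (\<lambda>_. borel) \<xi> J"
      "\<And>j. j \<in> J \<Longrightarrow> integrable M (\<lambda>w. norm (\<xi> j w) powr \<gamma>)"
      "\<And>j. j \<in> J \<Longrightarrow> (\<integral>w. \<xi> j w \<partial>M) = 0"
    then show "integrable M (\<lambda>w. norm (\<Sum>j\<in>J. \<xi> j w) powr \<gamma>) \<and>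
      (\<integral>w. norm (\<Sum>j\<in>J. \<xi> j w) powr \<gamma> \<partial>M)
        \<le> (K * (\<Sum>j\<in>J. (\<integral>w. norm (\<xi> j w) powr \<gamma> \<partial>M) powr (q / \<gamma>))) powr (\<gamma> / q)"
    proof (induction J rule: finite_induct)
      case empty
      then show ?case by simp
    next
      case (insert i J)
      have [measurable]: "\<xi> j \<in> borel_measurable M" if "j \<in> insert i J" for j
        using insert.prems(1) that by (auto simp: indep_vars_def2)
      have sub: "indep_vars (\<lambda>_. borel) \<xi> J"
        by (rule indep_vars_subset[OF insert.prems(1)]) auto
      define X where "X = (\<lambda>w. \<Sum>j\<in>J. \<xi> j w)"
      have IH: "integrable M (\<lambda>w. norm (X w) powr \<gamma>)"
        "(\<integral>w. norm (X w) powr \<gamma> \<partial>M) \<le> (K * (\<Sum>j\<in>J. (\<integral>w. norm (\<xi> j w) powr \<gamma> \<partial>M) powr (q / \<gamma>))) powr (\<gamma> / q)"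
        using insert.IH[OF sub] insert.prems(2,3) unfolding X_def by auto
      have "indep_var (PiM J (\<lambda>_. borel)) (\<lambda>w. restrict (\<lambda>i. \<xi> i w) J)
          (PiM {i} (\<lambda>_. borel)) (\<lambda>w. restrict (\<lambda>i. \<xi> i w) {i})"
        using insert.hyps by (intro indep_var_restrict[OF insert.prems(1)]) auto
      from indep_var_compose[OF this, of "\<lambda>f. \<Sum>j\<in>J. f j" borel "\<lambda>f. f i" borel]
      have "indep_var borel ((\<lambda>f. \<Sum>j\<in>J. f j) \<circ> (\<lambda>w. restrict (\<lambda>i. \<xi> i w) J))
          borel ((\<lambda>f. f i) \<circ> (\<lambda>w. restrict (\<lambda>i. \<xi> i w) {i}))"
        by measurable
      then have ind: "indep_var borel X borel (\<xi> i)"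
        by (simp add: comp_def X_def)
      let ?h = "\<integral>w. norm (X w) powr \<gamma> \<partial>M"
      let ?e = "\<lambda>j. \<integral>w. norm (\<xi> j w) powr \<gamma> \<partial>M"
      define s where "s = (\<Sum>j\<in>J. ?e j powr (q / \<gamma>))"
      define b where "b = ?e i powr (q / \<gamma>)"
      have sb: "0 \<le> s" "0 \<le> b" by (auto simp: s_def b_def intro!: sum_nonneg)
      have b: "?e i = b powr r" using r by (simp add: b_def powr_powr)
      have "integrable M (\<lambda>w. norm (\<xi> i w) powr \<gamma>)" "(\<integral>w. \<xi> i w \<partial>M) = 0"
        using insert.prems(2,3) by blast+
      note add = moment_add_indep_le[OF \<gamma> q C ind IH(1) this]
      have h: "?h \<le> (K * s) powr r" using IH(2) by (simp add: s_def r_def)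
      have sum: "(\<lambda>w. norm (\<Sum>j\<in>insert i J. \<xi> j w) powr \<gamma>) = (\<lambda>w. norm (X w + \<xi> i w) powr \<gamma>)"
        using insert.hyps by (simp add: X_def add.commute)
      have "(\<integral>w. norm (X w + \<xi> i w) powr \<gamma> \<partial>M) \<le> ?h + C * (?h powr (1 - q / \<gamma>) * b + ?e i)"
        unfolding b_def by (rule add(2))
      also have "\<dots> \<le> (K * s) powr r + C * (((K * s) powr r) powr (1 - q / \<gamma>) * b + ?e i)"
        using h C sb qq \<gamma> by (intro add_mono mult_left_mono mult_right_mono powr_mono2) auto
      also have "((K * s) powr r) powr (1 - q / \<gamma>) = (K * s) powr (r - 1)"
        using r by (simp add: powr_powr right_diff_distrib)
      also have "(K * s) powr r + C * ((K * s) powr (r - 1) * b + ?e i) \<le> (K * (s + b)) powr r"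
        unfolding b by (rule powr_add_ge) (use sb r C in \<open>auto simp: K_def\<close>)
      also have "s + b = (\<Sum>j\<in>insert i J. ?e j powr (q / \<gamma>))"
        using insert.hyps by (simp add: s_def b_def)
      finally show ?case
        unfolding sum r_def using add(1) by blast
    qed
  qed
qed

section \<open>Elementary power inequalities, matrix products and trees\<close>

lemma sum_powr_le_card:
  fixes x :: "'i \<Rightarrow> real"
  assumes "finite S" "\<And>i. i \<in> S \<Longrightarrow> 0 \<le> x i" "1 \<le> \<gamma>"
  shows "(\<Sum>i\<in>S. x i) powr \<gamma> \<le> real (card S) powr (\<gamma> - 1) * (\<Sum>i\<in>S. x i powr \<gamma>)"
proof -
  \<comment> \<open>Only the positive summands enter the convexity inequality. Zero summands change
    neither sum, and card T <= card S restores the stated factor.\<close>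
  define T where "T = {i\<in>S. 0 < x i}"
  have T: "finite T" "T \<subseteq> S" using assms by (auto simp: T_def)
  have 0: "x i = 0" if "i \<in> S - T" for i using assms(2)[of i] that by (auto simp: T_def)
  have sT: "(\<Sum>i\<in>S. x i) = (\<Sum>i\<in>T. x i)" "(\<Sum>i\<in>S. x i powr \<gamma>) = (\<Sum>i\<in>T. x i powr \<gamma>)"
    using assms T 0 by (auto intro!: sum.mono_neutral_right)
  show ?thesis
  proof (cases "T = {}")
    case False
    define c where "c = real (card T)"
    have c: "0 < c" "c \<le> real (card S)"
      using False T assms by (auto simp: c_def card_gt_0_iff intro: card_mono)
    have "(\<Sum>i\<in>T. (1/c) *\<^sub>R x i) powr \<gamma> \<le> (\<Sum>i\<in>T. (1/c) * x i powr \<gamma>)"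
      by (rule convex_on_sum[OF T(1) False powr_convex[OF assms(3)], of "\<lambda>_. 1/c" x])
         (use T c False in \<open>auto simp: T_def c_def\<close>)
    then have "((\<Sum>i\<in>T. x i) / c) powr \<gamma> \<le> (\<Sum>i\<in>T. x i powr \<gamma>) / c"
      by (simp add: sum_divide_distrib)
    then have "(\<Sum>i\<in>T. x i) powr \<gamma> \<le> c powr \<gamma> * ((\<Sum>i\<in>T. x i powr \<gamma>) / c)"
      using c by (simp add: powr_divide T_def sum_nonneg field_simps)
    also have "\<dots> = c powr (\<gamma> - 1) * (\<Sum>i\<in>T. x i powr \<gamma>)"
      using c by (simp add: powr_diff)
    also have "\<dots> \<le> real (card S) powr (\<gamma> - 1) * (\<Sum>i\<in>T. x i powr \<gamma>)"
      using c assms by (intro mult_right_mono powr_mono2 sum_nonneg) auto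
    finally show ?thesis unfolding sT .
  qed (simp add: sT)
qed

text \<open>Either b <= \<delta> a, and the sum is at most (1 + \<delta>) a, or a < b / \<delta>. A
  small \<delta> keeps the factor of the first term close to 1, as the contraction in
  \<open>nonneg_moment_decay\<close> demands.\<close>

lemma add_powr_le:
  fixes a b \<delta> :: real
  assumes "0 \<le> a" "0 \<le> b" "0 < \<delta>" "0 \<le> \<gamma>"
  shows "(a + b) powr \<gamma> \<le> (1 + \<delta>) powr \<gamma> * a powr \<gamma> + (1 + 1/\<delta>) powr \<gamma> * b powr \<gamma>"
proof (cases "b \<le> \<delta> * a")
  case True
  have "(a + b) powr \<gamma> \<le> ((1 + \<delta>) * a) powr \<gamma>"
    using True assms by (intro powr_mono2) (auto simp: algebra_simps)
  also have "\<dots> = (1 + \<delta>) powr \<gamma> * a powr \<gamma>" using assms by (simp add: powr_mult)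
  finally show ?thesis by (smt (verit) mult_nonneg_nonneg powr_ge_zero)
next
  case False
  have "(a + b) powr \<gamma> \<le> ((1 + 1/\<delta>) * b) powr \<gamma>"
    using False assms by (intro powr_mono2) (auto simp: field_simps)
  also have "\<dots> = (1 + 1/\<delta>) powr \<gamma> * b powr \<gamma>" using assms by (simp add: powr_mult)
  finally show ?thesis by (smt (verit) mult_nonneg_nonneg powr_ge_zero)
qed

text \<open>Each \<open>x i\<close> is at most the whole sum; this bounds the factor
  \<open>x i powr (s - 1)\<close> uniformly and leaves the sum itself.\<close>

lemma sum_powr_le_powr_sum:
  fixes x :: "'i \<Rightarrow> real"
  assumes "finite S" "\<And>i. i \<in> S \<Longrightarrow> 0 \<le> x i" "1 \<le> s"
  shows "(\<Sum>i\<in>S. x i powr s) \<le> (\<Sum>i\<in>S. x i) powr s"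
proof -
  have base: "y powr (s - 1) * y = y powr s" if "0 \<le> y" for y :: real
    using that by (cases "y = 0") (auto simp: powr_mult_base mult.commute)
  have "(\<Sum>i\<in>S. x i powr s) = (\<Sum>i\<in>S. x i powr (s - 1) * x i)"
    using assms by (intro sum.cong) (auto simp: base)
  also have "\<dots> \<le> (\<Sum>i\<in>S. (\<Sum>i\<in>S. x i) powr (s - 1) * x i)"
    using assms by (intro sum_mono mult_right_mono powr_mono2 member_le_sum) auto
  also have "\<dots> = (\<Sum>i\<in>S. x i) powr (s - 1) * (\<Sum>i\<in>S. x i)" by (simp add: sum_distrib_left)
  also have "\<dots> = (\<Sum>i\<in>S. x i) powr s" using assms by (simp add: base sum_nonneg)
  finally show ?thesis .
qed

text \<open>Interpolates the \<open>q\<close>-norm between the \<open>1\<close>-norm, with a factor that is small for small \<open>\<delta>\<close>,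
  and the \<open>\<gamma>\<close>-norm, by comparing the largest \<open>b i\<close> with \<open>\<delta>\<close> times the sum.\<close>

lemma sum_powr_interpolation:
  fixes b :: "'i \<Rightarrow> real"
  assumes "finite S" and b: "\<And>i. i \<in> S \<Longrightarrow> 0 \<le> b i" and q: "1 < q" "q \<le> \<gamma>" and \<delta>: "0 < \<delta>"
  shows "(\<Sum>i\<in>S. b i powr q) powr (\<gamma> / q) \<le>
    \<delta> powr ((q - 1) * (\<gamma> / q)) * (\<Sum>i\<in>S. b i) powr \<gamma> + \<delta> powr (- \<gamma>) * (\<Sum>i\<in>S. b i powr \<gamma>)"
proof -
  define s where "s = (\<Sum>i\<in>S. b i)"
  have s: "0 \<le> s" by (simp add: s_def sum_nonneg b)
  have base: "y powr (q - 1) * y = y powr q" if "0 \<le> y" for y :: real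
    using that by (cases "y = 0") (auto simp: powr_mult_base mult.commute)
  show ?thesis
  proof (cases "\<forall>i\<in>S. b i \<le> \<delta> * s")
    case True
    have "(\<Sum>i\<in>S. b i powr q) = (\<Sum>i\<in>S. b i powr (q - 1) * b i)"
      using b by (intro sum.cong) (auto simp: base)
    also have "\<dots> \<le> (\<Sum>i\<in>S. (\<delta> * s) powr (q - 1) * b i)"
      using True b q by (intro sum_mono mult_right_mono powr_mono2) auto
    also have "\<dots> = \<delta> powr (q - 1) * s powr q"
      using \<delta> s by (simp add: powr_mult s_def flip: base sum_distrib_left)
    finally have "(\<Sum>i\<in>S. b i powr q) powr (\<gamma> / q) \<le> (\<delta> powr (q - 1) * s powr q) powr (\<gamma> / q)"
      using q by (intro powr_mono2) (auto intro: sum_nonneg)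
    also have "\<dots> = \<delta> powr ((q - 1) * (\<gamma> / q)) * s powr \<gamma>"
      using q by (simp add: powr_mult powr_powr)
    finally show ?thesis
      unfolding s_def by (smt (verit) mult_nonneg_nonneg powr_ge_zero sum_nonneg)
  next
    case False
    then obtain j where j: "j \<in> S" "\<delta> * s < b j" by force
    have "(\<Sum>i\<in>S. b i powr q) powr (\<gamma> / q) \<le> (s powr q) powr (\<gamma> / q)"
      unfolding s_def using q b assms(1)
      by (intro powr_mono2 sum_powr_le_powr_sum) (auto intro: sum_nonneg)
    also have "\<dots> = s powr \<gamma>" using q by (simp add: powr_powr)
    also have "s powr \<gamma> = \<delta> powr (- \<gamma>) * (\<delta> * s) powr \<gamma>"
      using \<delta> s by (simp add: powr_mult powr_minus)
    also have "\<dots> \<le> \<delta> powr (- \<gamma>) * b j powr \<gamma>"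
      using j \<delta> s q by (intro mult_left_mono powr_mono2) auto
    also have "\<dots> \<le> \<delta> powr (- \<gamma>) * (\<Sum>i\<in>S. b i powr \<gamma>)"
      using j assms(1) by (intro mult_left_mono member_le_sum) auto
    finally show ?thesis
      by (smt (verit) mult_nonneg_nonneg powr_ge_zero)
  qed
qed

section \<open>Branch products and their entrywise powers\<close>

lemma branch_prod_Nil [simp]: "branch_prod A [] = mat 1"
  by (simp add: branch_prod_def)

lemma branch_prod_snoc: "branch_prod A (u @ [k]) = branch_prod A u ** A (u @ [k])"
proof -
  \<comment> \<open>The last factor is pulled out of the fold; for indices up to
    \<open>length u\<close> the prefixes of \<open>u\<close> and of \<open>u @ [k]\<close>
    agree.\<close>
  have *: "foldr (\<lambda>j B. A (take j (u @ [k])) ** B) js C = foldr (\<lambda>j B. A (take j u) ** B) js (mat 1) ** C"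
    if "\<forall>j\<in>set js. j \<le> length u" for js C
    using that by (induction js) (auto simp: matrix_mul_assoc)
  have "[1..<Suc (length (u @ [k]))] = [1..<Suc (length u)] @ [Suc (length u)]" by simp
  then show ?thesis
    unfolding branch_prod_def by (simp add: * del: upt_Suc take_append)
qed

lemma branch_prod_nonneg:
  fixes H :: "nat list \<Rightarrow> real ^ 'p ^ 'p"
  assumes "\<And>u i j. 0 \<le> H u $ i $ j"
  shows "0 \<le> branch_prod H u $ i $ j"
proof (induction u arbitrary: i j rule: rev_induct)
  case (snoc k u)
  then show ?case
    unfolding branch_prod_snoc by (simp add: matrix_matrix_mult_def assms sum_nonneg)
qed (simp add: mat_def)

lemma cmat_branch_prod: "cmat (branch_prod H u) = branch_prod (\<lambda>u. cmat (H u)) u"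
proof (induction u rule: rev_induct)
  case Nil
  show ?case by (simp add: cmat_def mat_def vec_eq_iff)
next
  case (snoc k u)
  show ?case
    unfolding branch_prod_snoc snoc[symmetric]
    by (simp add: matrix_matrix_mult_def cmat_def vec_eq_iff)
qed

lemma cmod_branch_prod_le:
  "cmod (branch_prod A u $ i $ j) \<le> branch_prod (\<lambda>u. abs_mat (A u)) u $ i $ j"
proof (induction u arbitrary: i j rule: rev_induct)
  case Nil
  show ?case by (simp add: mat_def)
next
  case (snoc k u)
  have "cmod (branch_prod A (u @ [k]) $ i $ j) \<le>
      (\<Sum>l\<in>UNIV. cmod (branch_prod A u $ i $ l) * cmod (A (u @ [k]) $ l $ j))"
    unfolding branch_prod_snoc by (simp add: matrix_matrix_mult_def sum_norm_le norm_mult)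
  also have "\<dots> \<le> (\<Sum>l\<in>UNIV. branch_prod (\<lambda>u. abs_mat (A u)) u $ i $ l * cmod (A (u @ [k]) $ l $ j))"
    by (intro sum_mono mult_right_mono snoc) auto
  also have "\<dots> = branch_prod (\<lambda>u. abs_mat (A u)) (u @ [k]) $ i $ j"
    unfolding branch_prod_snoc by (simp add: matrix_matrix_mult_def abs_mat_def)
  finally show ?case .
qed

text \<open>The factor p^(t-1) is the price of the power mean inequality for the p summands in one
  entry of a matrix product. Built into every matrix, it makes \<open>branch_prod_powr_le\<close> an
  induction without further constants.\<close>

definition entry_powr :: "real \<Rightarrow> real ^ 'p ^ 'p \<Rightarrow> real ^ 'p ^ 'p" where
  "entry_powr t B = (\<chi> i j. real CARD('p) powr (t - 1) * B $ i $ j powr t)"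

lemma entry_powr_nonneg [simp]: "0 \<le> entry_powr t B $ i $ j"
  by (simp add: entry_powr_def)

text \<open>The exponents of p match because (s - 1) t + (t - 1) = s t - 1. So the power
  \<alpha>/\<beta> of the \<beta>-matrices gives exactly the \<alpha>-matrices, which brings
  \<rho>(\<alpha>) into the case \<alpha> > 2.\<close>

lemma entry_powr_entry_powr:
  fixes B :: "real ^ 'p ^ 'p"
  assumes "0 < s"
  shows "entry_powr t (entry_powr s B) = entry_powr (s * t) B"
proof -
  have "real CARD('p) powr (t - 1) * (real CARD('p) powr (s - 1)) powr t = real CARD('p) powr (s * t - 1)"
    by (simp add: powr_powr algebra_simps flip: powr_add)
  then show ?thesis
    by (simp add: entry_powr_def vec_eq_iff powr_mult powr_powr flip: mult.assoc)
qed

lemma branch_prod_powr_le: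
  fixes H :: "nat list \<Rightarrow> real ^ 'p ^ 'p"
  assumes H: "\<And>u i j. 0 \<le> H u $ i $ j" and \<gamma>: "1 \<le> \<gamma>"
  shows "branch_prod H u $ i $ j powr \<gamma> \<le> branch_prod (\<lambda>u. entry_powr \<gamma> (H u)) u $ i $ j"
proof (induction u arbitrary: i j rule: rev_induct)
  case Nil
  show ?case by (simp add: mat_def)
next
  case (snoc k u)
  have "branch_prod H (u @ [k]) $ i $ j powr \<gamma> = (\<Sum>l\<in>UNIV. branch_prod H u $ i $ l * H (u @ [k]) $ l $ j) powr \<gamma>"
    unfolding branch_prod_snoc by (simp add: matrix_matrix_mult_def)
  also have "\<dots> \<le> real CARD('p) powr (\<gamma> - 1) * (\<Sum>l\<in>UNIV. (branch_prod H u $ i $ l * H (u @ [k]) $ l $ j) powr \<gamma>)"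
    using \<gamma> by (intro sum_powr_le_card mult_nonneg_nonneg H branch_prod_nonneg) auto
  also have "\<dots> = (\<Sum>l\<in>UNIV. branch_prod H u $ i $ l powr \<gamma> * entry_powr \<gamma> (H (u @ [k])) $ l $ j)"
    by (simp add: sum_distrib_left entry_powr_def powr_mult H branch_prod_nonneg mult_ac)
  also have "\<dots> \<le> (\<Sum>l\<in>UNIV. branch_prod (\<lambda>u. entry_powr \<gamma> (H u)) u $ i $ l * entry_powr \<gamma> (H (u @ [k])) $ l $ j)"
    by (intro sum_mono mult_right_mono snoc) auto
  also have "\<dots> = branch_prod (\<lambda>u. entry_powr \<gamma> (H u)) (u @ [k]) $ i $ j"
    unfolding branch_prod_snoc by (simp add: matrix_matrix_mult_def)
  finally show ?case .
qed

section \<open>Generations of the tree and their finite truncations\<close>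

lemma gw_tree_iff: "u \<in> gw_tree N \<longleftrightarrow> (\<forall>i<length u. 1 \<le> u ! i \<and> u ! i \<le> N (take i u))"
proof (induction u rule: rev_induct)
  case Nil
  show ?case by (simp add: gw_tree.root)
next
  case (snoc k u)
  have "u @ [k] \<in> gw_tree N \<longleftrightarrow> u \<in> gw_tree N \<and> 1 \<le> k \<and> k \<le> N u"
    by (auto elim: gw_tree.cases intro: gw_tree.child)
  then show ?case
    unfolding snoc by (auto simp: nth_append less_Suc_eq)
qed

lemma generation_0: "generation N 0 = {[]}"
  by (auto simp: generation_def gw_tree_iff)

lemma generation_Suc: "generation N (Suc n) = (\<lambda>(u, k). u @ [k]) ` (SIGMA u:generation N n. {1..N u})"
proof safe
  fix w assume "w \<in> generation N (Suc n)"
  then have "w \<in> gw_tree N" "length w = Suc n" by (auto simp: generation_def)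
  then show "w \<in> (\<lambda>(u, k). u @ [k]) ` (SIGMA u:generation N n. {1..N u})"
    by (cases rule: gw_tree.cases) (force simp: generation_def)+
qed (auto simp: generation_def intro: gw_tree.child)

lemma finite_generation [simp]: "finite (generation N n)"
  by (induction n) (auto simp: generation_0 generation_Suc intro!: finite_imageI finite_SigmaI)

lemma sum_generation_Suc:
  "(\<Sum>w\<in>generation N (Suc n). f w) = (\<Sum>u\<in>generation N n. \<Sum>k=1..N u. f (u @ [k]))"
proof -
  have "inj_on (\<lambda>(u, k). u @ [k]) (SIGMA u:generation N n. {1..N u})"
    by (auto simp: inj_on_def)
  then show ?thesis
    unfolding generation_Suc by (subst sum.reindex) (auto simp: sum.Sigma case_prod_unfold)
qed

definition level :: "nat \<Rightarrow> nat \<Rightarrow> nat list set" where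
  "level m n = {u. set u \<subseteq> {1..m} \<and> length u = n}"

lemma finite_level [simp]: "finite (level m n)"
  unfolding level_def by (rule finite_lists_length_eq) simp

lemma level_subset_nodes: "level m n \<subseteq> nodes"
  by (auto simp: level_def nodes_def)

lemma level_nodes: "u \<in> level m n \<Longrightarrow> u \<in> nodes"
  using level_subset_nodes by blast

lemma generation_nodes: "u \<in> generation N n \<Longrightarrow> u \<in> nodes"
  by (force simp: generation_def gw_tree_iff nodes_def in_set_conv_nth)

text \<open>The truncations \<open>generation N n \<inter> level m n\<close> exhaust the generation; a sum over them ranges over
  the fixed finite set \<open>level m n\<close>.\<close>

lemma eventually_generation_level: "eventually (\<lambda>m. generation N n \<subseteq> level m n) sequentially"
proof -
  have "finite (\<Union> (set ` generation N n))" by auto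
  then obtain k where k: "\<forall>x\<in>\<Union> (set ` generation N n). x \<le> k"
    using finite_nat_set_iff_bounded_le by meson
  show ?thesis
  proof (rule eventually_sequentiallyI[of k])
    fix m assume "k \<le> m"
    show "generation N n \<subseteq> level m n"
    proof
      fix u assume u: "u \<in> generation N n"
      have "x \<noteq> 0" if "x \<in> set u" for x
        using generation_nodes[OF u] that by (metis (mono_tags) mem_Collect_eq nodes_def)
      moreover have "x \<le> m" if "x \<in> set u" for x using k u that \<open>k \<le> m\<close> by force
      ultimately show "u \<in> level m n" using u by (force simp: level_def generation_def)
    qed
  qed
qed

lemma sum_generation_level:
  fixes f :: "nat list \<Rightarrow> 'a :: real_vector"
  shows "(\<Sum>u\<in>generation N n \<inter> level m n. f u) = (\<Sum>u\<in>level m n. of_bool (u \<in> gw_tree N) *\<^sub>R f u)"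
  by (rule sum.mono_neutral_cong_left[OF finite_level]) (auto simp: generation_def level_def)

section \<open>Perron-Frobenius eigenvectors\<close>

lemma mat_pow_0: "mat_pow B 0 = mat 1"
  by (simp add: mat_pow_def)

lemma mat_pow_Suc: "mat_pow B (Suc n) = B ** mat_pow B n"
  by (simp add: mat_pow_def)

lemma mat_pow_nonneg:
  fixes B :: "real ^ 'p ^ 'p"
  assumes "\<And>i j. 0 \<le> B $ i $ j"
  shows "0 \<le> mat_pow B n $ i $ j"
proof (induction n arbitrary: i j)
  case 0
  show ?case by (simp add: mat_pow_0 mat_def)
next
  case (Suc n)
  then show ?case
    by (simp add: mat_pow_Suc matrix_matrix_mult_def assms sum_nonneg)
qed

lemma mat_pow_cmat: "mat_pow (cmat B) n = cmat (mat_pow B n)"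
proof (induction n)
  case 0
  show ?case by (simp add: mat_pow_0 cmat_def mat_def vec_eq_iff)
next
  case (Suc n)
  then show ?case
    by (simp add: mat_pow_Suc) (simp add: cmat_def matrix_matrix_mult_def vec_eq_iff)
qed

lemma strictly_positive_cmat:
  "strictly_positive (cmat B) \<longleftrightarrow> (\<exists>n\<ge>1. \<forall>i j. 0 < mat_pow B n $ i $ j)"
  unfolding strictly_positive_def mat_pow_cmat by (simp add: cmat_def)

text \<open>A positive entry of a power comes from a path of positive entries, so only the zero
  pattern counts. This transfers strict positivity from \<open>Mhat P N A 1\<close> to
  \<open>Mhat P N A t\<close>.\<close>

lemma mat_pow_pos_mono:
  fixes B C :: "real ^ 'p ^ 'p"
  assumes B: "\<And>i j. 0 \<le> B $ i $ j" and C: "\<And>i j. 0 \<le> C $ i $ j"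
    and BC: "\<And>i j. 0 < B $ i $ j \<Longrightarrow> 0 < C $ i $ j"
  shows "0 < mat_pow B n $ i $ j \<Longrightarrow> 0 < mat_pow C n $ i $ j"
proof (induction n arbitrary: i j)
  case 0
  then show ?case by (simp add: mat_pow_0)
next
  case (Suc n)
  have "(\<Sum>l\<in>UNIV. B $ i $ l * mat_pow B n $ l $ j) \<noteq> 0"
    using Suc.prems by (simp add: mat_pow_Suc matrix_matrix_mult_def)
  then obtain l where l: "B $ i $ l * mat_pow B n $ l $ j \<noteq> 0"
    by (meson sum.neutral)
  then have "0 < B $ i $ l" "0 < mat_pow B n $ l $ j"
    using B mat_pow_nonneg[OF B] by (auto simp: less_le)
  then have "0 < C $ i $ l * mat_pow C n $ l $ j" using BC Suc.IH by simp
  also have "\<dots> \<le> (\<Sum>l\<in>UNIV. C $ i $ l * mat_pow C n $ l $ j)"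
    using C mat_pow_nonneg[OF C] by (intro member_le_sum) auto
  finally show ?case by (simp add: mat_pow_Suc matrix_matrix_mult_def)
qed

lemma mat_pow_eigenvector:
  fixes B :: "real ^ 'p ^ 'p"
  assumes "B *v x = r *\<^sub>R x"
  shows "mat_pow B n *v x = r ^ n *\<^sub>R x"
proof (induction n)
  case (Suc n)
  then show ?case
    by (simp add: mat_pow_Suc assms matrix_vector_mult_scaleR flip: matrix_vector_mul_assoc)
qed (simp add: mat_pow_0)

text \<open>Collatz-Wielandt argument: let c x be the smallest multiple of x that dominates |v| for
  an eigenvector v. At an index where equality holds, the eigenvalue equations of v and x give
  |\<mu>| <= r.\<close>

lemma pf_eigenvalueI:
  fixes B :: "real ^ 'p ^ 'p"
  assumes B: "\<And>i j. 0 \<le> B $ i $ j" and x: "\<And>i. 0 < x $ i" and eig: "B *v x = r *\<^sub>R x" and r: "0 \<le> r"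
  shows "pf_eigenvalue B = r"
proof -
  have le: "cmod \<mu> \<le> r" if \<mu>: "is_eigenvalue (cmat B) \<mu>" for \<mu>
  proof -
    obtain v where v: "v \<noteq> 0" "cmat B *v v = \<mu> *s v" using \<mu> unfolding is_eigenvalue_def by blast
    have "finite (range (\<lambda>i. cmod (v $ i) / x $ i))" "range (\<lambda>i. cmod (v $ i) / x $ i) \<noteq> {}" by auto
    from Max_in[OF this] obtain i where i: "Max (range (\<lambda>i. cmod (v $ i) / x $ i)) = cmod (v $ i) / x $ i"
      by (rule rangeE)
    define c where "c = cmod (v $ i) / x $ i"
    have c: "cmod (v $ j) \<le> c * x $ j" for j
    proof -
      have "cmod (v $ j) / x $ j \<le> c" unfolding c_def i[symmetric] by (rule Max_ge) auto
      then show ?thesis using x[of j] by (simp add: field_simps)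
    qed
    obtain j where "v $ j \<noteq> 0" using v by (auto simp: vec_eq_iff)
    then have "0 < c * x $ j" using c[of j] by (simp add: less_le_trans[of 0 "cmod (v $ j)"])
    then have c0: "0 < c" using x[of j] by (simp add: zero_less_mult_iff)
    have vi: "cmod (v $ i) = c * x $ i" using x[of i] by (simp add: c_def)
    have "cmod \<mu> * cmod (v $ i) = cmod ((cmat B *v v) $ i)" using v by (simp add: norm_mult)
    also have "\<dots> \<le> (\<Sum>j\<in>UNIV. B $ i $ j * cmod (v $ j))"
      unfolding matrix_vector_mult_def cmat_def
      by (simp, rule sum_norm_le) (simp add: norm_mult B)
    also have "\<dots> \<le> (\<Sum>j\<in>UNIV. B $ i $ j * (c * x $ j))"
      by (intro sum_mono mult_left_mono c B)
    also have "\<dots> = c * (B *v x) $ i"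
      by (simp add: matrix_vector_mult_def sum_distrib_left mult_ac)
    also have "\<dots> = r * cmod (v $ i)" by (simp add: eig vi)
    finally show ?thesis using c0 x[of i] by (simp add: vi)
  qed
  have ev: "is_eigenvalue (cmat B) (complex_of_real r)"
    unfolding is_eigenvalue_def
  proof (intro exI conjI)
    show "cvec x \<noteq> 0" using x by (auto simp: cvec_def vec_eq_iff less_le)
    have "(B *v x) $ i = r * x $ i" for i by (simp add: eig)
    then show "cmat B *v cvec x = complex_of_real r *s cvec x"
      by (simp add: matrix_vector_mult_def cmat_def cvec_def vec_eq_iff del: of_real_mult of_real_sum flip: of_real_mult of_real_sum)
  qed
  show ?thesis
    unfolding pf_eigenvalue_def
  proof (rule the_equality)
    show "0 \<le> r \<and> max_modulus_eigenvalue (cmat B) (complex_of_real r)"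
      using r ev le by (auto simp: max_modulus_eigenvalue_def)
  next
    fix s assume s: "0 \<le> s \<and> max_modulus_eigenvalue (cmat B) (complex_of_real s)"
    then have "s \<le> r" "r \<le> s"
      using le[of "complex_of_real s"] ev r by (auto simp: max_modulus_eigenvalue_def)
    then show "s = r" by simp
  qed
qed

text \<open>Brouwer's fixed point theorem on the standard simplex, for B x divided by the sum of its
  entries. Positivity of the n-th power excludes B x = 0, and it makes the fixed point positive
  because B^n x = r^n x.\<close>

lemma perron_frobenius:
  fixes B :: "real ^ 'p ^ 'p"
  assumes B: "\<And>i j. 0 \<le> B $ i $ j" and n: "1 \<le> n" and pos: "\<And>i j. 0 < mat_pow B n $ i $ j"
  obtains x where "\<And>i. 0 < x $ i" "B *v x = pf_eigenvalue B *\<^sub>R x" "0 \<le> pf_eigenvalue B"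
proof -
  define S :: "(real ^ 'p) set" where "S = {x. (\<forall>i. 0 \<le> x $ i) \<and> (\<Sum>i\<in>UNIV. x $ i) = 1}"
  define f where "f x = (1 / (\<Sum>i\<in>UNIV. (B *v x) $ i)) *\<^sub>R (B *v x)" for x
  have Bnn: "0 \<le> (B *v x) $ i" if "x \<in> S" for x i
    using that B by (auto simp: S_def matrix_vector_mult_def intro!: sum_nonneg)
  have powpos: "0 < (mat_pow B n *v x) $ i" if "x \<in> S" for x i
  proof -
    have "\<not> (\<forall>j. x $ j = 0)"
    proof
      assume "\<forall>j. x $ j = 0"
      then have "(\<Sum>j\<in>UNIV. x $ j) = 0" by simp
      with that show False by (simp add: S_def)
    qed
    then obtain j where j: "x $ j \<noteq> 0" by blast
    then have "0 < mat_pow B n $ i $ j * x $ j" using that pos by (auto simp: S_def less_le)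
    also have "\<dots> \<le> (\<Sum>j\<in>UNIV. mat_pow B n $ i $ j * x $ j)"
      using that mat_pow_nonneg[OF B] by (intro member_le_sum) (auto simp: S_def)
    finally show ?thesis by (simp add: matrix_vector_mult_def)
  qed
  \<comment> \<open>If the entries of B x sum to 0, then x is an eigenvector for 0 and B^n x = 0,
    since n >= 1.\<close>
  have Bpos: "0 < (\<Sum>i\<in>UNIV. (B *v x) $ i)" if "x \<in> S" for x
  proof (rule ccontr)
    assume "\<not> 0 < (\<Sum>i\<in>UNIV. (B *v x) $ i)"
    moreover have "0 \<le> (\<Sum>i\<in>UNIV. (B *v x) $ i)" using Bnn[OF that] by (rule sum_nonneg)
    ultimately have "(\<Sum>i\<in>UNIV. (B *v x) $ i) = 0" by simp
    then have "(B *v x) $ i = 0" for i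
      using Bnn[OF that] by (subst (asm) sum_nonneg_eq_0_iff) auto
    then have "B *v x = 0 *\<^sub>R x" by (simp add: vec_eq_iff)
    from mat_pow_eigenvector[OF this, of n] powpos[OF that] n show False by (auto simp: power_0_left)
  qed
  have "closed S"
    unfolding S_def
    by (intro closed_Collect_conj closed_Collect_all closed_Collect_le closed_Collect_eq continuous_intros)
  moreover have "bounded S"
    unfolding bounded_iff
  proof (intro exI ballI)
    fix x assume "x \<in> S"
    have "norm x \<le> (\<Sum>i\<in>UNIV. norm (x $ i))" by (simp add: norm_vec_def L2_set_le_sum)
    also have "\<dots> = 1" using \<open>x \<in> S\<close> by (simp add: S_def)
    finally show "norm x \<le> 1" .
  qed
  ultimately have "compact S" by (simp add: compact_eq_bounded_closed)
  moreover have "convex S"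
    by (auto simp: convex_def S_def sum.distrib simp flip: sum_distrib_left)
  moreover have "(\<chi> i. 1 / real CARD('p)) \<in> S" by (simp add: S_def)
  then have "S \<noteq> {}" by blast
  moreover have "continuous_on S f"
    unfolding f_def
    by (intro continuous_intros matrix_vector_mult_linear_continuous_on) (use Bpos in force)
  moreover have "f \<in> S \<rightarrow> S"
  proof
    fix x assume "x \<in> S"
    then show "f x \<in> S"
      using Bpos[of x] Bnn[of x] by (simp add: S_def f_def sum_divide_distrib[symmetric])
  qed
  ultimately obtain x where x: "x \<in> S" "f x = x" by (rule brouwer)
  define r where "r = (\<Sum>i\<in>UNIV. (B *v x) $ i)"
  have r: "0 < r" using Bpos[OF x(1)] by (simp add: r_def)
  have "r *\<^sub>R f x = B *v x" using r by (simp add: f_def r_def)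
  then have eig: "B *v x = r *\<^sub>R x" by (simp add: x)
  have xpos: "0 < x $ i" for i
    using powpos[OF x(1), of i] r by (simp add: mat_pow_eigenvector[OF eig] zero_less_mult_iff)
  have "pf_eigenvalue B = r" by (rule pf_eigenvalueI[OF B xpos eig]) (use r in auto)
  with xpos eig r show ?thesis by (intro that) auto
qed

section \<open>Independence along the tree\<close>

lemma borel_measurable_vec_nth [measurable (raw)]:
  fixes f :: "'w \<Rightarrow> 'a :: {second_countable_topology} ^ 'n"
  assumes "f \<in> borel_measurable M"
  shows "(\<lambda>w. f w $ i) \<in> borel_measurable M"
  using assms by (rule borel_measurable_continuous_on[rotated]) (intro continuous_intros)

lemma borel_measurable_vec_lambda [measurable (raw)]:
  fixes f :: "'w \<Rightarrow> 'n :: finite \<Rightarrow> 'a :: euclidean_space"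
  assumes [measurable]: "\<And>i. (\<lambda>w. f w i) \<in> borel_measurable M"
  shows "(\<lambda>w. \<chi> i. f w i) \<in> borel_measurable M"
  by (subst borel_measurable_euclidean_space) (auto simp: Basis_vec_def inner_axis)

lemma borel_measurable_matrix_matrix_mult [measurable (raw)]:
  fixes X Y :: "'w \<Rightarrow> 'a :: {euclidean_space, real_normed_algebra_1} ^ 'p ^ 'p"
  assumes [measurable]: "X \<in> borel_measurable M" "Y \<in> borel_measurable M"
  shows "(\<lambda>w. X w ** Y w) \<in> borel_measurable M"
  unfolding matrix_matrix_mult_def by measurable

lemma borel_measurable_matrix_vector_mult [measurable (raw)]:
  fixes X :: "'w \<Rightarrow> 'a :: {euclidean_space, real_normed_algebra_1} ^ 'p ^ 'p" and Y :: "'w \<Rightarrow> 'a ^ 'p"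
  assumes [measurable]: "X \<in> borel_measurable M" "Y \<in> borel_measurable M"
  shows "(\<lambda>w. X w *v Y w) \<in> borel_measurable M"
  unfolding matrix_vector_mult_def by measurable

lemma borel_measurable_abs_mat [measurable (raw)]:
  assumes [measurable]: "X \<in> borel_measurable M"
  shows "(\<lambda>w. abs_mat (X w)) \<in> borel_measurable M"
  unfolding abs_mat_def by measurable

lemma nodes_take: "u \<in> nodes \<Longrightarrow> take i u \<in> nodes"
  by (auto simp: nodes_def dest: in_set_takeD)

lemma nodes_snoc [simp]: "u @ [k] \<in> nodes \<longleftrightarrow> u \<in> nodes \<and> 1 \<le> k"
  by (auto simp: nodes_def)

lemma Nil_in_nodes [simp]: "[] \<in> nodes"
  by (simp add: nodes_def)

text \<open>By \<open>gw_tree_iff\<close> membership of u depends on N only at the proper prefixes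
  of u. The space \<open>F\<close> is arbitrary because the lemma is applied both to P and to the
  sub-algebra \<open>past n\<close>.\<close>

lemma measurable_gw_tree:
  assumes N: "\<And>v. v \<in> nodes \<Longrightarrow> length v < n \<Longrightarrow> N v \<in> measurable F (count_space UNIV)"
    and u: "u \<in> nodes" "length u \<le> n"
  shows "Measurable.pred F (\<lambda>w. u \<in> gw_tree (\<lambda>v. N v w))"
proof -
  have [measurable]: "N (take i u) \<in> measurable F (count_space UNIV)" if "i < length u" for i
    using that u by (intro N nodes_take) auto
  have "Measurable.pred F (\<lambda>w. \<forall>i\<in>{..<length u}. 1 \<le> u ! i \<and> u ! i \<le> N (take i u) w)"
    by (intro pred_intros_finite) measurable
  then show ?thesis by (simp add: gw_tree_iff Ball_def)
qed

lemma measurable_branch_prod: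
  fixes A :: "nat list \<Rightarrow> 'w \<Rightarrow> 'a :: {euclidean_space, real_normed_algebra_1} ^ 'p ^ 'p"
  assumes A: "\<And>v k. v \<in> nodes \<Longrightarrow> length v < n \<Longrightarrow> 1 \<le> k \<Longrightarrow> A (v @ [k]) \<in> borel_measurable F"
  shows "u \<in> nodes \<Longrightarrow> length u \<le> n \<Longrightarrow> (\<lambda>w. branch_prod (\<lambda>u. A u w) u) \<in> borel_measurable F"
proof (induction u rule: rev_induct)
  case (snoc k u)
  then have [measurable]: "A (u @ [k]) \<in> borel_measurable F" "(\<lambda>w. branch_prod (\<lambda>u. A u w) u) \<in> borel_measurable F"
    using A[of u k] by auto
  show ?case unfolding branch_prod_snoc by measurable
qed simp

lemma measurable_fst_mark_space [measurable]: "fst \<in> measurable mark_space (count_space UNIV)"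
  unfolding mark_space_def by measurable

lemma measurable_snd_mark_space:
  "1 \<le> k \<Longrightarrow> (\<lambda>s. snd s k) \<in> borel_measurable mark_space"
  unfolding mark_space_def
  by (rule measurable_compose[OF measurable_snd measurable_component_singleton]) simp

text \<open>Fatou's lemma in the form needed for sums over a random generation: the truncations to
  \<open>level m n\<close> agree with the full sum from some m on that depends on the point, and the
  bound is uniform in m.\<close>

lemma nn_integral_le_of_eventually_const:
  fixes h :: "nat \<Rightarrow> 'w \<Rightarrow> ennreal"
  assumes "\<And>m. h m \<in> borel_measurable M" "\<And>w. w \<in> space M \<Longrightarrow> eventually (\<lambda>m. h m w = H w) sequentially"
    and le: "\<And>m. (\<integral>\<^sup>+w. h m w \<partial>M) \<le> K"
  shows "(\<integral>\<^sup>+w. H w \<partial>M) \<le> K"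
proof -
  have "liminf (\<lambda>m. h m w) = H w" if "w \<in> space M" for w
    by (intro lim_imp_Liminf tendsto_eventually assms that) simp
  then have "(\<integral>\<^sup>+w. H w \<partial>M) = (\<integral>\<^sup>+w. liminf (\<lambda>m. h m w) \<partial>M)"
    by (intro nn_integral_cong) simp
  also have "\<dots> \<le> liminf (\<lambda>m. \<integral>\<^sup>+w. h m w \<partial>M)"
    by (rule nn_integral_liminf) (rule assms)
  also have "\<dots> \<le> liminf (\<lambda>m. K)"
    by (intro Liminf_mono always_eventually allI le)
  also have "\<dots> = K" by (simp add: Liminf_const)
  finally show ?thesis .
qed

lemma positive_vector_bound:
  fixes x :: "real ^ 'p"
  assumes x: "\<And>i. 0 < x $ i"
  obtains z where "0 < z" "\<And>i. z \<le> x $ i"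
proof
  have "Min (range (($) x)) \<in> range (($) x)" by (rule Min_in) auto
  then show "0 < Min (range (($) x))" using x by auto
  show "Min (range (($) x)) \<le> x $ i" for i by (rule Min_le) auto
qed

lemma nn_integral_le_mult:
  assumes "f \<in> borel_measurable M" "0 \<le> K" and le: "\<And>w. g w \<le> K * f w"
    and B: "(\<integral>\<^sup>+w. ennreal (f w) \<partial>M) \<le> ennreal B"
  shows "(\<integral>\<^sup>+w. ennreal (g w) \<partial>M) \<le> ennreal (K * B)"
proof -
  have "(\<integral>\<^sup>+w. ennreal (g w) \<partial>M) \<le> (\<integral>\<^sup>+w. ennreal K * ennreal (f w) \<partial>M)"
    using assms by (intro nn_integral_mono) (simp add: ennreal_leI flip: ennreal_mult')
  also have "\<dots> = ennreal K * (\<integral>\<^sup>+w. ennreal (f w) \<partial>M)"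
    using assms by (intro nn_integral_cmult) measurable
  also have "\<dots> \<le> ennreal (K * B)"
    using assms by (simp add: ennreal_mult' mult_left_mono)
  finally show ?thesis .
qed

text \<open>The product rule for preimages identifies the joint law of X and Z with the product of
  their laws; Tonelli's theorem then integrates over Z first.\<close>

lemma (in prob_space) nn_integral_indep_pair:
  assumes [measurable]: "X \<in> measurable M S" "Z \<in> measurable M T"
    and ind: "\<And>a b. a \<in> sets S \<Longrightarrow> b \<in> sets T \<Longrightarrow>
      prob ((X -` a \<inter> space M) \<inter> (Z -` b \<inter> space M)) = prob (X -` a \<inter> space M) * prob (Z -` b \<inter> space M)"
    and F: "F \<in> borel_measurable (S \<Otimes>\<^sub>M T)"
  shows "(\<integral>\<^sup>+w. F (X w, Z w) \<partial>M) = (\<integral>\<^sup>+w. \<integral>\<^sup>+w'. F (X w, Z w') \<partial>M \<partial>M)"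
proof -
  have F' [measurable]: "(\<lambda>z. F z) \<in> borel_measurable (S \<Otimes>\<^sub>M T)" by (rule F)
  interpret S: prob_space "distr M S X" by (rule prob_space_distr) simp
  interpret T: prob_space "distr M T Z" by (rule prob_space_distr) simp
  have FF: "F \<in> borel_measurable (distr M S X \<Otimes>\<^sub>M distr M T Z)" using F by simp
  have "(\<integral>\<^sup>+w. F (X w, Z w) \<partial>M) = (\<integral>\<^sup>+z. F z \<partial>distr M (S \<Otimes>\<^sub>M T) (\<lambda>w. (X w, Z w)))"
    by (subst nn_integral_distr) measurable
  also have "distr M (S \<Otimes>\<^sub>M T) (\<lambda>w. (X w, Z w)) = distr M S X \<Otimes>\<^sub>M distr M T Z"
  proof (rule pair_measure_eqI[symmetric])
    fix a b assume "a \<in> sets (distr M S X)" "b \<in> sets (distr M T Z)"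
    then have [measurable]: "a \<in> sets S" "b \<in> sets T" by auto
    have "(\<lambda>w. (X w, Z w)) -` (a \<times> b) \<inter> space M = (X -` a \<inter> space M) \<inter> (Z -` b \<inter> space M)"
      by auto
    then show "emeasure (distr M S X) a * emeasure (distr M T Z) b =
        emeasure (distr M (S \<Otimes>\<^sub>M T) (\<lambda>w. (X w, Z w))) (a \<times> b)"
      by (simp add: emeasure_distr emeasure_eq_measure ind ennreal_mult)
  qed (auto intro: S.sigma_finite_measure_axioms T.sigma_finite_measure_axioms)
  also have "(\<integral>\<^sup>+z. F z \<partial>(distr M S X \<Otimes>\<^sub>M distr M T Z)) = (\<integral>\<^sup>+x. \<integral>\<^sup>+z. F (x, z) \<partial>distr M T Z \<partial>distr M S X)"
    by (rule T.nn_integral_fst[OF FF, symmetric])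
  also have "\<dots> = (\<integral>\<^sup>+x. \<integral>\<^sup>+w'. F (x, Z w') \<partial>M \<partial>distr M S X)"
    by (intro nn_integral_cong nn_integral_distr) measurable
  also have "\<dots> = (\<integral>\<^sup>+w. \<integral>\<^sup>+w'. F (X w, Z w') \<partial>M \<partial>M)"
    by (rule nn_integral_distr) measurable
  finally show ?thesis .
qed

text \<open>Nothing but independence and equality in law of the marks is assumed, so the locale can
  be entered a second time with the nonnegative matrices
  \<open>cmat (abs_powr t u w)\<close>.\<close>

locale branching_marks = prob_space P for P :: "'w measure" +
  fixes N :: "nat list \<Rightarrow> 'w \<Rightarrow> nat" and A :: "nat list \<Rightarrow> 'w \<Rightarrow> complex ^ 'p ^ 'p"
  assumes indep: "indep_vars (\<lambda>_. mark_space) (mark N A) nodes"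
    and copies: "u \<in> nodes \<Longrightarrow> distr P mark_space (mark N A u) = distr P mark_space (mark N A [])"
begin

abbreviation gen :: "nat \<Rightarrow> 'w \<Rightarrow> nat list set" where
  "gen n w \<equiv> generation (\<lambda>u. N u w) n"

abbreviation weight :: "nat list \<Rightarrow> 'w \<Rightarrow> complex ^ 'p ^ 'p" where
  "weight u w \<equiv> branch_prod (\<lambda>u. A u w) u"

abbreviation abs_weight :: "nat list \<Rightarrow> 'w \<Rightarrow> real ^ 'p ^ 'p" where
  "abs_weight u w \<equiv> branch_prod (\<lambda>u. abs_mat (A u w)) u"

lemma measurable_mark: "u \<in> nodes \<Longrightarrow> mark N A u \<in> measurable P mark_space"
  using indep by (simp add: indep_vars_def2)

lemma fst_mark [simp]: "fst (mark N A u w) = N u w"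
  by (simp add: mark_def)

lemma snd_mark [simp]: "1 \<le> k \<Longrightarrow> snd (mark N A u w) k = A (u @ [k]) w"
  by (simp add: mark_def)

lemma measurable_N: "u \<in> nodes \<Longrightarrow> N u \<in> measurable P (count_space UNIV)"
  using measurable_compose[OF measurable_mark measurable_fst_mark_space] by simp

lemma measurable_A: "u \<in> nodes \<Longrightarrow> 1 \<le> k \<Longrightarrow> A (u @ [k]) \<in> borel_measurable P"
  using measurable_compose[OF measurable_mark measurable_snd_mark_space] by simp

lemma nn_integral_mark:
  assumes "u \<in> nodes" "\<psi> \<in> borel_measurable mark_space"
  shows "(\<integral>\<^sup>+w. \<psi> (mark N A u w) \<partial>P) = (\<integral>\<^sup>+w. \<psi> (mark N A [] w) \<partial>P)"
  using assms copies[of u]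
  by (simp add: measurable_mark flip: nn_integral_distr[of _ _ mark_space])

lemma integral_mark:
  fixes \<psi> :: "_ \<Rightarrow> 'b :: {banach, second_countable_topology}"
  assumes "u \<in> nodes" "\<psi> \<in> borel_measurable mark_space"
  shows "(\<integral>w. \<psi> (mark N A u w) \<partial>P) = (\<integral>w. \<psi> (mark N A [] w) \<partial>P)"
  using assms copies[of u]
  by (simp add: measurable_mark flip: integral_distr[of _ _ mark_space])

lemma integrable_mark:
  fixes \<psi> :: "_ \<Rightarrow> 'b :: {banach, second_countable_topology}"
  assumes "u \<in> nodes" "\<psi> \<in> borel_measurable mark_space"
  shows "integrable P (\<lambda>w. \<psi> (mark N A u w)) \<longleftrightarrow> integrable P (\<lambda>w. \<psi> (mark N A [] w))"
  using assms copies[of u]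
  by (simp add: measurable_mark flip: integrable_distr_eq[of _ _ mark_space])

text \<open>The mark of a node holds the matrices of its children. Marks of nodes of length below n
  thus determine generation n and the products along its branches, but not the offspring of that
  generation.\<close>

definition past :: "nat \<Rightarrow> 'w measure" where
  "past n = vimage_algebra (space P) (\<lambda>w. restrict (\<lambda>v. mark N A v w) {v\<in>nodes. length v < n})
     (PiM {v\<in>nodes. length v < n} (\<lambda>_. mark_space))"

lemma measurable_marks: "J \<subseteq> nodes \<Longrightarrow> (\<lambda>w. restrict (\<lambda>v. mark N A v w) J) \<in> measurable P (PiM J (\<lambda>_. mark_space))"
  by (intro measurable_restrict measurable_mark) auto

lemma marks_space: "J \<subseteq> nodes \<Longrightarrow> (\<lambda>w. restrict (\<lambda>v. mark N A v w) J) \<in> space P \<rightarrow> space (PiM J (\<lambda>_. mark_space))"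
  using measurable_space[OF measurable_marks] by blast

lemma space_past [simp]: "space (past n) = space P"
  by (simp add: past_def)

lemma sets_past: "sets (past n) = {(\<lambda>w. restrict (\<lambda>v. mark N A v w) {v\<in>nodes. length v < n}) -` B \<inter> space P | B.
    B \<in> sets (PiM {v\<in>nodes. length v < n} (\<lambda>_. mark_space))}"
  unfolding past_def by (rule sets_vimage_algebra2[OF marks_space]) auto

lemma measurable_past_imp: "X \<in> measurable (past n) S \<Longrightarrow> X \<in> measurable P S"
  by (rule measurable_mono[THEN subsetD, OF order_refl refl _ space_past])
     (auto simp: sets_past intro!: measurable_sets[OF measurable_marks])

lemma mark_measurable_past:
  assumes "v \<in> nodes" "length v < n"
  shows "mark N A v \<in> measurable (past n) mark_space"
proof -
  have "(\<lambda>w. restrict (\<lambda>v. mark N A v w) {v\<in>nodes. length v < n} v) \<in> measurable (past n) mark_space"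
    unfolding past_def
    by (rule measurable_compose[OF measurable_vimage_algebra1[OF marks_space] measurable_component_singleton])
       (use assms in auto)
  then show ?thesis using assms by simp
qed

lemma N_measurable_past: "v \<in> nodes \<Longrightarrow> length v < n \<Longrightarrow> N v \<in> measurable (past n) (count_space UNIV)"
  using measurable_compose[OF mark_measurable_past measurable_fst_mark_space] by simp

lemma A_measurable_past: "v \<in> nodes \<Longrightarrow> length v < n \<Longrightarrow> 1 \<le> k \<Longrightarrow> A (v @ [k]) \<in> borel_measurable (past n)"
  using measurable_compose[OF mark_measurable_past measurable_snd_mark_space] by simp

text \<open>The nodes of length below n and those of length n are disjoint blocks of an independent
  family.\<close>

lemma indep_past:
  assumes J: "J \<subseteq> nodes" "\<And>u. u \<in> J \<Longrightarrow> length u = n"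
    and a: "a \<in> sets (past n)" and b: "b \<in> sets (PiM J (\<lambda>_. mark_space))"
  shows "prob (a \<inter> ((\<lambda>w. restrict (\<lambda>v. mark N A v w) J) -` b \<inter> space P)) =
    prob a * prob ((\<lambda>w. restrict (\<lambda>v. mark N A v w) J) -` b \<inter> space P)"
proof -
  let ?K = "{v\<in>nodes. length v < n}"
  let ?G = "{(\<lambda>w. restrict (\<lambda>v. mark N A v w) J) -` B \<inter> space P | B. B \<in> sets (PiM J (\<lambda>_. mark_space))}"
  have "indep_var (PiM ?K (\<lambda>_. mark_space)) (\<lambda>w. restrict (\<lambda>v. mark N A v w) ?K)
      (PiM J (\<lambda>_. mark_space)) (\<lambda>w. restrict (\<lambda>v. mark N A v w) J)"
    using J by (intro indep_var_restrict[OF indep]) auto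
  then have *: "indep_set (sigma_sets (space P) (sets (past n))) (sigma_sets (space P) ?G)"
    unfolding indep_var_eq sets_past by blast
  have "(\<lambda>w. restrict (\<lambda>v. mark N A v w) J) -` b \<inter> space P \<in> sigma_sets (space P) ?G"
    using b by (intro sigma_sets.Basic) blast
  moreover have "a \<in> sigma_sets (space P) (sets (past n))" using a by (rule sigma_sets.Basic)
  ultimately show ?thesis using * unfolding indep_sets2_eq by blast
qed

text \<open>Extension by 0 off the tree: a sum over the random generation becomes a sum over a fixed
  finite set whose coefficients are measurable with respect to the past.\<close>

definition stopped_prod :: "nat list \<Rightarrow> 'w \<Rightarrow> complex ^ 'p ^ 'p" where
  "stopped_prod u w = of_bool (u \<in> gw_tree (\<lambda>v. N v w)) *\<^sub>R weight u w"

lemma measurable_stopped_prod: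
  assumes "u \<in> nodes" "length u = n"
  shows "stopped_prod u \<in> borel_measurable (past n)"
proof -
  have [measurable]: "Measurable.pred (past n) (\<lambda>w. u \<in> gw_tree (\<lambda>v. N v w))"
    by (rule measurable_gw_tree[OF N_measurable_past]) (use assms in auto)
  have [measurable]: "(\<lambda>w. weight u w) \<in> borel_measurable (past n)"
    by (rule measurable_branch_prod[where n = n]) (use assms A_measurable_past in auto)
  show ?thesis
    unfolding stopped_prod_def by measurable
qed

text \<open>Conditioning on the first \<open>n\<close> generations: the marks at level \<open>n\<close> are integrated out first.\<close>

lemma nn_integral_past_le:
  assumes J: "J \<subseteq> nodes" "\<And>u. u \<in> J \<Longrightarrow> length u = n"
    and X: "\<And>u. u \<in> J \<Longrightarrow> X u \<in> measurable (past n) S"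
    and F: "F \<in> borel_measurable (PiM J (\<lambda>_. S) \<Otimes>\<^sub>M PiM J (\<lambda>_. mark_space))"
    and le: "\<And>w. w \<in> space P \<Longrightarrow>
      (\<integral>\<^sup>+w'. F (restrict (\<lambda>u. X u w) J, restrict (\<lambda>u. mark N A u w') J) \<partial>P) \<le> B w"
  shows "(\<integral>\<^sup>+w. F (restrict (\<lambda>u. X u w) J, restrict (\<lambda>u. mark N A u w) J) \<partial>P) \<le> (\<integral>\<^sup>+w. B w \<partial>P)"
proof -
  have X': "(\<lambda>w. restrict (\<lambda>u. X u w) J) \<in> measurable (past n) (PiM J (\<lambda>_. S))"
    by (intro measurable_restrict X)
  have "(\<integral>\<^sup>+w. F (restrict (\<lambda>u. X u w) J, restrict (\<lambda>u. mark N A u w) J) \<partial>P) =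
      (\<integral>\<^sup>+w. \<integral>\<^sup>+w'. F (restrict (\<lambda>u. X u w) J, restrict (\<lambda>u. mark N A u w') J) \<partial>P \<partial>P)"
  proof (rule nn_integral_indep_pair[OF measurable_past_imp[OF X'] measurable_marks[OF J(1)] _ F])
    fix a b assume a: "a \<in> sets (PiM J (\<lambda>_. S))" and b: "b \<in> sets (PiM J (\<lambda>_. mark_space :: (nat \<times> (nat \<Rightarrow> complex ^ 'p ^ 'p)) measure))"
    have "(\<lambda>w. restrict (\<lambda>u. X u w) J) -` a \<inter> space P \<in> sets (past n)"
      using measurable_sets[OF X' a] by simp
    from indep_past[OF J(1) _ this b] J(2)
    show "prob (((\<lambda>w. restrict (\<lambda>u. X u w) J) -` a \<inter> space P) \<inter> ((\<lambda>w. restrict (\<lambda>v. mark N A v w) J) -` b \<inter> space P)) =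
      prob ((\<lambda>w. restrict (\<lambda>u. X u w) J) -` a \<inter> space P) * prob ((\<lambda>w. restrict (\<lambda>v. mark N A v w) J) -` b \<inter> space P)"
      by blast
  qed
  also have "\<dots> \<le> (\<integral>\<^sup>+w. B w \<partial>P)" by (rule nn_integral_mono) (rule le)
  finally show ?thesis .
qed

end

section \<open>Moments of the increments of the process\<close>

definition entry_sum :: "complex ^ 'p ^ 'p \<Rightarrow> real" where
  "entry_sum B = (\<Sum>i\<in>UNIV. \<Sum>j\<in>UNIV. cmod (B $ i $ j))"

lemma entry_sum_nonneg [simp]: "0 \<le> entry_sum B"
  by (simp add: entry_sum_def sum_nonneg)

lemma entry_sum_scaleR: "entry_sum (c *\<^sub>R B) = \<bar>c\<bar> * entry_sum B"
  by (simp add: entry_sum_def sum_distrib_left)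

lemma borel_measurable_entry_sum [measurable]: "entry_sum \<in> borel_measurable borel"
  unfolding entry_sum_def by measurable

lemma norm_le_sum_component: "norm x \<le> (\<Sum>i\<in>UNIV. norm (x $ i))"
  by (simp add: norm_vec_def L2_set_le_sum)

lemma norm_matrix_vector_mult_le: "norm (B *v d) \<le> entry_sum B * norm d"
proof -
  have "norm (B *v d) \<le> (\<Sum>i\<in>UNIV. cmod ((B *v d) $ i))" by (rule norm_le_sum_component)
  also have "\<dots> \<le> (\<Sum>i\<in>UNIV. \<Sum>j\<in>UNIV. cmod (B $ i $ j) * norm d)"
    unfolding matrix_vector_mult_def
    by (intro sum_mono) (auto intro!: sum_norm_le mult_left_mono Finite_Cartesian_Product.norm_nth_le simp: norm_mult)
  also have "\<dots> = entry_sum B * norm d" by (simp add: entry_sum_def sum_distrib_right)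
  finally show ?thesis .
qed

lemma scaleR_matrix_vector_mult: "(c *\<^sub>R B) *v d = c *\<^sub>R (B *v d)"
  for B :: "complex ^ 'p ^ 'p"
  by (simp add: matrix_vector_mult_def vec_eq_iff scaleR_sum_right)

lemma entry_sum_branch_prod_le:
  "entry_sum (branch_prod A u) \<le> (\<Sum>i\<in>UNIV. \<Sum>j\<in>UNIV. branch_prod (\<lambda>u. abs_mat (A u)) u $ i $ j)"
  unfolding entry_sum_def by (intro sum_mono cmod_branch_prod_le)

context branching_marks
begin

text \<open>The centred offspring vector when V is an eigenvector of the mean matrix for r: r = 1
  for the martingale, r = c for the auxiliary process in \<open>nonneg_moment_decay\<close>.\<close>

definition dev :: "real ^ 'p \<Rightarrow> real \<Rightarrow> nat \<times> (nat \<Rightarrow> complex ^ 'p ^ 'p) \<Rightarrow> complex ^ 'p" where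
  "dev V r s = (\<Sum>k=1..fst s. snd s k *v cvec V) - r *\<^sub>R cvec V"

lemma measurable_dev [measurable]: "dev V r \<in> borel_measurable mark_space"
proof -
  have "(\<lambda>s. \<Sum>k=1..n. snd s k *v cvec V) \<in> borel_measurable (mark_space :: (nat \<times> (nat \<Rightarrow> complex ^ 'p ^ 'p)) measure)" for n
    by (intro borel_measurable_sum borel_measurable_matrix_vector_mult measurable_snd_mark_space) auto
  from measurable_compose_countable[OF this measurable_fst_mark_space]
  have [measurable]: "(\<lambda>s. \<Sum>k=1..fst s. snd s k *v cvec V) \<in> borel_measurable (mark_space :: (nat \<times> (nat \<Rightarrow> complex ^ 'p ^ 'p)) measure)" .
  show ?thesis unfolding dev_def by measurable
qed

lemma mandelbrot_increment:
  "mandelbrot N A V (Suc n) w - r *\<^sub>R mandelbrot N A V n w =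
    (\<Sum>u\<in>gen n w. weight u w *v dev V r (mark N A u w))"
proof -
  have lin: "linear ((*v) B)" for B :: "complex ^ 'p ^ 'p"
    by (rule bounded_linear.linear) (rule matrix_vector_mul_bounded_linear)
  have "(\<Sum>k=1..N u w. branch_prod (\<lambda>u. A u w) (u @ [k]) *v cvec V) - r *\<^sub>R (weight u w *v cvec V)
      = weight u w *v dev V r (mark N A u w)" for u
    by (simp add: dev_def branch_prod_snoc linear_diff[OF lin] linear_scale[OF lin] linear_sum[OF lin]
        matrix_vector_mul_assoc)
  then show ?thesis
    unfolding mandelbrot_def sum_generation_Suc
    by (simp add: scaleR_sum_right flip: sum_subtractf)
qed

lemma sum_stopped_prod:
  "(\<Sum>u\<in>level m n. stopped_prod u w *v d u) =
    (\<Sum>u\<in>gen n w \<inter> level m n. weight u w *v d u)"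
  unfolding sum_generation_level stopped_prod_def scaleR_matrix_vector_mult ..

lemma sum_entry_sum_stopped_prod:
  "(\<Sum>u\<in>level m n. entry_sum (stopped_prod u w) powr q) =
    (\<Sum>u\<in>gen n w \<inter> level m n. entry_sum (weight u w) powr q)"
  unfolding sum_generation_level
  by (intro sum.cong) (auto simp: stopped_prod_def entry_sum_scaleR)

lemma eventually_sum_generation_level:
  "eventually (\<lambda>m. (\<Sum>u\<in>gen n w \<inter> level m n. f u) = (\<Sum>u\<in>gen n w. f u)) sequentially"
  using eventually_generation_level[of "\<lambda>u. N u w" n]
  by eventually_elim (simp add: Int_absorb2)

lemma measurable_sum_generation:
  fixes f :: "nat list \<Rightarrow> 'w \<Rightarrow> 'b :: {real_normed_vector, second_countable_topology}"
  assumes "\<And>u. u \<in> nodes \<Longrightarrow> length u = n \<Longrightarrow> f u \<in> borel_measurable P"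
  shows "(\<lambda>w. \<Sum>u\<in>gen n w. f u w) \<in> borel_measurable P"
proof (rule borel_measurable_LIMSEQ_metric)
  fix m
  show "(\<lambda>w. \<Sum>u\<in>level m n. of_bool (u \<in> gw_tree (\<lambda>v. N v w)) *\<^sub>R f u w) \<in> borel_measurable P"
  proof (rule borel_measurable_sum)
    fix u assume "u \<in> level m n"
    then have u: "u \<in> nodes" "length u = n" by (auto intro: level_nodes simp: level_def)
    have [measurable]: "Measurable.pred P (\<lambda>w. u \<in> gw_tree (\<lambda>v. N v w))"
      by (rule measurable_gw_tree[OF measurable_N u(1) order_refl])
    have [measurable]: "f u \<in> borel_measurable P" using assms u by simp
    show "(\<lambda>w. of_bool (u \<in> gw_tree (\<lambda>v. N v w)) *\<^sub>R f u w) \<in> borel_measurable P"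
      by measurable
  qed
next
  fix w
  show "(\<lambda>m. \<Sum>u\<in>level m n. of_bool (u \<in> gw_tree (\<lambda>v. N v w)) *\<^sub>R f u w) \<longlonglongrightarrow>
      (\<Sum>u\<in>gen n w. f u w)"
    unfolding sum_generation_level[symmetric]
    by (rule tendsto_eventually) (rule eventually_sum_generation_level)
qed

lemma measurable_branch_prods:
  assumes "u \<in> nodes"
  shows "(\<lambda>w. weight u w) \<in> borel_measurable P"
    "(\<lambda>w. abs_weight u w) \<in> borel_measurable P"
  by (rule measurable_branch_prod[where n = "length u"];
      use assms measurable_A in \<open>auto intro: borel_measurable_abs_mat\<close>)+

lemma measurable_mandelbrot [measurable]: "mandelbrot N A V n \<in> borel_measurable P"
proof -
  have "(\<lambda>w. \<Sum>u\<in>gen n w. weight u w *v cvec V) \<in> borel_measurable P"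
    by (intro measurable_sum_generation borel_measurable_matrix_vector_mult measurable_branch_prods) auto
  then show ?thesis by (simp add: mandelbrot_def[abs_def])
qed

text \<open>The products along the branches are first frozen to deterministic matrices
  (\<open>inner\<close>), where the inequality for independent centred sums applies;
  \<open>nn_integral_past_le\<close> puts the random ones back. This treats a fixed finite set of
  nodes, so the truncation is removed last, with a constant free of m and n.\<close>

lemma increment_moment_le:
  assumes \<gamma>: "1 < \<gamma>" and q: "q = min \<gamma> 2"
    and mean: "(\<integral>w. dev V r (mark N A [] w) \<partial>P) = 0"
    and moment: "integrable P (\<lambda>w. norm (dev V r (mark N A [] w)) powr \<gamma>)"
  obtains K :: real where "0 \<le> K"
    "\<And>n. (\<integral>\<^sup>+w. ennreal (norm (mandelbrot N A V (Suc n) w - r *\<^sub>R mandelbrot N A V n w) powr \<gamma>) \<partial>P)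
      \<le> ennreal K * (\<integral>\<^sup>+w. ennreal ((\<Sum>u\<in>gen n w.
            entry_sum (weight u w) powr q) powr (\<gamma> / q)) \<partial>P)"
proof -
  let ?Q = "\<lambda>n w. (\<Sum>u\<in>gen n w. entry_sum (weight u w) powr q) powr (\<gamma> / q)"
  let ?D = "\<lambda>u w. dev V r (mark N A u w)"
  obtain K where K: "1 \<le> K"
    "\<And>(M :: 'w measure) J (\<xi> :: nat list \<Rightarrow> 'w \<Rightarrow> complex ^ 'p).
      prob_space M \<Longrightarrow> finite J \<Longrightarrow> prob_space.indep_vars M (\<lambda>_. borel) \<xi> J \<Longrightarrow>
      (\<And>j. j \<in> J \<Longrightarrow> integrable M (\<lambda>w. norm (\<xi> j w) powr \<gamma>)) \<Longrightarrow>
      (\<And>j. j \<in> J \<Longrightarrow> (\<integral>w. \<xi> j w \<partial>M) = 0) \<Longrightarrow>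
      integrable M (\<lambda>w. norm (\<Sum>j\<in>J. \<xi> j w) powr \<gamma>) \<and>
      (\<integral>w. norm (\<Sum>j\<in>J. \<xi> j w) powr \<gamma> \<partial>M)
        \<le> (K * (\<Sum>j\<in>J. (\<integral>w. norm (\<xi> j w) powr \<gamma> \<partial>M) powr (q / \<gamma>))) powr (\<gamma> / q)"
    by (rule sum_indep_centred_moment_le[OF \<gamma> q]) blast
  have qq: "0 < q" "0 < \<gamma>" using q \<gamma> by auto
  define d where "d = (\<integral>w. norm (dev V r (mark N A [] w)) powr \<gamma> \<partial>P)"
  have d: "0 \<le> d" by (simp add: d_def)
  \<comment> \<open>The deviations all have the same \<gamma>-th moment \<open>d\<close>; it leaves
    the sum with total exponent (q/\<gamma>) (\<gamma>/q) = 1.\<close>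
  define K' where "K' = K powr (\<gamma> / q) * d"
  have K': "0 \<le> K'" using d by (simp add: K'_def)
  have inner: "(\<integral>\<^sup>+w. ennreal (norm (\<Sum>u\<in>J. x u *v ?D u w) powr \<gamma>) \<partial>P)
      \<le> ennreal (K' * (\<Sum>u\<in>J. entry_sum (x u) powr q) powr (\<gamma> / q))"
    if J: "finite J" "J \<subseteq> nodes" for J and x :: "nat list \<Rightarrow> complex ^ 'p ^ 'p"
  proof -
    define \<xi> where "\<xi> u w = x u *v ?D u w" for u w
    have mdev: "(\<lambda>w. ?D u w) \<in> borel_measurable P" if "u \<in> J" for u
      using measurable_compose[OF measurable_mark measurable_dev] that J by blast
    have m\<xi>: "\<xi> u \<in> borel_measurable P" if "u \<in> J" for u
      unfolding \<xi>_def using mdev[OF that] by measurable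
    have int: "integrable P (\<lambda>w. norm (?D u w) powr \<gamma>)"
      "(\<integral>w. norm (?D u w) powr \<gamma> \<partial>P) = d"
      "(\<integral>w. ?D u w \<partial>P) = 0" if "u \<in> J" for u
    proof -
      have u: "u \<in> nodes" using that J by auto
      have m: "(\<lambda>s. norm (dev V r s) powr \<gamma>) \<in> borel_measurable mark_space" by measurable
      show "integrable P (\<lambda>w. norm (?D u w) powr \<gamma>)"
        using integrable_mark[OF u m] moment by blast
      show "(\<integral>w. norm (?D u w) powr \<gamma> \<partial>P) = d"
        using integral_mark[OF u m] by (simp add: d_def)
      show "(\<integral>w. ?D u w \<partial>P) = 0"
        using integral_mark[OF u measurable_dev] mean by simp
    qed
    have le: "norm (\<xi> u w) powr \<gamma> \<le> entry_sum (x u) powr \<gamma> * norm (?D u w) powr \<gamma>" for u w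
      unfolding \<xi>_def using norm_matrix_vector_mult_le[of "x u"] qq
      by (subst powr_mult[symmetric]) (auto intro!: powr_mono2)
    have int\<xi>: "integrable P (\<lambda>w. norm (\<xi> u w) powr \<gamma>)" if "u \<in> J" for u
    proof (rule Bochner_Integration.integrable_bound)
      show "integrable P (\<lambda>w. entry_sum (x u) powr \<gamma> * norm (?D u w) powr \<gamma>)"
        using int(1)[OF that] by (rule integrable_mult_right)
      show "(\<lambda>w. norm (\<xi> u w) powr \<gamma>) \<in> borel_measurable P" using m\<xi>[OF that] by measurable
    qed (use le in simp)
    have "(\<integral>w. norm (\<xi> u w) powr \<gamma> \<partial>P) \<le> entry_sum (x u) powr \<gamma> * d" if "u \<in> J" for u
      using integral_mono[OF int\<xi>[OF that] integrable_mult_right[OF int(1)[OF that]] le] int(2)[OF that] by simp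
    then have le2: "(\<integral>w. norm (\<xi> u w) powr \<gamma> \<partial>P) powr (q / \<gamma>) \<le> entry_sum (x u) powr q * d powr (q / \<gamma>)" if "u \<in> J" for u
    proof -
      have "(\<integral>w. norm (\<xi> u w) powr \<gamma> \<partial>P) powr (q / \<gamma>) \<le> (entry_sum (x u) powr \<gamma> * d) powr (q / \<gamma>)"
        using qq that \<open>\<And>u. u \<in> J \<Longrightarrow> (\<integral>w. norm (\<xi> u w) powr \<gamma> \<partial>P) \<le> entry_sum (x u) powr \<gamma> * d\<close>
        by (intro powr_mono2) auto
      also have "\<dots> = entry_sum (x u) powr q * d powr (q / \<gamma>)"
        using d qq by (simp add: powr_mult powr_powr)
      finally show ?thesis .
    qed
    have mean\<xi>: "(\<integral>w. \<xi> u w \<partial>P) = 0" if "u \<in> J" for u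
    proof -
      have "integrable P (\<lambda>w. norm (?D u w) powr 1)"
        by (rule lyapunov_inequality(1)[OF mdev[OF that] int(1)[OF that]]) (use \<gamma> in auto)
      then have "integrable P (\<lambda>w. ?D u w)"
        using mdev[OF that] by (intro integrable_norm_cancel[of _ "\<lambda>w. ?D u w"]) auto
      from integral_bounded_linear[OF matrix_vector_mul_bounded_linear this] int(3)[OF that]
      show ?thesis by (simp add: \<xi>_def)
    qed
    have "indep_vars (\<lambda>_. borel) \<xi> J"
      unfolding \<xi>_def
      by (rule indep_vars_compose2[OF indep_vars_subset[OF indep J(2)], of "\<lambda>u s. x u *v dev V r s"]) measurable
    from K(2)[OF prob_space_axioms J(1) this int\<xi> mean\<xi>]
    have *: "integrable P (\<lambda>w. norm (\<Sum>u\<in>J. \<xi> u w) powr \<gamma>)"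
      "(\<integral>w. norm (\<Sum>j\<in>J. \<xi> j w) powr \<gamma> \<partial>P)
        \<le> (K * (\<Sum>j\<in>J. (\<integral>w. norm (\<xi> j w) powr \<gamma> \<partial>P) powr (q / \<gamma>))) powr (\<gamma> / q)" by auto
    note *(2)
    also have "(K * (\<Sum>j\<in>J. (\<integral>w. norm (\<xi> j w) powr \<gamma> \<partial>P) powr (q / \<gamma>))) powr (\<gamma> / q)
        \<le> (K * (\<Sum>j\<in>J. entry_sum (x j) powr q * d powr (q / \<gamma>))) powr (\<gamma> / q)"
      using K(1) qq le2 by (intro powr_mono2 mult_left_mono sum_mono mult_nonneg_nonneg sum_nonneg) auto
    also have "\<dots> = K' * (\<Sum>j\<in>J. entry_sum (x j) powr q) powr (\<gamma> / q)"
      using K(1) d qq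
      by (simp add: K'_def powr_mult powr_powr sum_nonneg mult_ac flip: sum_distrib_right sum_distrib_left)
    finally have "ennreal (\<integral>w. norm (\<Sum>j\<in>J. \<xi> j w) powr \<gamma> \<partial>P) \<le> ennreal (K' * (\<Sum>u\<in>J. entry_sum (x u) powr q) powr (\<gamma> / q))"
      by (rule ennreal_leI)
    then show ?thesis
      using nn_integral_eq_integral[OF *(1)] by (simp add: \<xi>_def)
  qed
  have "(\<integral>\<^sup>+w. ennreal (norm (mandelbrot N A V (Suc n) w - r *\<^sub>R mandelbrot N A V n w) powr \<gamma>) \<partial>P)
      \<le> ennreal K' * (\<integral>\<^sup>+w. ennreal (?Q n w) \<partial>P)" for n
    unfolding mandelbrot_increment
  proof (rule nn_integral_le_of_eventually_const)
    fix m
    let ?J = "level m n"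
    have lev: "?J \<subseteq> nodes" "\<And>u. u \<in> ?J \<Longrightarrow> length u = n"
      by (auto intro: level_nodes simp: level_def)
    have X: "stopped_prod u \<in> borel_measurable (past n)" if "u \<in> ?J" for u
      using measurable_stopped_prod lev that by blast
    have mdev: "(\<lambda>w. ?D u w) \<in> borel_measurable P" if "u \<in> ?J" for u
      using measurable_compose[OF measurable_mark measurable_dev] that lev by blast
    show "(\<lambda>w. ennreal (norm (\<Sum>u\<in>?J. stopped_prod u w *v ?D u w) powr \<gamma>)) \<in> borel_measurable P"
      using measurable_past_imp[OF X] mdev by measurable
    define F where "F = (\<lambda>(x, s). ennreal (norm (\<Sum>u\<in>?J. (x u :: complex ^ 'p ^ 'p) *v dev V r (s u)) powr \<gamma>))"
    have F: "F \<in> borel_measurable (PiM ?J (\<lambda>_. borel) \<Otimes>\<^sub>M PiM ?J (\<lambda>_. mark_space))"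
      unfolding F_def by measurable
    have "(\<integral>\<^sup>+w. F (restrict (\<lambda>u. stopped_prod u w) ?J, restrict (\<lambda>u. mark N A u w) ?J) \<partial>P)
      \<le> (\<integral>\<^sup>+w. ennreal (K' * (\<Sum>u\<in>?J. entry_sum (stopped_prod u w) powr q) powr (\<gamma> / q)) \<partial>P)"
    proof (rule nn_integral_past_le[OF lev X F])
      fix w assume "w \<in> space P"
      show "(\<integral>\<^sup>+w'. F (restrict (\<lambda>u. stopped_prod u w) ?J, restrict (\<lambda>u. mark N A u w') ?J) \<partial>P)
        \<le> ennreal (K' * (\<Sum>u\<in>?J. entry_sum (stopped_prod u w) powr q) powr (\<gamma> / q))"
        using inner[OF finite_level lev(1), of "\<lambda>u. stopped_prod u w"] by (simp add: F_def)
    qed auto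
    \<comment> \<open>Passing from the truncated to the full sum makes the bound independent of m,
      as the limit requires.\<close>
    also have "\<dots> \<le> (\<integral>\<^sup>+w. ennreal (K' * ?Q n w) \<partial>P)"
      unfolding sum_entry_sum_stopped_prod using K' qq
      by (intro nn_integral_mono ennreal_leI mult_left_mono powr_mono2 sum_mono2 sum_nonneg) auto
    also have "\<dots> = ennreal K' * (\<integral>\<^sup>+w. ennreal (?Q n w) \<partial>P)"
      unfolding ennreal_mult'[OF K']
    proof (rule nn_integral_cmult)
      have "(\<lambda>w. \<Sum>u\<in>gen n w. entry_sum (weight u w) powr q) \<in> borel_measurable P"
      proof (rule measurable_sum_generation)
        fix u assume "u \<in> nodes"
        note [measurable] = measurable_branch_prods(1)[OF this]
        show "(\<lambda>w. entry_sum (weight u w) powr q) \<in> borel_measurable P" by measurable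
      qed
      then show "(\<lambda>w. ennreal (?Q n w)) \<in> borel_measurable P"
        by measurable
    qed
    finally show "(\<integral>\<^sup>+w. ennreal (norm (\<Sum>u\<in>?J. stopped_prod u w *v ?D u w) powr \<gamma>) \<partial>P)
      \<le> ennreal K' * (\<integral>\<^sup>+w. ennreal (?Q n w) \<partial>P)"
      by (simp add: F_def)
  next
    fix w
    show "eventually (\<lambda>m. ennreal (norm (\<Sum>u\<in>level m n. stopped_prod u w *v ?D u w) powr \<gamma>) =
       ennreal (norm (\<Sum>u\<in>gen n w. weight u w *v ?D u w) powr \<gamma>)) sequentially"
      using eventually_sum_generation_level[where w = w and n = n and f = "\<lambda>u. weight u w *v ?D u w"]
      unfolding sum_stopped_prod by eventually_elim simp
  qed
  with that K' show ?thesis by blast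
qed

section \<open>Moments of the branching products\<close>

text \<open>Given the past, \<open>X u\<close> is a constant and the mark of u is a copy of the mark
  of the root. The expectation is linear in the terms, so each of them is replaced by its bound
  \<open>g\<close> separately.\<close>

lemma nn_integral_sum_generation_le:
  fixes f :: "'b \<Rightarrow> nat \<times> (nat \<Rightarrow> complex ^ 'p ^ 'p) \<Rightarrow> ennreal"
  assumes X: "\<And>u. u \<in> nodes \<Longrightarrow> length u = n \<Longrightarrow> X u \<in> measurable (past n) S"
    and f [measurable]: "case_prod f \<in> borel_measurable (S \<Otimes>\<^sub>M mark_space)"
    and le: "\<And>x. x \<in> space S \<Longrightarrow> (\<integral>\<^sup>+w. f x (mark N A [] w) \<partial>P) \<le> g x"
  shows "(\<integral>\<^sup>+w. (\<Sum>u\<in>gen n w. f (X u w) (mark N A u w)) \<partial>P)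
    \<le> (\<integral>\<^sup>+w. (\<Sum>u\<in>gen n w. g (X u w)) \<partial>P)"
proof (rule nn_integral_le_of_eventually_const)
  fix m
  let ?J = "level m n"
  let ?S = "count_space (UNIV :: bool set) \<Otimes>\<^sub>M S"
  \<comment> \<open>Membership in the tree is carried along as a first component, so that the past
    decides which terms of the fixed sum are switched off.\<close>
  let ?X = "\<lambda>u w. (u \<in> gw_tree (\<lambda>v. N v w), X u w)"
  let ?f = "\<lambda>u w w'. if u \<in> gw_tree (\<lambda>v. N v w) then f (X u w) (mark N A u w') else 0"
  let ?g = "\<lambda>u w. if u \<in> gw_tree (\<lambda>v. N v w) then g (X u w) else 0"
  have lev: "?J \<subseteq> nodes" "\<And>u. u \<in> ?J \<Longrightarrow> length u = n"
    by (auto intro: level_nodes simp: level_def)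
  have gen: "(\<Sum>u\<in>gen n w \<inter> ?J. h u) = (\<Sum>u\<in>?J. if u \<in> gw_tree (\<lambda>v. N v w) then h u else 0)"
    for h :: "nat list \<Rightarrow> ennreal" and w
    by (rule sum.mono_neutral_cong_left[OF finite_level]) (auto simp: generation_def level_def)
  have X': "?X u \<in> measurable (past n) ?S" if "u \<in> ?J" for u
  proof (rule measurable_Pair)
    show "Measurable.pred (past n) (\<lambda>w. u \<in> gw_tree (\<lambda>v. N v w))"
      by (rule measurable_gw_tree[OF N_measurable_past]) (use that lev in auto)
    show "X u \<in> measurable (past n) S" by (rule X) (use that lev in auto)
  qed
  have f_meas: "f x \<in> borel_measurable mark_space" if "x \<in> space S" for x
    using that f measurable_Pair2[of "case_prod f" S mark_space borel x] by simp
  define F where "F = (\<lambda>(x, s). \<Sum>u\<in>?J. if fst (x u) then f (snd (x u)) (s u) else 0)"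
  have F: "F \<in> borel_measurable (PiM ?J (\<lambda>_. ?S) \<Otimes>\<^sub>M PiM ?J (\<lambda>_. mark_space))"
    unfolding F_def by measurable
  let ?h = "\<lambda>w. F (restrict (\<lambda>u. ?X u w) ?J, restrict (\<lambda>u. mark N A u w) ?J)"
  show "?h \<in> borel_measurable P"
    by (rule measurable_compose[OF measurable_Pair[OF measurable_restrict[OF measurable_past_imp[OF X']]
          measurable_marks[OF lev(1)]] F])
  have "(\<integral>\<^sup>+w. ?h w \<partial>P) \<le> (\<integral>\<^sup>+w. (\<Sum>u\<in>?J. ?g u w) \<partial>P)"
  proof (rule nn_integral_past_le[OF lev X' F])
    fix w assume w: "w \<in> space P"
    have Xs: "X u w \<in> space S" if "u \<in> ?J" for u
    proof -
      have "X u \<in> measurable (past n) S" using X that lev by blast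
      from measurable_space[OF this, of w] w show ?thesis by simp
    qed
    have "(\<integral>\<^sup>+w'. F (restrict (\<lambda>u. ?X u w) ?J, restrict (\<lambda>u. mark N A u w') ?J) \<partial>P)
      = (\<integral>\<^sup>+w'. (\<Sum>u\<in>?J. ?f u w w') \<partial>P)"
      unfolding F_def prod.case by (intro nn_integral_cong sum.cong) auto
    also have "\<dots> = (\<Sum>u\<in>?J. \<integral>\<^sup>+w'. (?f u w w') \<partial>P)"
    proof (rule nn_integral_sum)
      fix u assume u: "u \<in> ?J"
      then have "(\<lambda>w'. f (X u w) (mark N A u w')) \<in> borel_measurable P"
        using measurable_compose[OF measurable_mark f_meas] Xs lev by blast
      then show "(\<lambda>w'. ?f u w w') \<in> borel_measurable P"
        by simp
    qed
    also have "\<dots> \<le> (\<Sum>u\<in>?J. ?g u w)"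
    proof (rule sum_mono)
      fix u assume u: "u \<in> ?J"
      then have "(\<integral>\<^sup>+w'. f (X u w) (mark N A u w') \<partial>P) \<le> g (X u w)"
        using nn_integral_mark[OF _ f_meas[OF Xs]] le[OF Xs] lev by (metis subsetD)
      then show "(\<integral>\<^sup>+w'. (?f u w w') \<partial>P)
        \<le> (?g u w)" by simp
    qed
    finally show "(\<integral>\<^sup>+w'. F (restrict (\<lambda>u. ?X u w) ?J, restrict (\<lambda>u. mark N A u w') ?J) \<partial>P)
      \<le> (\<Sum>u\<in>?J. ?g u w)" .
  qed auto
  also have "\<dots> \<le> (\<integral>\<^sup>+w. (\<Sum>u\<in>gen n w. g (X u w)) \<partial>P)"
    unfolding gen[symmetric] by (intro nn_integral_mono sum_mono2) auto
  finally show "(\<integral>\<^sup>+w. ?h w \<partial>P) \<le> (\<integral>\<^sup>+w. (\<Sum>u\<in>gen n w. g (X u w)) \<partial>P)" .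
next
  fix w
  show "eventually (\<lambda>m. (\<lambda>(x, s). \<Sum>u\<in>level m n. if fst (x u) then f (snd (x u)) (s u) else 0)
      (restrict (\<lambda>u. (u \<in> gw_tree (\<lambda>v. N v w), X u w)) (level m n), restrict (\<lambda>u. mark N A u w) (level m n))
      = (\<Sum>u\<in>gen n w. f (X u w) (mark N A u w))) sequentially"
    using eventually_generation_level[of "\<lambda>u. N u w" n]
  proof eventually_elim
    case (elim m)
    then show ?case
      by (simp, intro sum.mono_neutral_cong_right[OF finite_level]) (auto simp: generation_def level_def)
  qed
qed

definition offspring_abs :: "real ^ 'p \<Rightarrow> nat \<times> (nat \<Rightarrow> complex ^ 'p ^ 'p) \<Rightarrow> real ^ 'p" where
  "offspring_abs x s = (\<Sum>k=1..fst s. abs_mat (snd s k) *v x)"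

lemma measurable_offspring_abs [measurable]: "offspring_abs x \<in> borel_measurable mark_space"
proof -
  have "(\<lambda>s. \<Sum>k=1..n. abs_mat (snd s k) *v x) \<in> borel_measurable (mark_space :: (nat \<times> (nat \<Rightarrow> complex ^ 'p ^ 'p)) measure)" for n
    by (intro borel_measurable_sum borel_measurable_matrix_vector_mult borel_measurable_abs_mat measurable_snd_mark_space) auto
  from measurable_compose_countable[OF this measurable_fst_mark_space] show ?thesis
    by (simp add: offspring_abs_def[abs_def])
qed

text \<open>Integrating out the last generation replaces x by a vector that is at most c x, by
  \<open>mean\<close>; nonnegativity of the remaining product preserves the inequality, and
  induction gives c^n.\<close>

lemma abs_prod_moment_le:
  assumes x: "\<And>i. 0 \<le> x $ i" and c: "0 \<le> c"
    and mean: "\<And>i. (\<integral>\<^sup>+w. ennreal (offspring_abs x (mark N A [] w) $ i) \<partial>P) \<le> ennreal (c * x $ i)"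
  shows "(\<integral>\<^sup>+w. (\<Sum>u\<in>gen n w. ennreal ((abs_weight u w *v x) $ i)) \<partial>P)
    \<le> ennreal (c ^ n * x $ i)"
proof (induction n)
  case 0
  show ?case by (simp add: generation_0 emeasure_space_1)
next
  case (Suc n)
  let ?B = "\<lambda>w u. abs_weight u w"
  \<comment> \<open>The bound for one generation has to hold for every matrix B, not only for
    nonnegative ones. Taking positive parts leaves the actual products unchanged and makes
    \<open>ennreal\<close> multiplicative on the entries.\<close>
  let ?pos = "\<lambda>B :: real ^ 'p ^ 'p. (\<chi> i j. max 0 (B $ i $ j))"
  let ?o = "\<lambda>w. offspring_abs x (mark N A [] w)"
  have abs_nn: "0 \<le> abs_mat B $ i $ j" for B :: "complex ^ 'p ^ 'p" and i j by (simp add: abs_mat_def)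
  have B_nn: "0 \<le> ?B w u $ i $ j" for w u i j by (rule branch_prod_nonneg) (rule abs_nn)
  have pos: "?pos (?B w u) = ?B w u" for w u by (simp add: vec_eq_iff B_nn)
  have lin: "linear ((*v) B)" for B :: "real ^ 'p ^ 'p"
    by (rule matrix_vector_mul_linear)
  have off_nn: "0 \<le> offspring_abs x s $ j" for s j
    by (simp add: offspring_abs_def matrix_vector_mult_def sum_nonneg x abs_nn)
  have step: "(\<Sum>k=1..N u w. ennreal ((?B w (u @ [k]) *v x) $ i)) = ennreal ((?B w u *v offspring_abs x (mark N A u w)) $ i)" for u w
  proof -
    have "(\<Sum>k=1..N u w. ennreal ((?B w (u @ [k]) *v x) $ i)) = ennreal (\<Sum>k=1..N u w. (?B w (u @ [k]) *v x) $ i)"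
      by (rule sum_ennreal) (simp add: matrix_vector_mult_def sum_nonneg x B_nn)
    also have "(\<Sum>k=1..N u w. (?B w (u @ [k]) *v x) $ i) = (?B w u *v offspring_abs x (mark N A u w)) $ i"
      by (simp add: offspring_abs_def branch_prod_snoc linear_sum[OF lin] matrix_vector_mul_assoc)
    finally show ?thesis .
  qed
  have "(\<integral>\<^sup>+w. (\<Sum>u\<in>gen (Suc n) w. ennreal ((?B w u *v x) $ i)) \<partial>P)
    = (\<integral>\<^sup>+w. (\<Sum>u\<in>gen n w. ennreal ((?pos (?B w u) *v offspring_abs x (mark N A u w)) $ i)) \<partial>P)"
    unfolding sum_generation_Suc step pos ..
  also have "\<dots> \<le> (\<integral>\<^sup>+w. (\<Sum>u\<in>gen n w. ennreal c * ennreal ((?pos (?B w u) *v x) $ i)) \<partial>P)"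
  proof (rule nn_integral_sum_generation_le[where S = borel and X = "\<lambda>u w. ?B w u"
        and f = "\<lambda>B s. ennreal ((?pos B *v offspring_abs x s) $ i)"
        and g = "\<lambda>B. ennreal c * ennreal ((?pos B *v x) $ i)"])
    fix u assume "u \<in> nodes" "length u = n"
    then show "(\<lambda>w. ?B w u) \<in> borel_measurable (past n)"
      using A_measurable_past by (intro measurable_branch_prod[where n = n] borel_measurable_abs_mat) auto
  next
    show "(\<lambda>(B, s). ennreal ((?pos B *v offspring_abs x s) $ i)) \<in> borel_measurable (borel \<Otimes>\<^sub>M mark_space)"
      by measurable
  next
    fix B :: "real ^ 'p ^ 'p"
    have moff: "(\<lambda>w. ?o w) \<in> borel_measurable P"
      by (rule measurable_compose[OF measurable_mark measurable_offspring_abs]) simp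
    have "(\<integral>\<^sup>+w. ennreal ((?pos B *v ?o w) $ i) \<partial>P)
       = (\<integral>\<^sup>+w. (\<Sum>j\<in>UNIV. ennreal (?pos B $ i $ j) * ennreal (?o w $ j)) \<partial>P)"
    proof (intro nn_integral_cong)
      fix w
      define v where "v j = ?pos B $ i $ j" for j
      have "(?pos B *v ?o w) $ i = (\<Sum>j\<in>UNIV. v j * ?o w $ j)"
        by (simp add: matrix_vector_mult_def v_def)
      moreover have "0 \<le> v j" for j by (simp add: v_def)
      ultimately show "ennreal ((?pos B *v ?o w) $ i) =
          (\<Sum>j\<in>UNIV. ennreal (?pos B $ i $ j) * ennreal (?o w $ j))"
        unfolding v_def[symmetric] by (simp add: off_nn flip: ennreal_mult)
    qed
    also have "\<dots> = (\<Sum>j\<in>UNIV. ennreal (?pos B $ i $ j) * (\<integral>\<^sup>+w. ennreal (?o w $ j) \<partial>P))"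
      using moff by (subst nn_integral_sum) (auto intro!: sum.cong nn_integral_cmult)
    also have "\<dots> \<le> (\<Sum>j\<in>UNIV. ennreal (?pos B $ i $ j) * ennreal (c * x $ j))"
      by (intro sum_mono mult_left_mono mean) auto
    also have "\<dots> = ennreal (\<Sum>j\<in>UNIV. ?pos B $ i $ j * (c * x $ j))"
    proof -
      have *: "ennreal v * ennreal (c * x $ j) = ennreal (v * (c * x $ j))" if "0 \<le> v" for v j
        using c x that by (simp add: ennreal_mult)
      have "ennreal (?pos B $ i $ j) * ennreal (c * x $ j) = ennreal (?pos B $ i $ j * (c * x $ j))" for j
        by (rule *) simp
      then have "(\<Sum>j\<in>UNIV. ennreal (?pos B $ i $ j) * ennreal (c * x $ j))
          = (\<Sum>j\<in>UNIV. ennreal (?pos B $ i $ j * (c * x $ j)))" by (simp only:)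
      also have "\<dots> = ennreal (\<Sum>j\<in>UNIV. ?pos B $ i $ j * (c * x $ j))"
        by (rule sum_ennreal) (use c x in simp)
      finally show ?thesis .
    qed
    also have "(\<Sum>j\<in>UNIV. ?pos B $ i $ j * (c * x $ j)) = c * (?pos B *v x) $ i"
      by (simp add: matrix_vector_mult_def sum_distrib_left mult_ac)
    also have "ennreal \<dots> = ennreal c * ennreal ((?pos B *v x) $ i)"
      using c by (rule ennreal_mult')
    finally show "(\<integral>\<^sup>+w. ennreal ((?pos B *v ?o w) $ i) \<partial>P)
       \<le> ennreal c * ennreal ((?pos B *v x) $ i)" .
  qed
  also have "\<dots> = (\<integral>\<^sup>+w. ennreal c * (\<Sum>u\<in>gen n w. ennreal ((?B w u *v x) $ i)) \<partial>P)"
    unfolding pos by (simp add: sum_distrib_left)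
  also have "\<dots> = ennreal c * (\<integral>\<^sup>+w. (\<Sum>u\<in>gen n w. ennreal ((?B w u *v x) $ i)) \<partial>P)"
  proof (rule nn_integral_cmult)
    have B_nn': "0 \<le> (?B w u *v x) $ i" for w u
      by (simp add: matrix_vector_mult_def sum_nonneg x B_nn)
    have "(\<lambda>w. \<Sum>u\<in>gen n w. (?B w u *v x) $ i) \<in> borel_measurable P"
      by (intro measurable_sum_generation borel_measurable_vec_nth borel_measurable_matrix_vector_mult
          measurable_branch_prods) auto
    then show "(\<lambda>w. \<Sum>u\<in>gen n w. ennreal ((?B w u *v x) $ i)) \<in> borel_measurable P"
      by (simp add: B_nn')
  qed
  also have "\<dots> \<le> ennreal c * ennreal (c ^ n * x $ i)"
    by (intro mult_left_mono Suc.IH) auto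
  also have "\<dots> = ennreal (c ^ Suc n * x $ i)"
    using c x[of i] by (simp add: ennreal_mult mult.assoc)
  finally show ?case .
qed

text \<open>The entries of x are at least some z > 0, so the total of all entries is at most 1/z
  times the total weighted by x.\<close>

lemma abs_prod_sum_moment_le:
  assumes x: "\<And>i. 0 < x $ i" and c: "0 \<le> c"
    and mean: "\<And>i. (\<integral>\<^sup>+w. ennreal (offspring_abs x (mark N A [] w) $ i) \<partial>P) \<le> ennreal (c * x $ i)"
  obtains C where "0 \<le> C"
    "\<And>n. (\<integral>\<^sup>+w. ennreal (\<Sum>u\<in>gen n w. \<Sum>i\<in>UNIV. \<Sum>j\<in>UNIV.
        abs_weight u w $ i $ j) \<partial>P) \<le> ennreal (C * c ^ n)"
proof -
  obtain z where z: "0 < z" and zx: "\<And>j. z \<le> x $ j" by (rule positive_vector_bound[OF x]) blast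
  let ?B = "\<lambda>w u. abs_weight u w"
  let ?G = "\<lambda>n w. \<Sum>u\<in>gen n w. \<Sum>i\<in>UNIV. \<Sum>j\<in>UNIV. ?B w u $ i $ j"
  have B_nn: "0 \<le> ?B w u $ i $ j" for w u i j by (rule branch_prod_nonneg) (simp add: abs_mat_def)
  have Bx_nn: "0 \<le> (?B w u *v x) $ i" for w u i
    using x B_nn by (auto simp: matrix_vector_mult_def intro!: sum_nonneg mult_nonneg_nonneg less_imp_le[OF x])
  have le: "(\<Sum>i\<in>UNIV. \<Sum>j\<in>UNIV. ?B w u $ i $ j) \<le> 1 / z * (\<Sum>i\<in>UNIV. (?B w u *v x) $ i)" for w u
  proof -
    have "?B w u $ i $ j \<le> 1 / z * (?B w u $ i $ j * x $ j)" for i j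
      using mult_left_mono[OF zx[of j] B_nn[of w u i j]] z by (simp add: field_simps)
    then show ?thesis
      by (simp add: matrix_vector_mult_def sum_distrib_left sum_mono)
  qed
  have C: "0 \<le> 1 / z * (\<Sum>i\<in>UNIV. x $ i)" using z x by (simp add: sum_nonneg less_imp_le)
  have "(\<integral>\<^sup>+w. ennreal (?G n w) \<partial>P) \<le> ennreal (1 / z * (\<Sum>i\<in>UNIV. c ^ n * x $ i))" for n
  proof (rule nn_integral_le_mult)
    have [measurable]: "(\<lambda>w. \<Sum>u\<in>gen n w. (?B w u *v x) $ i) \<in> borel_measurable P" for i
      by (intro measurable_sum_generation borel_measurable_vec_nth borel_measurable_matrix_vector_mult
          measurable_branch_prods) auto
    show "(\<lambda>w. \<Sum>i\<in>UNIV. \<Sum>u\<in>gen n w. (?B w u *v x) $ i) \<in> borel_measurable P" by measurable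
    show "?G n w \<le> 1 / z * (\<Sum>i\<in>UNIV. \<Sum>u\<in>gen n w. (?B w u *v x) $ i)" for w
      by (subst sum.swap) (simp only: sum_distrib_left[of _ _ "gen n w"] sum_mono le)
    have "(\<integral>\<^sup>+w. ennreal (\<Sum>i\<in>UNIV. \<Sum>u\<in>gen n w. (?B w u *v x) $ i) \<partial>P)
        = (\<integral>\<^sup>+w. (\<Sum>i\<in>UNIV. ennreal (\<Sum>u\<in>gen n w. (?B w u *v x) $ i)) \<partial>P)"
      by (simp add: Bx_nn sum_nonneg)
    also have "\<dots> = (\<Sum>i\<in>UNIV. \<integral>\<^sup>+w. ennreal (\<Sum>u\<in>gen n w. (?B w u *v x) $ i) \<partial>P)"
      by (rule nn_integral_sum) measurable
    also have "\<dots> \<le> (\<Sum>i\<in>UNIV. ennreal (c ^ n * x $ i))"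
      using abs_prod_moment_le[OF less_imp_le[OF x] c mean] by (intro sum_mono) (simp add: Bx_nn)
    also have "\<dots> = ennreal (\<Sum>i\<in>UNIV. c ^ n * x $ i)"
      using c x by (intro sum_ennreal) (simp add: less_imp_le)
    finally show "(\<integral>\<^sup>+w. ennreal (\<Sum>i\<in>UNIV. \<Sum>u\<in>gen n w. (?B w u *v x) $ i) \<partial>P) \<le> \<dots>" .
  qed (use z in simp)
  then show ?thesis
    by (intro that[OF C]) (simp add: sum_distrib_left sum_distrib_right mult_ac)
qed

lemma indep_var_past:
  fixes X :: "'w \<Rightarrow> 'b :: topological_space" and \<psi> :: "_ \<Rightarrow> 'b"
  assumes X: "X \<in> borel_measurable (past n)" and \<psi>: "\<psi> \<in> borel_measurable mark_space"
    and u: "u \<in> nodes" "length u = n"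
  shows "indep_var borel X borel (\<lambda>w. \<psi> (mark N A u w))"
  unfolding indep_var_eq
proof (intro conjI indep_set_sigma_sets)
  show "X \<in> borel_measurable P" by (rule measurable_past_imp[OF X])
  show m: "(\<lambda>w. \<psi> (mark N A u w)) \<in> borel_measurable P"
    by (rule measurable_compose[OF measurable_mark[OF u(1)] \<psi>])
  have stable: "Int_stable {f -` B \<inter> space P | B. B \<in> sets borel}" for f :: "'w \<Rightarrow> 'b"
    unfolding Int_stable_def
  proof safe
    fix a b :: "'b set" assume "a \<in> sets borel" "b \<in> sets borel"
    then show "\<exists>c. f -` a \<inter> space P \<inter> (f -` b \<inter> space P) = f -` c \<inter> space P \<and> c \<in> sets borel"
      by (intro exI[of _ "a \<inter> b"]) auto
  qed
  show "Int_stable {X -` B \<inter> space P | B. B \<in> sets borel}" by (rule stable)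
  show "Int_stable {(\<lambda>w. \<psi> (mark N A u w)) -` B \<inter> space P | B. B \<in> sets borel}" by (rule stable)
  show "indep_set {X -` B \<inter> space P | B. B \<in> sets borel} {(\<lambda>w. \<psi> (mark N A u w)) -` B \<inter> space P | B. B \<in> sets borel}"
    unfolding indep_sets2_eq
  proof (intro conjI ballI)
    show "{X -` B \<inter> space P | B. B \<in> sets borel} \<subseteq> events"
      using measurable_sets[OF measurable_past_imp[OF X]] by auto
    show "{(\<lambda>w. \<psi> (mark N A u w)) -` B \<inter> space P | B. B \<in> sets borel} \<subseteq> events"
      using measurable_sets[OF m] by auto
    fix a b assume "a \<in> {X -` B \<inter> space P | B. B \<in> sets borel}"
      and "b \<in> {(\<lambda>w. \<psi> (mark N A u w)) -` B \<inter> space P | B. B \<in> sets borel}"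
    then obtain B B' where a: "a = X -` B \<inter> space P" "B \<in> sets borel"
      and b: "b = (\<lambda>w. \<psi> (mark N A u w)) -` B' \<inter> space P" "B' \<in> sets borel" by auto
    have a': "a \<in> sets (past n)" using measurable_sets[OF X a(2)] a(1) by simp
    let ?M = "PiM {u} (\<lambda>_. mark_space :: (nat \<times> (nat \<Rightarrow> complex ^ 'p ^ 'p)) measure)"
    have "(\<lambda>s. \<psi> (s u)) \<in> borel_measurable ?M"
      by (rule measurable_compose[OF _ \<psi>]) measurable
    then have b': "(\<lambda>s. \<psi> (s u)) -` B' \<inter> space ?M \<in> sets ?M" using b(2) by (rule measurable_sets)
    have "b = (\<lambda>w. restrict (\<lambda>v. mark N A v w) {u}) -` ((\<lambda>s. \<psi> (s u)) -` B' \<inter> space ?M) \<inter> space P"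
      unfolding b using marks_space[of "{u}"] u by auto
    then show "prob (a \<inter> b) = prob a * prob b"
      using indep_past[of "{u}" n a, OF _ _ a' b'] u by auto
  qed
qed

text \<open>The increment over a random generation is the limit of finite sums of terms with mean 0.
  Dominated convergence carries this over; the dominating \<open>b\<close> is integrable by
  \<open>fin\<close> and \<open>nn_integral_sum_generation_le\<close>.\<close>

lemma mandelbrot_mean:
  assumes mean: "(\<integral>w. dev V r (mark N A [] w) \<partial>P) = 0"
    and int: "integrable P (\<lambda>w. dev V r (mark N A [] w))"
    and fin: "\<And>n. (\<integral>\<^sup>+w. ennreal (\<Sum>u\<in>gen n w. entry_sum (weight u w)) \<partial>P) < \<infinity>"
  shows "integrable P (mandelbrot N A V n) \<and> (\<integral>w. mandelbrot N A V n w \<partial>P) = r ^ n *\<^sub>R cvec V"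
proof (induction n)
  case 0
  have "mandelbrot N A V 0 = (\<lambda>_. cvec V)"
    by (simp add: mandelbrot_def[abs_def] generation_0)
  then show ?case by (simp add: prob_space)
next
  case (Suc n)
  let ?D = "\<lambda>u w. dev V r (mark N A u w)"
  let ?S = "\<lambda>m w. \<Sum>u\<in>level m n. stopped_prod u w *v ?D u w"
  define g where "g w = (\<Sum>u\<in>gen n w. entry_sum (weight u w))" for w
  define b where "b w = (\<Sum>u\<in>gen n w.
      entry_sum (weight u w) * norm (?D u w))" for w
  define \<Delta> where "\<Delta> w = (\<Sum>u\<in>gen n w. weight u w *v ?D u w)" for w
  have mdev: "(\<lambda>w. ?D u w) \<in> borel_measurable P" if "u \<in> nodes" for u
    using measurable_compose[OF measurable_mark measurable_dev] that by blast
  have mprod: "(\<lambda>w. entry_sum (weight u w)) \<in> borel_measurable P" if "u \<in> nodes" for u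
    using measurable_compose[OF measurable_branch_prods(1)[OF that] borel_measurable_entry_sum] .
  have g_meas [measurable]: "g \<in> borel_measurable P"
    unfolding g_def using mprod by (intro measurable_sum_generation) auto
  have b_meas [measurable]: "b \<in> borel_measurable P"
    unfolding b_def using mprod mdev by (intro measurable_sum_generation borel_measurable_times borel_measurable_norm) auto
  have g_int: "integrable P g"
    using fin[of n] by (intro integrableI_nonneg) (auto simp: g_def sum_nonneg)
  have b_int: "integrable P b"
  proof (rule integrableI_nonneg)
    show "AE w in P. 0 \<le> b w" by (simp add: b_def sum_nonneg)
    let ?d = "\<integral>w. norm (dev V r (mark N A [] w)) \<partial>P"
    have d: "(\<integral>\<^sup>+w. ennreal (norm (dev V r (mark N A [] w))) \<partial>P) = ennreal ?d"
      using int by (intro nn_integral_eq_integral) auto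
    have "(\<integral>\<^sup>+w. ennreal (b w) \<partial>P) = (\<integral>\<^sup>+w. (\<Sum>u\<in>gen n w.
        ennreal (entry_sum (weight u w) * norm (?D u w))) \<partial>P)"
      by (simp add: b_def)
    also have "\<dots> \<le> (\<integral>\<^sup>+w. (\<Sum>u\<in>gen n w. ennreal (entry_sum (weight u w)) * ennreal ?d) \<partial>P)"
    proof (rule nn_integral_sum_generation_le[where S = borel and X = "\<lambda>u w. weight u w"
          and f = "\<lambda>B s. ennreal (entry_sum B * norm (dev V r s))"
          and g = "\<lambda>B. ennreal (entry_sum B) * ennreal ?d"])
      fix u assume "u \<in> nodes" "length u = n"
      then show "(\<lambda>w. weight u w) \<in> borel_measurable (past n)"
        using A_measurable_past by (intro measurable_branch_prod[where n = n]) auto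
    next
      show "(\<lambda>(B, s). ennreal (entry_sum B * norm (dev V r s))) \<in> borel_measurable (borel \<Otimes>\<^sub>M mark_space)"
        by measurable
    next
      fix B :: "complex ^ 'p ^ 'p"
      show "(\<integral>\<^sup>+w. ennreal (entry_sum B * norm (dev V r (mark N A [] w))) \<partial>P) \<le> ennreal (entry_sum B) * ennreal ?d"
        using mdev[of "[]"] by (simp add: ennreal_mult nn_integral_cmult d)
    qed
    also have "\<dots> = (\<integral>\<^sup>+w. ennreal (g w) * ennreal ?d \<partial>P)"
      by (simp add: g_def flip: sum_distrib_right)
    also have "\<dots> = (\<integral>\<^sup>+w. ennreal (g w) \<partial>P) * ennreal ?d"
      by (rule nn_integral_multc) measurable
    also have "\<dots> < \<infinity>" using fin[of n] by (simp add: g_def ennreal_mult_less_top)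
    finally show "(\<integral>\<^sup>+w. ennreal (b w) \<partial>P) < \<infinity>" .
  qed simp
  have prod_term: "integrable P (\<lambda>w. stopped_prod u w *v ?D u w)"
    "(\<integral>w. stopped_prod u w *v ?D u w \<partial>P) = 0" if u: "u \<in> nodes" "length u = n" for u
  proof -
    have mX: "stopped_prod u \<in> borel_measurable P"
      using measurable_past_imp[OF measurable_stopped_prod[OF u]] .
    have le: "entry_sum (stopped_prod u w) * y u \<le>
        (\<Sum>u\<in>gen n w. entry_sum (weight u w) * y u)"
      if "\<And>u. 0 \<le> y u" for w and y :: "nat list \<Rightarrow> real"
    proof (cases "u \<in> gw_tree (\<lambda>v. N v w)")
      case True
      then have "u \<in> gen n w" using u by (simp add: generation_def)
      then show ?thesis
        using True that by (simp add: stopped_prod_def member_le_sum[where f = "\<lambda>u. entry_sum (weight u w) * y u"])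
    next
      case False
      then show ?thesis using that by (simp add: stopped_prod_def entry_sum_def sum_nonneg)
    qed
    show int': "integrable P (\<lambda>w. stopped_prod u w *v ?D u w)"
    proof (rule Bochner_Integration.integrable_bound[OF b_int])
      show "(\<lambda>w. stopped_prod u w *v ?D u w) \<in> borel_measurable P"
        using mX mdev[OF u(1)] by measurable
      show "AE w in P. norm (stopped_prod u w *v ?D u w) \<le> norm (b w)"
      proof (rule AE_I2)
        fix w
        have "norm (stopped_prod u w *v ?D u w) \<le> b w"
          unfolding b_def
          using norm_matrix_vector_mult_le le[of "\<lambda>u. norm (?D u w)" w] by (rule order_trans) simp
        then show "norm (stopped_prod u w *v ?D u w) \<le> norm (b w)" by simp
      qed
    qed
    have Xint: "integrable P (\<lambda>w. stopped_prod u w $ i $ j)" for i j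
    proof (rule Bochner_Integration.integrable_bound[OF g_int])
      show "(\<lambda>w. stopped_prod u w $ i $ j) \<in> borel_measurable P" using mX by measurable
      show "AE w in P. norm (stopped_prod u w $ i $ j) \<le> norm (g w)"
      proof (rule AE_I2)
        fix w
        have "cmod (stopped_prod u w $ i $ j) \<le> (\<Sum>j\<in>UNIV. cmod (stopped_prod u w $ i $ j))"
          by (rule member_le_sum) auto
        also have "\<dots> \<le> entry_sum (stopped_prod u w)"
          unfolding entry_sum_def by (rule member_le_sum[where f = "\<lambda>i. \<Sum>j\<in>UNIV. cmod (stopped_prod u w $ i $ j)"]) (auto simp: sum_nonneg)
        also have "\<dots> \<le> g w" using le[of "\<lambda>_. 1" w] by (simp add: g_def)
        finally show "norm (stopped_prod u w $ i $ j) \<le> norm (g w)" by simp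
      qed
    qed
    have dint: "integrable P (\<lambda>w. ?D u w)" "(\<integral>w. ?D u w \<partial>P) = 0"
      using integrable_mark[OF u(1) measurable_dev] integral_mark[OF u(1) measurable_dev] int mean by auto
    have Dint: "integrable P (\<lambda>w. ?D u w $ j)" "(\<integral>w. ?D u w $ j \<partial>P) = 0" for j
      using integrable_bounded_linear[OF bounded_linear_vec_nth dint(1), of j]
        integral_bounded_linear[OF bounded_linear_vec_nth dint(1), of j] dint(2) by auto
    \<comment> \<open>Each coordinate of the product is a finite sum of products of two independent
      complex variables, the second one centred.\<close>
    have ind: "indep_var borel (\<lambda>w. stopped_prod u w $ i $ j) borel (\<lambda>w. ?D u w $ j)" for i j
    proof (rule indep_var_past[where \<psi> = "\<lambda>s. dev V r s $ j", OF _ _ u])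
      show "(\<lambda>w. stopped_prod u w $ i $ j) \<in> borel_measurable (past n)"
        using measurable_stopped_prod[OF u] by measurable
    qed measurable
    note prod = indep_var_integrable[OF ind Xint Dint(1)] indep_var_lebesgue_integral[OF ind Xint Dint(1)]
    have "(\<integral>w. stopped_prod u w *v ?D u w \<partial>P) $ i = 0" for i
    proof -
      have "(\<integral>w. stopped_prod u w *v ?D u w \<partial>P) $ i
        = (\<integral>w. (\<Sum>j\<in>UNIV. stopped_prod u w $ i $ j * ?D u w $ j) \<partial>P)"
        using integral_bounded_linear[OF bounded_linear_vec_nth int', of i]
        by (simp add: matrix_vector_mult_def)
      also have "\<dots> = (\<Sum>j\<in>UNIV. (\<integral>w. stopped_prod u w $ i $ j * ?D u w $ j \<partial>P))"
        by (rule Bochner_Integration.integral_sum) (rule prod(1))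
      also have "\<dots> = 0" unfolding prod(2) Dint(2) by simp
      finally show ?thesis .
    qed
    then show "(\<integral>w. stopped_prod u w *v ?D u w \<partial>P) = 0" by (simp add: vec_eq_iff)
  qed
  have lev: "u \<in> nodes" "length u = n" if "u \<in> level m n" for u m
    using that by (auto intro: level_nodes simp: level_def)
  have bound: "norm (\<Sum>u\<in>gen n w \<inter> level m n. weight u w *v ?D u w) \<le> b w" for m w
    unfolding b_def
    by (rule order_trans[OF norm_sum], rule order_trans[OF sum_mono[OF norm_matrix_vector_mult_le]]) (auto intro!: sum_mono2)
  have conv: "(\<lambda>m. ?S m w) \<longlonglongrightarrow> \<Delta> w" for w
    unfolding sum_stopped_prod \<Delta>_def
    by (rule tendsto_eventually) (rule eventually_sum_generation_level)
  have \<Delta>_meas: "\<Delta> \<in> borel_measurable P"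
    unfolding \<Delta>_def using mdev
    by (intro measurable_sum_generation borel_measurable_matrix_vector_mult measurable_branch_prods) auto
  have S_meas: "(\<lambda>w. ?S m w) \<in> borel_measurable P" for m
    using prod_term(1)[OF lev] by (intro borel_measurable_sum) auto
  have convAE: "AE w in P. (\<lambda>m. ?S m w) \<longlonglongrightarrow> \<Delta> w"
    using conv by simp
  have boundAE: "AE w in P. norm (?S m w) \<le> b w" for m
    using bound unfolding sum_stopped_prod by simp
  have \<Delta>_int: "integrable P \<Delta>"
    and lim: "(\<lambda>m. \<integral>w. (?S m w) \<partial>P) \<longlonglongrightarrow> (\<integral>w. \<Delta> w \<partial>P)"
    by (rule integrable_dominated_convergence[OF \<Delta>_meas S_meas b_int convAE boundAE]
        integral_dominated_convergence[OF \<Delta>_meas S_meas b_int convAE boundAE])+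
  have "(\<integral>w. (?S m w) \<partial>P) = 0" for m
    using prod_term[OF lev] by (subst Bochner_Integration.integral_sum) auto
  with lim have "(\<integral>w. \<Delta> w \<partial>P) = 0" by (simp add: LIMSEQ_const_iff)
  moreover have "mandelbrot N A V (Suc n) = (\<lambda>w. r *\<^sub>R mandelbrot N A V n w + \<Delta> w)"
    using mandelbrot_increment[of V n _ r] by (simp add: \<Delta>_def fun_eq_iff algebra_simps)
  ultimately show ?case using Suc.IH \<Delta>_int by simp
qed

end

section \<open>Convergence\<close>

text \<open>Geometrically small \<open>\<alpha>\<close>-th moments of the increments give
  \<open>h = (\<Sum>n. \<sigma>\<^sup>-\<^sup>n \<cdot> \<parallel>Y\<^sub>n\<^sub>+\<^sub>1 - Y\<^sub>n\<parallel>\<^sup>\<alpha>) < \<infinity>\<close> almost surely for some \<open>\<sigma> < 1\<close>, so that the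
  increments are dominated by a geometric series times \<open>h\<^sup>1\<^sup>/\<^sup>\<alpha>\<close>, which has an \<open>\<alpha>\<close>-th moment.\<close>

lemma (in prob_space) converges_of_geometric_increments:
  fixes Y :: "nat \<Rightarrow> 'a \<Rightarrow> 'b :: euclidean_space"
  assumes [measurable]: "\<And>n. Y n \<in> borel_measurable M"
    and \<alpha>: "1 < \<alpha>" and Y0: "integrable M (\<lambda>w. norm (Y 0 w) powr \<alpha>)"
    and C: "0 \<le> C" and r: "0 \<le> r" "r < 1"
    and incr: "\<And>n. (\<integral>\<^sup>+w. ennreal (norm (Y (Suc n) w - Y n w) powr \<alpha>) \<partial>M) \<le> ennreal (C * r ^ n)"
  obtains Z G where "Z \<in> borel_measurable M" "G \<in> borel_measurable M" "integrable M (\<lambda>w. G w powr \<alpha>)"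
    "AE w in M. (\<lambda>n. Y n w) \<longlonglongrightarrow> Z w" "AE w in M. \<forall>n. norm (Y n w) \<le> G w"
proof -
  \<comment> \<open>The midpoint of r and 1: r < \<sigma> makes the expectation of the weighted
    series finite, and \<sigma> < 1 makes the increments summable with ratio s < 1.\<close>
  define \<sigma> where "\<sigma> = (1 + r) / 2"
  have \<sigma>: "0 < \<sigma>" "\<sigma> < 1" "r < \<sigma>" using r by (auto simp: \<sigma>_def)
  define s where "s = \<sigma> powr (1 / \<alpha>)"
  have s: "0 < s" "s < 1" using powr_less_mono2[of "1 / \<alpha>" \<sigma> 1] \<sigma> \<alpha> by (auto simp: s_def)
  define \<Delta> where "\<Delta> n w = norm (Y (Suc n) w - Y n w)" for n w
  have \<Delta>_meas [measurable]: "\<Delta> n \<in> borel_measurable M" for n unfolding \<Delta>_def by measurable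
  define H where "H w = (\<Sum>n. ennreal (\<Delta> n w powr \<alpha> / \<sigma> ^ n))" for w
  have H_meas [measurable]: "H \<in> borel_measurable M" unfolding H_def by measurable
  have "(\<integral>\<^sup>+w. H w \<partial>M) = (\<Sum>n. \<integral>\<^sup>+w. ennreal (\<Delta> n w powr \<alpha> / \<sigma> ^ n) \<partial>M)"
    unfolding H_def by (rule nn_integral_suminf) measurable
  also have "\<dots> \<le> (\<Sum>n. ennreal (C * (r / \<sigma>) ^ n))"
  proof (intro suminf_le allI)
    fix n
    have "(\<integral>\<^sup>+w. ennreal (\<Delta> n w powr \<alpha> / \<sigma> ^ n) \<partial>M) = (\<integral>\<^sup>+w. ennreal (1 / \<sigma> ^ n) * ennreal (\<Delta> n w powr \<alpha>) \<partial>M)"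
      using \<sigma> by (intro nn_integral_cong) (simp flip: ennreal_mult')
    also have "\<dots> = ennreal (1 / \<sigma> ^ n) * (\<integral>\<^sup>+w. ennreal (\<Delta> n w powr \<alpha>) \<partial>M)"
      by (rule nn_integral_cmult) measurable
    also have "\<dots> \<le> ennreal (1 / \<sigma> ^ n) * ennreal (C * r ^ n)"
      unfolding \<Delta>_def by (intro mult_left_mono incr) simp
    also have "\<dots> = ennreal (C * (r / \<sigma>) ^ n)"
      using \<sigma> C by (simp add: power_divide flip: ennreal_mult')
    finally show "(\<integral>\<^sup>+w. ennreal (\<Delta> n w powr \<alpha> / \<sigma> ^ n) \<partial>M) \<le> ennreal (C * (r / \<sigma>) ^ n)" .
  qed auto
  also have "\<dots> < \<infinity>"
  proof -
    have "summable (\<lambda>n. C * (r / \<sigma>) ^ n)" using \<sigma> r by (intro summable_mult summable_geometric) auto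
    then have "(\<Sum>n. ennreal (C * (r / \<sigma>) ^ n)) = ennreal (\<Sum>n. C * (r / \<sigma>) ^ n)"
      using C r \<sigma> by (intro suminf_ennreal2) auto
    then show ?thesis by simp
  qed
  finally have H_fin: "(\<integral>\<^sup>+w. H w \<partial>M) < \<infinity>" .
  then have H_AE: "AE w in M. H w \<noteq> \<infinity>" by (intro nn_integral_noteq_infinite) auto
  \<comment> \<open>\<open>enn2real\<close> sends the value infinity, which is taken on a null set
    only, to 0, so h is a real function everywhere.\<close>
  define h where "h w = enn2real (H w)" for w
  have h_nn: "0 \<le> h w" for w by (simp add: h_def)
  have h_meas [measurable]: "h \<in> borel_measurable M" unfolding h_def by measurable
  have h_int: "integrable M h"
  proof (rule integrableI_nonneg)
    have "(\<integral>\<^sup>+w. ennreal (h w) \<partial>M) \<le> (\<integral>\<^sup>+w. H w \<partial>M)"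
      by (intro nn_integral_mono) (auto simp: h_def ennreal_enn2real_if)
    with H_fin show "(\<integral>\<^sup>+w. ennreal (h w) \<partial>M) < \<infinity>" by (rule le_less_trans[rotated])
  qed (auto simp: h_nn)
  define G where "G w = norm (Y 0 w) + h w powr (1 / \<alpha>) / (1 - s)" for w
  have G_meas [measurable]: "G \<in> borel_measurable M" unfolding G_def by measurable
  have key: "(\<lambda>n. Y n w) \<longlonglongrightarrow> lim (\<lambda>n. Y n w) \<and> (\<forall>n. norm (Y n w) \<le> G w)" if "H w \<noteq> \<infinity>" for w
  proof -
    have \<Delta>_le: "\<Delta> n w \<le> s ^ n * h w powr (1 / \<alpha>)" for n
    proof -
      have "ennreal (\<Delta> n w powr \<alpha> / \<sigma> ^ n) \<le> H w"
        using sum_le_suminf[of "\<lambda>n. ennreal (\<Delta> n w powr \<alpha> / \<sigma> ^ n)" "{n}"] by (simp add: H_def)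
      also have "H w = ennreal (h w)" using that by (simp add: h_def less_top)
      finally have "\<Delta> n w powr \<alpha> / \<sigma> ^ n \<le> h w" using h_nn by simp
      then have "\<Delta> n w powr \<alpha> \<le> \<sigma> ^ n * h w" using \<sigma> by (simp add: field_simps)
      then have "(\<Delta> n w powr \<alpha>) powr (1 / \<alpha>) \<le> (\<sigma> ^ n * h w) powr (1 / \<alpha>)"
        using \<alpha> by (intro powr_mono2) auto
      also have "\<dots> = s ^ n * h w powr (1 / \<alpha>)"
        using \<sigma> h_nn[of w] by (simp add: powr_mult s_def powr_power mult.commute flip: powr_realpow powr_powr)
           (simp add: powr_powr mult.commute)
      finally show ?thesis using \<alpha> by (simp add: powr_powr \<Delta>_def)
    qed
    have geo: "summable (\<lambda>n. s ^ n * h w powr (1 / \<alpha>))"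
      using s by (intro summable_mult2 summable_geometric) auto
    have sum: "summable (\<lambda>n. Y (Suc n) w - Y n w)"
      by (rule summable_comparison_test'[OF geo, of 0]) (use \<Delta>_le in \<open>simp add: \<Delta>_def\<close>)
    have part: "Y n w = Y 0 w + (\<Sum>k<n. Y (Suc k) w - Y k w)" for n
      using sum_lessThan_telescope[of "\<lambda>k. Y k w" n] by simp
    have "(\<lambda>n. Y 0 w + (\<Sum>k<n. Y (Suc k) w - Y k w)) \<longlonglongrightarrow> Y 0 w + (\<Sum>k. Y (Suc k) w - Y k w)"
      by (intro tendsto_intros summable_LIMSEQ sum)
    then have "convergent (\<lambda>n. Y n w)" unfolding part[symmetric] by (rule convergentI)
    moreover have "norm (Y n w) \<le> G w" for n
    proof -
      have "norm (Y n w) \<le> norm (Y 0 w) + norm (\<Sum>k<n. Y (Suc k) w - Y k w)"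
        by (subst part[of n]) (rule norm_triangle_ineq)
      also have "norm (\<Sum>k<n. Y (Suc k) w - Y k w) \<le> (\<Sum>k<n. s ^ k * h w powr (1 / \<alpha>))"
        using \<Delta>_le by (intro sum_norm_le) (simp add: \<Delta>_def)
      also have "\<dots> \<le> (\<Sum>k. s ^ k * h w powr (1 / \<alpha>))"
        using s by (intro sum_le_suminf[OF geo]) auto
      also have "\<dots> = h w powr (1 / \<alpha>) / (1 - s)"
        using s by (simp add: suminf_mult2[symmetric] suminf_geometric summable_geometric)
      finally show ?thesis by (simp add: G_def)
    qed
    ultimately show ?thesis by (simp add: convergent_LIMSEQ_iff)
  qed
  have G_int: "integrable M (\<lambda>w. G w powr \<alpha>)"
  proof (rule Bochner_Integration.integrable_bound)
    show "integrable M (\<lambda>w. 2 powr \<alpha> * norm (Y 0 w) powr \<alpha> + 2 powr \<alpha> * (h w / (1 - s) powr \<alpha>))"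
      using Y0 h_int by simp
    show "AE w in M. norm (G w powr \<alpha>) \<le> norm (2 powr \<alpha> * norm (Y 0 w) powr \<alpha> + 2 powr \<alpha> * (h w / (1 - s) powr \<alpha>))"
    proof (rule AE_I2)
      fix w
      have "G w powr \<alpha> \<le> (1 + 1) powr \<alpha> * norm (Y 0 w) powr \<alpha> + (1 + 1 / 1) powr \<alpha> * (h w powr (1 / \<alpha>) / (1 - s)) powr \<alpha>"
        unfolding G_def using s \<alpha> by (intro add_powr_le) auto
      also have "\<dots> = 2 powr \<alpha> * norm (Y 0 w) powr \<alpha> + 2 powr \<alpha> * (h w / (1 - s) powr \<alpha>)"
        using s \<alpha> h_nn[of w] by (simp add: powr_divide powr_powr)
      finally show "norm (G w powr \<alpha>) \<le> norm (2 powr \<alpha> * norm (Y 0 w) powr \<alpha> + 2 powr \<alpha> * (h w / (1 - s) powr \<alpha>))"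
        by simp
    qed
  qed measurable
  show ?thesis
  proof (rule that[of "\<lambda>w. lim (\<lambda>n. Y n w)" G])
    show "(\<lambda>w. lim (\<lambda>n. Y n w)) \<in> borel_measurable M" by measurable
    show "AE w in M. (\<lambda>n. Y n w) \<longlonglongrightarrow> lim (\<lambda>n. Y n w)" using H_AE by eventually_elim (simp add: key)
    show "AE w in M. \<forall>n. norm (Y n w) \<le> G w" using H_AE by eventually_elim (simp add: key)
  qed (use G_int in simp_all)
qed

section \<open>Geometric decay of moments\<close>

lemma borel_measurable_cmat [measurable]: "cmat \<in> borel_measurable borel"
  unfolding cmat_def[abs_def] by measurable

lemma borel_measurable_entry_powr [measurable]: "entry_powr t \<in> borel_measurable borel"
  unfolding entry_powr_def[abs_def] by measurable

lemma borel_measurable_abs_mat' [measurable]: "abs_mat \<in> borel_measurable borel"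
  using borel_measurable_abs_mat[of "\<lambda>x. x" borel] by simp

lemma abs_mat_cmat: "(\<And>i j. 0 \<le> B $ i $ j) \<Longrightarrow> abs_mat (cmat B) = B"
  by (simp add: abs_mat_def cmat_def vec_eq_iff)

lemma entry_sum_cmat: "(\<And>i j. 0 \<le> B $ i $ j) \<Longrightarrow> entry_sum (cmat B) = (\<Sum>i\<in>UNIV. \<Sum>j\<in>UNIV. B $ i $ j)"
  by (simp add: entry_sum_def cmat_def)

lemma sum_matrix_vector_mult:
  fixes A :: "'k \<Rightarrow> complex ^ 'p ^ 'p"
  shows "(\<Sum>k\<in>S. A k) *v v = (\<Sum>k\<in>S. A k *v v)"
  by (induction S rule: infinite_finite_induct) (auto simp: matrix_vector_mult_add_rdistrib)

text \<open>With values in \<open>ennreal\<close> the recursion itself propagates finiteness from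
  \<open>Z 0\<close>; the moments to which it is applied need not be known to be finite
  beforehand.\<close>

lemma geometric_recursion_ennreal:
  fixes Z :: "nat \<Rightarrow> ennreal"
  assumes \<theta>: "0 \<le> \<theta>" "\<theta> < 1" and \<rho>: "0 \<le> \<rho>" "\<rho> < 1" and L: "0 \<le> L" and Z0: "Z 0 < \<infinity>"
    and step: "\<And>n. Z (Suc n) \<le> ennreal \<theta> * Z n + ennreal (L * \<rho> ^ n)"
  obtains R s where "0 \<le> R" "0 \<le> s" "s < 1" "\<And>n. Z n \<le> ennreal (R * s ^ n)"
proof -
  define s where "s = (1 + max \<theta> \<rho>) / 2"
  have s: "0 \<le> s" "s < 1" "\<theta> < s" "\<rho> \<le> s" using \<theta> \<rho> by (auto simp: s_def)
  obtain z where z: "0 \<le> z" "Z 0 = ennreal z" using Z0 by (cases "Z 0") auto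
  \<comment> \<open>Chosen with L <= R (s - \<theta>), so that \<theta> R s^n + L \<rho>^n <= R
    s^(n+1); here s lies strictly above \<theta> and is at least \<rho>.\<close>
  define R where "R = z + L / (s - \<theta>)"
  have R: "0 \<le> R" "L \<le> R * (s - \<theta>)"
    using z L s by (auto simp: R_def distrib_right)
  have "Z n \<le> ennreal (R * s ^ n)" for n
  proof (induction n)
    case 0
    show ?case using z L s by (simp add: R_def ennreal_leI)
  next
    case (Suc n)
    have "Z (Suc n) \<le> ennreal \<theta> * ennreal (R * s ^ n) + ennreal (L * \<rho> ^ n)"
      by (rule order_trans[OF step]) (intro add_mono mult_left_mono Suc order_refl, simp)
    also have "\<dots> = ennreal (\<theta> * (R * s ^ n) + L * \<rho> ^ n)"
      using \<theta> \<rho> L R s by (simp add: ennreal_mult' ennreal_plus)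
    also have "\<dots> \<le> ennreal (R * s ^ Suc n)"
    proof (rule ennreal_leI)
      have "L * \<rho> ^ n \<le> L * s ^ n" using L \<rho> s by (intro mult_left_mono power_mono) auto
      also have "\<dots> \<le> R * (s - \<theta>) * s ^ n" using R s by (intro mult_right_mono) auto
      finally show "\<theta> * (R * s ^ n) + L * \<rho> ^ n \<le> R * s ^ Suc n" by (simp add: algebra_simps)
    qed
    finally show ?case .
  qed
  with R s that show ?thesis by blast
qed

context branching_marks
begin

text \<open>A fixed Borel map of matrices acts on each mark separately, through
  \<open>\<Phi>\<close>, and so preserves independence and equality of laws. The restriction in
  \<open>\<Phi>\<close> keeps the marks in the extensional product space.\<close>

lemma branching_marks_map:
  fixes \<Gamma> :: "complex ^ 'p ^ 'p \<Rightarrow> complex ^ 'p ^ 'p"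
  assumes [measurable]: "\<Gamma> \<in> borel_measurable borel"
  shows "branching_marks P N (\<lambda>u w. \<Gamma> (A u w))"
proof
  define \<Phi> :: "nat \<times> (nat \<Rightarrow> complex ^ 'p ^ 'p) \<Rightarrow> nat \<times> (nat \<Rightarrow> complex ^ 'p ^ 'p)"
    where "\<Phi> s = (fst s, restrict (\<lambda>k. \<Gamma> (snd s k)) {1..})" for s
  have \<Phi>: "\<Phi> \<in> measurable mark_space mark_space"
  proof -
    have 1: "(\<lambda>s. restrict (\<lambda>k. \<Gamma> (snd s k)) {1..}) \<in> measurable mark_space (PiM {1..} (\<lambda>_. borel))"
      by (intro measurable_restrict measurable_compose[OF measurable_snd_mark_space assms]) auto
    show ?thesis
      unfolding \<Phi>_def[abs_def]
      by (subst (2) mark_space_def) (rule measurable_Pair[OF measurable_fst_mark_space 1])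
  qed
  have eq: "mark N (\<lambda>u w. \<Gamma> (A u w)) u = (\<lambda>w. \<Phi> (mark N A u w))" for u
    by (auto simp: fun_eq_iff mark_def \<Phi>_def)
  show "indep_vars (\<lambda>_. mark_space) (mark N (\<lambda>u w. \<Gamma> (A u w))) nodes"
    unfolding eq[abs_def] using indep_vars_compose2[OF indep, of "\<lambda>_. \<Phi>"] \<Phi> by simp
  fix u assume u: "u \<in> nodes"
  have "distr P mark_space (\<lambda>w. \<Phi> (mark N A u w)) = distr (distr P mark_space (mark N A u)) mark_space \<Phi>" if "u \<in> nodes" for u
    using distr_distr[OF \<Phi> measurable_mark[OF that]] by (simp add: comp_def)
  then show "distr P mark_space (mark N (\<lambda>u w. \<Gamma> (A u w)) u) = distr P mark_space (mark N (\<lambda>u w. \<Gamma> (A u w)) [])"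
    unfolding eq using u copies[OF u] by simp
qed

lemma measurable_offspring:
  fixes h :: "complex ^ 'p ^ 'p \<Rightarrow> 'b :: {second_countable_topology, real_normed_vector}"
  assumes [measurable]: "h \<in> borel_measurable borel"
  shows "(\<lambda>w. \<Sum>k=1..N [] w. h (A [k] w)) \<in> borel_measurable P"
proof -
  have "(\<lambda>w. \<Sum>k=1..n. h (A [k] w)) \<in> borel_measurable P" for n
    using measurable_A[of "[]"] by (intro borel_measurable_sum measurable_compose[OF _ assms]) auto
  from measurable_compose_countable[OF this measurable_N[OF Nil_in_nodes]] show ?thesis .
qed

lemma dev_root: "dev V r (mark N A [] w) = offspring_sum N A w *v cvec V - r *\<^sub>R cvec V"
  by (simp add: dev_def offspring_sum_def sum_matrix_vector_mult)

lemma dev_mean: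
  assumes "integrable P (offspring_sum N A)"
    and "integral\<^sup>L P (offspring_sum N A) *v cvec V = r *\<^sub>R cvec V"
  shows "integrable P (\<lambda>w. dev V r (mark N A [] w))" "(\<integral>w. dev V r (mark N A [] w) \<partial>P) = 0"
proof -
  have "linear (\<lambda>B :: complex ^ 'p ^ 'p. B *v cvec V)"
    by (intro linearI) (simp_all add: matrix_vector_mult_add_rdistrib scaleR_matrix_vector_mult)
  then have bl: "bounded_linear (\<lambda>B :: complex ^ 'p ^ 'p. B *v cvec V)"
    by (simp add: linear_conv_bounded_linear)
  note * = integrable_bounded_linear[OF bl assms(1)] integral_bounded_linear[OF bl assms(1)]
  show "integrable P (\<lambda>w. dev V r (mark N A [] w))" unfolding dev_root using *(1) by simp
  show "(\<integral>w. dev V r (mark N A [] w) \<partial>P) = 0"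
    unfolding dev_root using * assms(2) by (simp add: prob_space)
qed

lemma dev_moment:
  assumes \<gamma>: "1 \<le> \<gamma>"
    and int: "\<And>i j. integrable P (\<lambda>w. (\<Sum>k=1..N [] w. cmod (A [k] w $ i $ j)) powr \<gamma>)"
  shows "integrable P (\<lambda>w. norm (dev V r (mark N A [] w)) powr \<gamma>)"
proof (rule Bochner_Integration.integrable_bound)
  let ?T = "\<lambda>w i j. \<Sum>k=1..N [] w. cmod (A [k] w $ i $ j)"
  let ?p = "real CARD('p)"
  let ?v = "norm (cvec V)"
  let ?R = "\<lambda>w. 2 powr \<gamma> * (?p powr (\<gamma> - 1) * (\<Sum>i\<in>UNIV. ?p powr (\<gamma> - 1) * (\<Sum>j\<in>UNIV. ?T w i j powr \<gamma>)) * ?v powr \<gamma>)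
      + 2 powr \<gamma> * (\<bar>r\<bar> * ?v) powr \<gamma>"
  show "integrable P ?R" using int by simp
  show "AE w in P. norm (norm (dev V r (mark N A [] w)) powr \<gamma>) \<le> norm (?R w)"
  proof (rule AE_I2)
    fix w
    have T_nn: "0 \<le> ?T w i j" for i j by (simp add: sum_nonneg)
    have "entry_sum (offspring_sum N A w) \<le> (\<Sum>i\<in>UNIV. \<Sum>j\<in>UNIV. ?T w i j)"
      unfolding entry_sum_def offspring_sum_def by (intro sum_mono) (simp add: norm_sum)
    then have "entry_sum (offspring_sum N A w) powr \<gamma> \<le> (\<Sum>i\<in>UNIV. \<Sum>j\<in>UNIV. ?T w i j) powr \<gamma>"
      using \<gamma> by (intro powr_mono2) auto
    also have "\<dots> \<le> ?p powr (\<gamma> - 1) * (\<Sum>i\<in>UNIV. (\<Sum>j\<in>UNIV. ?T w i j) powr \<gamma>)"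
      using \<gamma> by (intro sum_powr_le_card sum_nonneg) auto
    also have "\<dots> \<le> ?p powr (\<gamma> - 1) * (\<Sum>i\<in>UNIV. ?p powr (\<gamma> - 1) * (\<Sum>j\<in>UNIV. ?T w i j powr \<gamma>))"
      using \<gamma> T_nn by (intro mult_left_mono sum_mono sum_powr_le_card) auto
    finally have 1: "entry_sum (offspring_sum N A w) powr \<gamma> \<le> \<dots>" .
    have "norm (dev V r (mark N A [] w)) \<le> entry_sum (offspring_sum N A w) * ?v + \<bar>r\<bar> * ?v"
      unfolding dev_root
      by (rule order_trans[OF norm_triangle_ineq4]) (simp add: norm_matrix_vector_mult_le)
    then have "norm (dev V r (mark N A [] w)) powr \<gamma> \<le> (entry_sum (offspring_sum N A w) * ?v + \<bar>r\<bar> * ?v) powr \<gamma>"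
      using \<gamma> by (intro powr_mono2) auto
    also have "\<dots> \<le> (1 + 1) powr \<gamma> * (entry_sum (offspring_sum N A w) * ?v) powr \<gamma> + (1 + 1/1) powr \<gamma> * (\<bar>r\<bar> * ?v) powr \<gamma>"
      using \<gamma> by (intro add_powr_le) auto
    also have "\<dots> = 2 powr \<gamma> * (entry_sum (offspring_sum N A w) powr \<gamma> * ?v powr \<gamma>) + 2 powr \<gamma> * (\<bar>r\<bar> * ?v) powr \<gamma>"
      by (simp add: powr_mult)
    also have "\<dots> \<le> ?R w"
      by (intro add_right_mono mult_left_mono mult_right_mono 1) auto
    finally show "norm (norm (dev V r (mark N A [] w)) powr \<gamma>) \<le> norm (?R w)" by simp
  qed
  have [measurable]: "(\<lambda>w. dev V r (mark N A [] w)) \<in> borel_measurable P"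
    using measurable_compose[OF measurable_mark measurable_dev] by simp
  show "(\<lambda>w. norm (dev V r (mark N A [] w)) powr \<gamma>) \<in> borel_measurable P" by measurable
qed

text \<open>\<open>A_nonneg\<close> expresses that all matrices have nonnegative real entries.
  Therefore the norm of the process bounds the sum of all entries of its products, and the first
  term of \<open>sum_powr_interpolation\<close> is again a multiple of the moment one started
  from.\<close>

lemma nonneg_moment_decay:
  assumes A_nonneg: "\<And>u w. A u w = cmat (abs_mat (A u w))"
    and x: "\<And>i. 0 < x $ i" and c: "0 \<le> c" "c < 1" and \<gamma>: "1 < \<gamma>"
    and mean: "(\<integral>w. dev x c (mark N A [] w) \<partial>P) = 0"
    and moment: "integrable P (\<lambda>w. norm (dev x c (mark N A [] w)) powr \<gamma>)"
    and C: "0 \<le> C" and \<rho>: "0 \<le> \<rho>" "\<rho> < 1"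
    and pow: "\<And>n. (\<integral>\<^sup>+w. ennreal (\<Sum>u\<in>gen n w. entry_sum (weight u w) powr \<gamma>) \<partial>P)
      \<le> ennreal (C * \<rho> ^ n)"
  obtains R s where "0 \<le> R" "0 \<le> s" "s < 1"
    "\<And>n. (\<integral>\<^sup>+w. ennreal ((\<Sum>u\<in>gen n w. entry_sum (weight u w)) powr \<gamma>) \<partial>P)
      \<le> ennreal (R * s ^ n)"
proof -
  define q where "q = min \<gamma> 2"
  have q: "1 < q" "q \<le> \<gamma>" using \<gamma> by (auto simp: q_def)
  let ?W = "mandelbrot N A x"
  let ?b = "\<lambda>w u. entry_sum (weight u w)"
  let ?gen = "\<lambda>w n. gen n w"
  have mb: "(\<lambda>w. ?b w u) \<in> borel_measurable P" if "u \<in> nodes" for u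
    using measurable_compose[OF measurable_branch_prods(1)[OF that] borel_measurable_entry_sum] .
  have [measurable]: "(\<lambda>w. \<Sum>u\<in>?gen w n. ?b w u) \<in> borel_measurable P"
    "(\<lambda>w. \<Sum>u\<in>?gen w n. ?b w u powr \<gamma>) \<in> borel_measurable P" for n
    using mb measurable_compose[OF mb, of _ "\<lambda>y. y powr \<gamma>" borel] by (intro measurable_sum_generation; simp)+
  obtain K where K: "0 \<le> K"
    "\<And>n. (\<integral>\<^sup>+w. ennreal (norm (?W (Suc n) w - c *\<^sub>R ?W n w) powr \<gamma>) \<partial>P)
      \<le> ennreal K * (\<integral>\<^sup>+w. ennreal ((\<Sum>u\<in>?gen w n. ?b w u powr q) powr (\<gamma> / q)) \<partial>P)"
    by (rule increment_moment_le[OF \<gamma> q_def mean moment]) blast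
  obtain z where z: "0 < z" and zx: "\<And>j. z \<le> x $ j" by (rule positive_vector_bound[OF x]) blast
  \<comment> \<open>Nothing cancels in \<open>?W n\<close>, and x >= z, so z times the sum of all
    entries is at most the sum of the p components of \<open>?W n\<close>, each of which is bounded
    by the norm.\<close>
  define \<kappa> where "\<kappa> = real CARD('p) / z"
  have \<kappa>: "0 < \<kappa>" using z by (simp add: \<kappa>_def)
  have b_le: "(\<Sum>u\<in>?gen w n. ?b w u) \<le> \<kappa> * norm (?W n w)" for w n
  proof -
    define H where "H u = abs_weight u w" for u
    have H_nn: "0 \<le> H u $ i $ j" for u i j
      unfolding H_def by (rule branch_prod_nonneg) (simp add: abs_mat_def)
    have bH: "weight u w = cmat (H u)" for u
      unfolding H_def cmat_branch_prod using A_nonneg by simp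
    have Wi: "?W n w $ i = complex_of_real (\<Sum>u\<in>?gen w n. \<Sum>j\<in>UNIV. H u $ i $ j * x $ j)" for i
      by (simp add: mandelbrot_def bH matrix_vector_mult_def cmat_def cvec_def)
    have "z * (\<Sum>u\<in>?gen w n. ?b w u) = (\<Sum>i\<in>UNIV. \<Sum>u\<in>?gen w n. \<Sum>j\<in>UNIV. H u $ i $ j * z)"
      unfolding bH entry_sum_cmat[OF H_nn] by (subst sum.swap) (simp add: sum_distrib_left mult.commute)
    also have "\<dots> \<le> (\<Sum>i\<in>UNIV. \<Sum>u\<in>?gen w n. \<Sum>j\<in>UNIV. H u $ i $ j * x $ j)"
      by (intro sum_mono mult_left_mono zx H_nn)
    also have "\<dots> \<le> (\<Sum>i\<in>UNIV. norm (?W n w $ i))"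
      by (intro sum_mono) (simp add: Wi del: of_real_sum)
    also have "\<dots> \<le> (\<Sum>i\<in>(UNIV :: 'p set). norm (?W n w))"
      by (intro sum_mono Finite_Cartesian_Product.norm_nth_le)
    finally show ?thesis using z by (simp add: \<kappa>_def field_simps)
  qed
  define Z where "Z n = (\<integral>\<^sup>+w. ennreal (norm (?W n w) powr \<gamma>) \<partial>P)" for n
  \<comment> \<open>For c > 0 this gives 1 - (1 + \<eta>) c = (1 - c) (2 - c) / 2 > 0: the
    deterministic part of the recursion stays a contraction after
    \<open>add_powr_le\<close>.\<close>
  define \<eta> where "\<eta> = (if c = 0 then 1 else (1 - c) / 2)"
  have \<eta>: "0 < \<eta>" using c by (auto simp: \<eta>_def)
  have \<eta>c: "(1 + \<eta>) * c < 1"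
  proof (cases "c = 0")
    case False
    have "0 < (1 - c) * (2 - c)" using c by (intro mult_pos_pos) auto
    then show ?thesis using False by (simp add: \<eta>_def field_simps)
  qed simp
  define \<theta>1 where "\<theta>1 = ((1 + \<eta>) * c) powr \<gamma>"
  have \<theta>1: "0 \<le> \<theta>1" "\<theta>1 < 1"
    using powr_less_mono2[of \<gamma> "(1 + \<eta>) * c" 1] \<eta>c c \<eta> \<gamma> by (auto simp: \<theta>1_def)
  define E where "E = (1 + 1 / \<eta>) powr \<gamma> * K"
  have E: "0 \<le> E" using K by (simp add: E_def)
  define e where "e = (q - 1) * (\<gamma> / q)"
  have e: "0 < e" using q by (simp add: e_def)
  \<comment> \<open>The summand 1 keeps \<open>D\<close> positive when E = 0. With the \<delta>
    below, the term E \<delta>^e \<kappa>^\<gamma> that returns to \<open>Z n\<close> is at most (1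
    - \<theta>1)/2, half of the gap left by \<open>\<theta>1\<close>.\<close>
  define D where "D = E * \<kappa> powr \<gamma> + 1"
  have D: "0 < D" using E by (simp add: D_def add_nonneg_pos)
  define \<delta> where "\<delta> = ((1 - \<theta>1) / (2 * D)) powr (1 / e)"
  have \<delta>: "0 < \<delta>" using \<theta>1 D by (simp add: \<delta>_def)
  have \<delta>e: "\<delta> powr e = (1 - \<theta>1) / (2 * D)" using \<theta>1 D e by (simp add: \<delta>_def powr_powr)
  define \<theta> where "\<theta> = \<theta>1 + E * (\<delta> powr e * \<kappa> powr \<gamma>)"
  have "E * (\<delta> powr e * \<kappa> powr \<gamma>) \<le> (1 - \<theta>1) / 2"
  proof -
    have "E * (\<delta> powr e * \<kappa> powr \<gamma>) = (D - 1) * ((1 - \<theta>1) / (2 * D))"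
      by (simp add: D_def \<delta>e)
    also have "\<dots> \<le> D * ((1 - \<theta>1) / (2 * D))" using \<theta>1 D by (intro mult_right_mono) auto
    also have "\<dots> = (1 - \<theta>1) / 2" using D by simp
    finally show ?thesis .
  qed
  then have \<theta>: "0 \<le> \<theta>" "\<theta> < 1" using \<theta>1 E by (auto simp: \<theta>_def)
  define L where "L = E * (\<delta> powr (- \<gamma>) * C)"
  have L: "0 \<le> L" using E C by (simp add: L_def)
  \<comment> \<open>The part with the small factor goes back to \<open>Z n\<close> by
    \<open>b_le\<close>; the other part decays by \<open>pow\<close>.\<close>
  have interp: "(\<integral>\<^sup>+w. ennreal ((\<Sum>u\<in>?gen w n. ?b w u powr q) powr (\<gamma> / q)) \<partial>P)
    \<le> ennreal (\<delta> powr e * \<kappa> powr \<gamma>) * Z n + ennreal (\<delta> powr (- \<gamma>) * C * \<rho> ^ n)" for n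
  proof -
    have "(\<integral>\<^sup>+w. ennreal ((\<Sum>u\<in>?gen w n. ?b w u powr q) powr (\<gamma> / q)) \<partial>P)
      \<le> (\<integral>\<^sup>+w. (ennreal (\<delta> powr e * \<kappa> powr \<gamma>) * ennreal (norm (?W n w) powr \<gamma>)
          + ennreal (\<delta> powr (- \<gamma>)) * ennreal (\<Sum>u\<in>?gen w n. ?b w u powr \<gamma>)) \<partial>P)"
    proof (rule nn_integral_mono)
      fix w
      have "(\<Sum>u\<in>?gen w n. ?b w u powr q) powr (\<gamma> / q)
        \<le> \<delta> powr e * (\<Sum>u\<in>?gen w n. ?b w u) powr \<gamma> + \<delta> powr (- \<gamma>) * (\<Sum>u\<in>?gen w n. ?b w u powr \<gamma>)"
        unfolding e_def using q \<delta> by (intro sum_powr_interpolation) auto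
      also have "\<dots> \<le> \<delta> powr e * (\<kappa> * norm (?W n w)) powr \<gamma> + \<delta> powr (- \<gamma>) * (\<Sum>u\<in>?gen w n. ?b w u powr \<gamma>)"
        using \<gamma> by (intro add_mono mult_left_mono powr_mono2 b_le order_refl) (auto simp: sum_nonneg)
      also have "\<dots> = \<delta> powr e * \<kappa> powr \<gamma> * norm (?W n w) powr \<gamma> + \<delta> powr (- \<gamma>) * (\<Sum>u\<in>?gen w n. ?b w u powr \<gamma>)"
        using \<kappa> by (simp add: powr_mult)
      finally show "ennreal ((\<Sum>u\<in>?gen w n. ?b w u powr q) powr (\<gamma> / q)) \<le>
        ennreal (\<delta> powr e * \<kappa> powr \<gamma>) * ennreal (norm (?W n w) powr \<gamma>)
          + ennreal (\<delta> powr (- \<gamma>)) * ennreal (\<Sum>u\<in>?gen w n. ?b w u powr \<gamma>)"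
        by (simp add: sum_nonneg ennreal_leI flip: ennreal_mult ennreal_plus)
    qed
    also have "\<dots> = ennreal (\<delta> powr e * \<kappa> powr \<gamma>) * Z n + ennreal (\<delta> powr (- \<gamma>)) *
        (\<integral>\<^sup>+w. ennreal (\<Sum>u\<in>?gen w n. ?b w u powr \<gamma>) \<partial>P)"
      unfolding Z_def by (simp add: nn_integral_add nn_integral_cmult)
    also have "\<dots> \<le> ennreal (\<delta> powr e * \<kappa> powr \<gamma>) * Z n + ennreal (\<delta> powr (- \<gamma>)) * ennreal (C * \<rho> ^ n)"
      by (intro add_mono mult_left_mono pow order_refl) simp
    finally show ?thesis using C \<rho> by (simp add: mult.assoc flip: ennreal_mult')
  qed
  have step: "Z (Suc n) \<le> ennreal \<theta> * Z n + ennreal (L * \<rho> ^ n)" for n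
  proof -
    have "Z (Suc n) \<le> (\<integral>\<^sup>+w. (ennreal \<theta>1 * ennreal (norm (?W n w) powr \<gamma>)
        + ennreal ((1 + 1 / \<eta>) powr \<gamma>) * ennreal (norm (?W (Suc n) w - c *\<^sub>R ?W n w) powr \<gamma>)) \<partial>P)"
      unfolding Z_def
    proof (rule nn_integral_mono)
      fix w
      have "norm (?W (Suc n) w) \<le> c * norm (?W n w) + norm (?W (Suc n) w - c *\<^sub>R ?W n w)"
        using norm_triangle_ineq[of "c *\<^sub>R ?W n w" "?W (Suc n) w - c *\<^sub>R ?W n w"] c by simp
      then have "norm (?W (Suc n) w) powr \<gamma> \<le> (c * norm (?W n w) + norm (?W (Suc n) w - c *\<^sub>R ?W n w)) powr \<gamma>"
        using \<gamma> by (intro powr_mono2) auto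
      also have "\<dots> \<le> (1 + \<eta>) powr \<gamma> * (c * norm (?W n w)) powr \<gamma> + (1 + 1 / \<eta>) powr \<gamma> * norm (?W (Suc n) w - c *\<^sub>R ?W n w) powr \<gamma>"
        using c \<eta> \<gamma> by (intro add_powr_le) auto
      also have "(1 + \<eta>) powr \<gamma> * (c * norm (?W n w)) powr \<gamma> = \<theta>1 * norm (?W n w) powr \<gamma>"
        using c \<eta> by (simp add: \<theta>1_def powr_mult)
      finally show "ennreal (norm (?W (Suc n) w) powr \<gamma>) \<le> ennreal \<theta>1 * ennreal (norm (?W n w) powr \<gamma>)
        + ennreal ((1 + 1 / \<eta>) powr \<gamma>) * ennreal (norm (?W (Suc n) w - c *\<^sub>R ?W n w) powr \<gamma>)"
        using \<theta>1 by (simp add: ennreal_leI flip: ennreal_mult ennreal_plus)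
    qed
    also have "\<dots> = ennreal \<theta>1 * Z n + ennreal ((1 + 1 / \<eta>) powr \<gamma>) *
        (\<integral>\<^sup>+w. ennreal (norm (?W (Suc n) w - c *\<^sub>R ?W n w) powr \<gamma>) \<partial>P)"
      unfolding Z_def by (simp add: nn_integral_add nn_integral_cmult)
    also have "\<dots> \<le> ennreal \<theta>1 * Z n + ennreal ((1 + 1 / \<eta>) powr \<gamma>) * (ennreal K *
        (ennreal (\<delta> powr e * \<kappa> powr \<gamma>) * Z n + ennreal (\<delta> powr (- \<gamma>) * C * \<rho> ^ n)))"
      by (intro add_mono mult_left_mono order_refl order_trans[OF K(2)] interp) auto
    also have "\<dots> = (ennreal \<theta>1 + ennreal E * ennreal (\<delta> powr e * \<kappa> powr \<gamma>)) * Z n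
        + ennreal E * ennreal (\<delta> powr (- \<gamma>) * C * \<rho> ^ n)"
      using K by (simp add: E_def ennreal_mult algebra_simps)
    also have "\<dots> = ennreal \<theta> * Z n + ennreal (L * \<rho> ^ n)"
      using \<theta>1 E C \<rho> by (simp add: \<theta>_def L_def mult.assoc flip: ennreal_mult ennreal_plus)
    finally show ?thesis .
  qed
  have "?W 0 = (\<lambda>_. cvec x)" by (simp add: mandelbrot_def[abs_def] generation_0)
  then have "Z 0 < \<infinity>" by (simp add: Z_def emeasure_space_1)
  from geometric_recursion_ennreal[OF \<theta> \<rho> L this step]
  obtain R s where R: "0 \<le> R" "0 \<le> s" "s < 1" "\<And>n. Z n \<le> ennreal (R * s ^ n)" by blast
  have "(\<integral>\<^sup>+w. ennreal ((\<Sum>u\<in>?gen w n. ?b w u) powr \<gamma>) \<partial>P) \<le> ennreal (\<kappa> powr \<gamma> * (R * s ^ n))" for n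
  proof (rule nn_integral_le_mult[OF _ _ _ R(4)[unfolded Z_def]])
    fix w
    have "(\<Sum>u\<in>?gen w n. ?b w u) powr \<gamma> \<le> (\<kappa> * norm (?W n w)) powr \<gamma>"
      using \<gamma> by (intro powr_mono2 b_le) (auto simp: sum_nonneg)
    then show "(\<Sum>u\<in>?gen w n. ?b w u) powr \<gamma> \<le> \<kappa> powr \<gamma> * norm (?W n w) powr \<gamma>"
      by (simp add: powr_mult)
  qed auto
  with R \<kappa> show ?thesis by (intro that[of "\<kappa> powr \<gamma> * R" s]) (auto simp: mult.assoc)
qed

end

section \<open>Powers of the branch products and the matrices \<open>Mhat\<close>\<close>

lemma entry_sum_powr_le:
  fixes B :: "complex ^ 'p ^ 'p"
  assumes "1 \<le> t"
  shows "entry_sum B powr t \<le> (real CARD('p) powr (t - 1))\<^sup>2 * (\<Sum>i\<in>UNIV. \<Sum>j\<in>UNIV. cmod (B $ i $ j) powr t)"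
proof -
  let ?p = "real CARD('p)"
  have "entry_sum B powr t \<le> ?p powr (t - 1) * (\<Sum>i\<in>UNIV. (\<Sum>j\<in>UNIV. cmod (B $ i $ j)) powr t)"
    unfolding entry_sum_def using assms by (intro sum_powr_le_card sum_nonneg) auto
  also have "\<dots> \<le> ?p powr (t - 1) * (\<Sum>i\<in>UNIV. ?p powr (t - 1) * (\<Sum>j\<in>UNIV. cmod (B $ i $ j) powr t))"
    using assms by (intro mult_left_mono sum_mono sum_powr_le_card) auto
  finally show ?thesis by (simp add: power2_eq_square sum_distrib_left mult.assoc)
qed

lemma entry_powr_one: "(\<And>i j. 0 \<le> B $ i $ j) \<Longrightarrow> entry_powr 1 B = B"
  by (simp add: entry_powr_def vec_eq_iff)

lemma abs_mat_nonneg: "0 \<le> abs_mat B $ i $ j"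
  by (simp add: abs_mat_def)

context branching_marks
begin

abbreviation abs_powr :: "real \<Rightarrow> nat list \<Rightarrow> 'w \<Rightarrow> real ^ 'p ^ 'p" where
  "abs_powr t u w \<equiv> entry_powr t (abs_mat (A u w))"

abbreviation powr_weight :: "real \<Rightarrow> nat list \<Rightarrow> 'w \<Rightarrow> real" where
  "powr_weight t u w \<equiv> \<Sum>i\<in>UNIV. \<Sum>j\<in>UNIV. branch_prod (\<lambda>u. abs_powr t u w) u $ i $ j"

lemma branching_marks_abs_powr: "branching_marks P N (\<lambda>u w. cmat (abs_powr t u w))"
  by (rule branching_marks_map[of "\<lambda>B. cmat (entry_powr t (abs_mat B))"]) measurable

lemma entry_sum_branch_prod_powr_le:
  assumes "1 \<le> t"
  shows "entry_sum (weight u w) powr t \<le>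
    (real CARD('p) powr (t - 1))\<^sup>2 * powr_weight t u w"
proof -
  have "cmod (weight u w $ i $ j) powr t \<le> branch_prod (\<lambda>u. abs_powr t u w) u $ i $ j" for i j
  proof -
    have "cmod (weight u w $ i $ j) powr t \<le> abs_weight u w $ i $ j powr t"
      using assms by (intro powr_mono2 cmod_branch_prod_le) auto
    also have "\<dots> \<le> branch_prod (\<lambda>u. abs_powr t u w) u $ i $ j"
      using assms by (intro branch_prod_powr_le abs_mat_nonneg)
    finally show ?thesis .
  qed
  then have "(\<Sum>i\<in>UNIV. \<Sum>j\<in>UNIV. cmod (weight u w $ i $ j) powr t)
      \<le> (powr_weight t u w)"
    by (intro sum_mono)
  then have "(real CARD('p) powr (t - 1))\<^sup>2 * (\<Sum>i\<in>UNIV. \<Sum>j\<in>UNIV. cmod (weight u w $ i $ j) powr t)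
      \<le> (real CARD('p) powr (t - 1))\<^sup>2 * powr_weight t u w"
    by (rule mult_left_mono) simp
  then show ?thesis using entry_sum_powr_le[OF assms] by (rule order_trans[rotated])
qed

lemma measurable_sum_abs_powr_prod [measurable]:
  "(\<lambda>w. \<Sum>u\<in>gen n w. powr_weight t u w) \<in> borel_measurable P"
proof -
  interpret G: branching_marks P N "\<lambda>u w. cmat (abs_powr t u w)" by (rule branching_marks_abs_powr)
  have abs: "abs_mat (cmat (abs_powr t u w)) = abs_powr t u w" for u w
    by (rule abs_mat_cmat) simp
  show ?thesis
    using G.measurable_branch_prods(2) unfolding abs
    by (intro measurable_sum_generation borel_measurable_sum borel_measurable_vec_nth)
qed

abbreviation row_sum :: "real \<Rightarrow> 'p \<Rightarrow> 'p \<Rightarrow> 'w \<Rightarrow> real" where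
  "row_sum t i j w \<equiv> \<Sum>k=1..N [] w. cmod (A [k] w $ i $ j) powr t"

lemma Mhat_nonneg: "0 \<le> Mhat P N A t $ i $ j"
  by (simp add: Mhat_def sum_nonneg integral_nonneg_AE)

text \<open>The mean offspring matrix of the family \<open>abs_powr t\<close> is p^(t-1) times
  \<open>Mhat P N A t\<close>, so x is an eigenvector of it for p^(t-1) r.\<close>

lemma abs_powr_prod_moment_le:
  assumes x: "\<And>i. 0 < x $ i" and r: "0 \<le> r" and eig: "Mhat P N A t *v x = r *\<^sub>R x"
    and int: "\<And>i j. integrable P (row_sum t i j)"
  obtains C where "0 \<le> C"
    "\<And>n. (\<integral>\<^sup>+w. ennreal (\<Sum>u\<in>gen n w. powr_weight t u w) \<partial>P) \<le> ennreal (C * (real CARD('p) powr (t - 1) * r) ^ n)"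
proof -
  interpret G: branching_marks P N "\<lambda>u w. cmat (abs_powr t u w)" by (rule branching_marks_abs_powr)
  let ?p = "real CARD('p) powr (t - 1)"
  have abs: "abs_mat (cmat (abs_powr t u w)) = abs_powr t u w" for u w
    by (rule abs_mat_cmat) simp
  have "(\<integral>\<^sup>+w. ennreal (G.offspring_abs x (mark N (\<lambda>u w. cmat (abs_powr t u w)) [] w) $ i) \<partial>P) \<le> ennreal (?p * r * x $ i)" for i
  proof -
    have eq: "G.offspring_abs x (mark N (\<lambda>u w. cmat (abs_powr t u w)) [] w) $ i =
        (\<Sum>j\<in>UNIV. row_sum t i j w * (?p * x $ j))" for w
    proof -
      have "G.offspring_abs x (mark N (\<lambda>u w. cmat (abs_powr t u w)) [] w) $ i =
          (\<Sum>k=1..N [] w. \<Sum>j\<in>UNIV. abs_powr t [k] w $ i $ j * x $ j)"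
        by (simp add: G.offspring_abs_def abs matrix_vector_mult_def)
      also have "\<dots> = (\<Sum>j\<in>UNIV. \<Sum>k=1..N [] w. abs_powr t [k] w $ i $ j * x $ j)"
        by (rule sum.swap)
      finally show ?thesis
        by (simp add: entry_powr_def abs_mat_def sum_distrib_left sum_distrib_right mult_ac)
    qed
    have "(\<integral>\<^sup>+w. ennreal (G.offspring_abs x (mark N (\<lambda>u w. cmat (abs_powr t u w)) [] w) $ i) \<partial>P) =
      ennreal (\<integral>w. (\<Sum>j\<in>UNIV. row_sum t i j w * (?p * x $ j)) \<partial>P)"
      unfolding eq using int x
      by (intro nn_integral_eq_integral Bochner_Integration.integrable_sum integrable_mult_left)
         (auto intro!: AE_I2 sum_nonneg mult_nonneg_nonneg less_imp_le[OF x])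
    also have "(\<integral>w. (\<Sum>j\<in>UNIV. row_sum t i j w * (?p * x $ j)) \<partial>P)
      = (\<Sum>j\<in>UNIV. Mhat P N A t $ i $ j * (?p * x $ j))"
      using int by (subst Bochner_Integration.integral_sum) (auto simp: Mhat_def)
    also have "\<dots> = ?p * (Mhat P N A t *v x) $ i"
      by (simp add: matrix_vector_mult_def sum_distrib_left mult_ac)
    finally show ?thesis by (simp add: eig mult.assoc)
  qed
  from G.abs_prod_sum_moment_le[OF x _ this] r obtain C where "0 \<le> C"
    "\<And>n. (\<integral>\<^sup>+w. ennreal (\<Sum>u\<in>gen n w. \<Sum>i\<in>UNIV. \<Sum>j\<in>UNIV.
        branch_prod (\<lambda>u. abs_mat (cmat (abs_powr t u w))) u $ i $ j) \<partial>P) \<le> ennreal (C * (?p * r) ^ n)"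
    by auto
  with that show ?thesis unfolding abs by blast
qed

text \<open>The sum of t-th powers is at most the t-th power of the sum. Hence the single moment
  condition at \<alpha> makes \<open>Mhat\<close> meaningful on [1, \<alpha>] and also controls the
  power \<alpha>/t of the row sums.\<close>

lemma integrable_offspring_powr:
  assumes int: "integrable P (\<lambda>w. (\<Sum>k=1..N [] w. cmod (A [k] w $ i $ j)) powr \<alpha>)"
    and t: "1 \<le> t" "t \<le> \<alpha>"
  shows "integrable P (row_sum t i j)"
    and "integrable P (\<lambda>w. row_sum t i j w powr (\<alpha> / t))"
proof -
  let ?T = "\<lambda>w. \<Sum>k=1..N [] w. cmod (A [k] w $ i $ j)"
  have mT: "?T \<in> borel_measurable P" by (rule measurable_offspring) measurable
  have mTt [measurable]: "(row_sum t i j) \<in> borel_measurable P"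
    by (rule measurable_offspring) measurable
  have T_nn: "norm (?T w) = ?T w" for w by (simp add: sum_nonneg)
  have le: "row_sum t i j w \<le> ?T w powr t" for w
    using t by (intro sum_powr_le_powr_sum) auto
  have "integrable P (\<lambda>w. norm (?T w) powr t)"
    using lyapunov_inequality(1)[OF mT, of \<alpha> t] int t unfolding T_nn by simp
  then have Tt: "integrable P (\<lambda>w. ?T w powr t)" unfolding T_nn .
  show "integrable P (row_sum t i j)"
    by (rule Bochner_Integration.integrable_bound[OF Tt mTt]) (use le in \<open>simp add: sum_nonneg\<close>)
  show "integrable P (\<lambda>w. row_sum t i j w powr (\<alpha> / t))"
  proof (rule Bochner_Integration.integrable_bound[OF int])
    show "AE w in P. norm (row_sum t i j w powr (\<alpha> / t)) \<le> norm (?T w powr \<alpha>)"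
    proof (rule AE_I2)
      fix w
      have "row_sum t i j w powr (\<alpha> / t) \<le> (?T w powr t) powr (\<alpha> / t)"
        using t le by (intro powr_mono2) (auto simp: sum_nonneg)
      also have "\<dots> = ?T w powr \<alpha>" using t by (simp add: powr_powr)
      finally show "norm (row_sum t i j w powr (\<alpha> / t)) \<le> norm (?T w powr \<alpha>)"
        by simp
    qed
  qed measurable
qed

text \<open>If the mean of a nonnegative sum is 0, all its terms vanish almost surely, whatever
  their exponent. Integrability matters here: a non-integrable function would have integral 0 by
  convention.\<close>

lemma Mhat_entry_pos:
  assumes int: "integrable P (row_sum t i j)"
    and pos: "0 < Mhat P N A 1 $ i $ j"
  shows "0 < Mhat P N A t $ i $ j"
proof (rule ccontr)
  assume "\<not> 0 < Mhat P N A t $ i $ j"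
  then have "Mhat P N A t $ i $ j = 0" using Mhat_nonneg[of t i j] by simp
  then have "(\<integral>w. row_sum t i j w \<partial>P) = 0" by (simp add: Mhat_def)
  then have "AE w in P. row_sum t i j w = 0"
    using int by (subst (asm) integral_nonneg_eq_0_iff_AE) (auto simp: sum_nonneg)
  then have "AE w in P. row_sum 1 i j w = 0"
    by eventually_elim (subst (asm) sum_nonneg_eq_0_iff; auto)
  then have "(\<integral>w. row_sum 1 i j w \<partial>P) = 0"
    by (rule integral_eq_zero_AE)
  with pos show False by (simp add: Mhat_def)
qed

lemma rho_hat_eigenvector:
  assumes int: "\<And>i j. integrable P (row_sum t i j)"
    and n: "1 \<le> n" "\<And>i j. 0 < mat_pow (Mhat P N A 1) n $ i $ j"
  obtains x where "\<And>i. 0 < x $ i" "Mhat P N A t *v x = rho_hat P N A t *\<^sub>R x" "0 \<le> rho_hat P N A t"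
proof -
  have "0 < mat_pow (Mhat P N A t) n $ i $ j" for i j
    by (rule mat_pow_pos_mono[OF Mhat_nonneg Mhat_nonneg Mhat_entry_pos[OF int] n(2)])
  from perron_frobenius[OF Mhat_nonneg n(1) this] that show ?thesis
    unfolding rho_hat_def by blast
qed

lemma powr_weight_moment_le:
  assumes int: "\<And>i j. integrable P (\<lambda>w. (\<Sum>k=1..N [] w. cmod (A [k] w $ i $ j)) powr \<alpha>)"
    and t: "1 \<le> t" "t \<le> \<alpha>"
    and n: "1 \<le> n" "\<And>i j. 0 < mat_pow (Mhat P N A 1) n $ i $ j"
  obtains C where "0 \<le> C" "0 \<le> rho_hat P N A t"
    "\<And>n. (\<integral>\<^sup>+w. ennreal (\<Sum>u\<in>gen n w. powr_weight t u w) \<partial>P) \<le> ennreal (C * (real CARD('p) powr (t - 1) * rho_hat P N A t) ^ n)"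
proof -
  note int' = integrable_offspring_powr(1)[OF int t]
  obtain x where x: "\<And>i. 0 < x $ i" "Mhat P N A t *v x = rho_hat P N A t *\<^sub>R x" "0 \<le> rho_hat P N A t"
    by (rule rho_hat_eigenvector[OF int' n]) blast
  show ?thesis by (rule abs_powr_prod_moment_le[OF x(1) x(3) x(2) int']) (rule that[OF _ x(3)])
qed

text \<open>An application of \<open>nonneg_moment_decay\<close> to the \<beta>-matrices, their
  Perron vector and the exponent \<gamma> = \<alpha>/\<beta>: \<rho>(\<beta>) yields the contraction
  factor c, and \<rho>(\<alpha>) yields the decay of the sums of \<gamma>-th powers.\<close>

lemma powr_sum_moment_decay:
  assumes \<alpha>: "1 < \<beta>" "\<beta> < \<alpha>"
    and int: "\<And>i j. integrable P (\<lambda>w. (\<Sum>k=1..N [] w. cmod (A [k] w $ i $ j)) powr \<alpha>)"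
    and n: "1 \<le> n" "\<And>i j. 0 < mat_pow (Mhat P N A 1) n $ i $ j"
    and c\<alpha>: "real CARD('p) powr (\<alpha> - 1) * rho_hat P N A \<alpha> < 1"
    and c\<beta>: "real CARD('p) powr (\<beta> - 1) * rho_hat P N A \<beta> < 1"
  obtains R s where "0 \<le> R" "0 \<le> s" "s < 1"
    "\<And>n. (\<integral>\<^sup>+w. ennreal ((\<Sum>u\<in>gen n w. powr_weight \<beta> u w) powr (\<alpha> / \<beta>)) \<partial>P) \<le> ennreal (R * s ^ n)"
proof -
  let ?B = "\<lambda>u w. cmat (abs_powr \<beta> u w)"
  interpret G: branching_marks P N "\<lambda>u w. ?B u w" by (rule branching_marks_abs_powr)
  let ?p = "real CARD('p)"
  define \<gamma> where "\<gamma> = \<alpha> / \<beta>"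
  have \<gamma>: "1 < \<gamma>" "\<beta> * \<gamma> = \<alpha>" using \<alpha> by (auto simp: \<gamma>_def)
  have int\<beta>: "integrable P (row_sum \<beta> i j)"
    and int\<gamma>: "integrable P (\<lambda>w. row_sum \<beta> i j w powr \<gamma>)" for i j
    using integrable_offspring_powr[OF int] \<alpha> by (auto simp: \<gamma>_def)
  obtain x where x: "\<And>i. 0 < x $ i" "Mhat P N A \<beta> *v x = rho_hat P N A \<beta> *\<^sub>R x" "0 \<le> rho_hat P N A \<beta>"
    by (rule rho_hat_eigenvector[OF int\<beta> n]) blast
  define c where "c = ?p powr (\<beta> - 1) * rho_hat P N A \<beta>"
  have c: "0 \<le> c" "c < 1" using x c\<beta> by (auto simp: c_def)
  obtain C where C: "0 \<le> C" and r0: "0 \<le> rho_hat P N A \<alpha>"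
    and C2: "\<And>n. (\<integral>\<^sup>+w. ennreal (\<Sum>u\<in>gen n w. powr_weight \<alpha> u w) \<partial>P) \<le> ennreal (C * (?p powr (\<alpha> - 1) * rho_hat P N A \<alpha>) ^ n)"
    by (rule powr_weight_moment_le[OF int _ order_refl n]) (use \<alpha> in auto)
  have abs: "abs_mat (?B u w) = abs_powr \<beta> u w" for u w
    by (rule abs_mat_cmat) simp
  let ?D = "\<lambda>w. G.dev x c (mark N (\<lambda>u w. ?B u w) [] w)"
  have cmod_sum: "(\<Sum>k=1..N [] w. cmod (cmat (abs_powr \<beta> [k] w) $ i $ j)) =
      ?p powr (\<beta> - 1) * row_sum \<beta> i j w" for w i j
    by (simp add: cmat_def entry_powr_def abs_mat_def sum_distrib_left norm_mult)
  have off: "offspring_sum N (\<lambda>u w. ?B u w) w =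
      cmat (\<chi> i j. ?p powr (\<beta> - 1) * row_sum \<beta> i j w)" for w
    by (simp add: offspring_sum_def cmat_def entry_powr_def abs_mat_def vec_eq_iff sum_distrib_left)
  have Gdev: "integrable P (\<lambda>w. ?D w)"
      "(\<integral>w. ?D w \<partial>P) = 0"
  proof -
    have dev: "?D w =
        (\<chi> i. complex_of_real ((\<Sum>j\<in>UNIV. row_sum \<beta> i j w * (?p powr (\<beta> - 1) * x $ j)) - c * x $ i))" for w
      unfolding G.dev_root off
      by (simp add: vec_eq_iff matrix_vector_mult_def cmat_def cvec_def scaleR_conv_of_real[where 'a = complex] mult_ac)
    have comp: "(\<integral>w. ((\<Sum>j\<in>UNIV. row_sum \<beta> i j w * (?p powr (\<beta> - 1) * x $ j)) - c * x $ i) \<partial>P) = 0" for i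
    proof -
      have "(\<integral>w. ((\<Sum>j\<in>UNIV. row_sum \<beta> i j w * (?p powr (\<beta> - 1) * x $ j)) - c * x $ i) \<partial>P)
        = (\<Sum>j\<in>UNIV. Mhat P N A \<beta> $ i $ j * (?p powr (\<beta> - 1) * x $ j)) - c * x $ i"
        using int\<beta> by (simp add: prob_space Mhat_def)
      also have "(\<Sum>j\<in>UNIV. Mhat P N A \<beta> $ i $ j * (?p powr (\<beta> - 1) * x $ j)) = ?p powr (\<beta> - 1) * (Mhat P N A \<beta> *v x) $ i"
        by (simp add: matrix_vector_mult_def sum_distrib_left mult_ac)
      finally show ?thesis by (simp add: x(2) c_def)
    qed
    have mom: "integrable P (\<lambda>w. norm (?D w) powr 1)"
    proof (rule G.dev_moment)
      fix i j
      show "integrable P (\<lambda>w. (\<Sum>k=1..N [] w. cmod (cmat (abs_powr \<beta> [k] w) $ i $ j)) powr 1)"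
        unfolding cmod_sum using int\<beta>[of i j] by (simp add: sum_nonneg)
    qed simp
    have m: "(\<lambda>w. ?D w) \<in> borel_measurable P"
      using measurable_compose[OF G.measurable_mark G.measurable_dev] by simp
    show int1: "integrable P (\<lambda>w. ?D w)"
      using mom by (intro integrable_norm_cancel[OF _ m]) simp
    have "(\<integral>w. ?D w \<partial>P) $ i = 0" for i
    proof -
      have "(\<integral>w. ?D w \<partial>P) $ i =
          (\<integral>w. ?D w $ i \<partial>P)"
        by (rule integral_bounded_linear[OF bounded_linear_vec_nth int1, symmetric])
      also have "\<dots> = complex_of_real (\<integral>w. ((\<Sum>j\<in>UNIV. row_sum \<beta> i j w *
          (?p powr (\<beta> - 1) * x $ j)) - c * x $ i) \<partial>P)"
        unfolding dev vec_lambda_beta by (rule integral_complex_of_real)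
      also have "\<dots> = 0" unfolding comp by simp
      finally show ?thesis .
    qed
    then show "(\<integral>w. ?D w \<partial>P) = 0"
      by (simp add: vec_eq_iff)
  qed
  have Gmom: "integrable P (\<lambda>w. norm (?D w) powr \<gamma>)"
  proof (rule G.dev_moment)
    fix i j
    show "integrable P (\<lambda>w. (\<Sum>k=1..N [] w. cmod (cmat (abs_powr \<beta> [k] w) $ i $ j)) powr \<gamma>)"
      unfolding cmod_sum using int\<gamma>[of i j] by (simp add: powr_mult sum_nonneg)
  qed (use \<gamma> in simp)
  have bp: "branch_prod (\<lambda>u. ?B u w) u = cmat (branch_prod (\<lambda>u. abs_powr \<beta> u w) u)" for u w
    by (rule cmat_branch_prod[symmetric])
  have bp_nn: "0 \<le> branch_prod (\<lambda>u. abs_powr \<beta> u w) u $ i $ j" for u w i j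
    by (rule branch_prod_nonneg) simp
  define \<kappa> where "\<kappa> = (?p powr (\<gamma> - 1))\<^sup>2"
  let ?H = "\<lambda>n w. \<Sum>u\<in>gen n w. powr_weight \<alpha> u w"
  let ?E = "\<lambda>n w. \<Sum>u\<in>gen n w. entry_sum (branch_prod (\<lambda>u. ?B u w) u) powr \<gamma>"
  let ?r = "?p powr (\<alpha> - 1) * rho_hat P N A \<alpha>"
  \<comment> \<open>By \<open>entry_powr_entry_powr\<close> the \<gamma>-th powers of the products
    of \<beta>-matrices are bounded by products of \<alpha>-matrices, whose first moments are known
    from \<open>C2\<close>.\<close>
  have pow: "(\<integral>\<^sup>+w. ennreal (?E n w) \<partial>P) \<le> ennreal (\<kappa> * C * ?r ^ n)" for n
    unfolding mult.assoc[of \<kappa>]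
  proof (rule nn_integral_le_mult[OF _ _ _ C2])
    fix w
    have "entry_sum (branch_prod (\<lambda>u. ?B u w) u) powr \<gamma> \<le> \<kappa> * powr_weight \<alpha> u w" for u
      using G.entry_sum_branch_prod_powr_le[of \<gamma> w u] \<gamma> \<alpha>
      by (simp add: abs entry_powr_entry_powr \<kappa>_def)
    then show "?E n w \<le> \<kappa> * ?H n w"
      unfolding sum_distrib_left[of \<kappa> _ "generation _ _"] by (intro sum_mono)
  qed (simp_all add: \<kappa>_def measurable_sum_abs_powr_prod)
  have nn: "?B u w = cmat (abs_mat (?B u w))" for u w by (simp only: abs)
  have \<kappa>C: "0 \<le> \<kappa> * C" using C by (simp add: \<kappa>_def)
  have c\<alpha>0: "0 \<le> ?p powr (\<alpha> - 1) * rho_hat P N A \<alpha>" using r0 by simp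
  obtain R s where R: "0 \<le> R" "0 \<le> s" "s < 1"
    "\<And>n. (\<integral>\<^sup>+w. ennreal ((\<Sum>u\<in>gen n w. entry_sum (branch_prod (\<lambda>u. ?B u w) u)) powr \<gamma>) \<partial>P)
      \<le> ennreal (R * s ^ n)"
    by (rule G.nonneg_moment_decay[OF nn x(1) c \<gamma>(1) Gdev(2) Gmom \<kappa>C c\<alpha>0 c\<alpha> pow]) blast
  show ?thesis
    by (rule that[OF R(1-3)]) (use R(4) in \<open>simp add: bp entry_sum_cmat[OF bp_nn] \<gamma>_def\<close>)
qed

end

text \<open>Since \<open>\<nu>\<close> is an arbitrary function with the norm axioms, this is the
  equivalence of norms in finite dimension: \<open>\<nu>\<close> is Lipschitz, hence continuous, and
  attains a positive minimum on the compact unit sphere.\<close>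

lemma matrix_norm_entry_le:
  fixes \<nu> :: "real ^ 'p ^ 'p \<Rightarrow> real"
  assumes "matrix_norm \<nu>"
  obtains c where "0 \<le> c" "\<And>B i j. \<bar>B $ i $ j\<bar> \<le> c * \<nu> B"
proof -
  have nn: "0 \<le> \<nu> B" and zero: "\<nu> B = 0 \<longleftrightarrow> B = 0" and scale: "\<nu> (c *\<^sub>R B) = \<bar>c\<bar> * \<nu> B"
    and tri: "\<nu> (B + C) \<le> \<nu> B + \<nu> C" for B C c
    using assms unfolding matrix_norm_def by blast+
  define K where "K = (\<Sum>b\<in>(Basis :: (real ^ 'p ^ 'p) set). \<nu> b)"
  have sum_le: "\<nu> (\<Sum>b\<in>S. f b) \<le> (\<Sum>b\<in>S. \<nu> (f b))" if "finite S"
    for S :: "(real ^ 'p ^ 'p) set" and f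
    using that
  proof induction
    case empty
    show ?case using zero[of 0] by simp
  next
    case (insert b S)
    then show ?case using tri[of "f b" "sum f S"] by simp
  qed
  have le: "\<nu> B \<le> K * norm B" for B
  proof -
    have "\<nu> B = \<nu> (\<Sum>b\<in>Basis. (B \<bullet> b) *\<^sub>R b)" by (simp add: euclidean_representation)
    also have "\<dots> \<le> (\<Sum>b\<in>Basis. \<nu> ((B \<bullet> b) *\<^sub>R b))" by (rule sum_le) simp
    also have "\<dots> \<le> (\<Sum>b\<in>Basis. norm B * \<nu> b)"
      unfolding scale by (intro sum_mono mult_right_mono nn Basis_le_norm)
    finally show ?thesis by (simp add: K_def sum_distrib_left mult.commute)
  qed
  have K: "0 \<le> K" unfolding K_def by (intro sum_nonneg nn)
  have lip: "\<bar>\<nu> B - \<nu> C\<bar> \<le> K * dist B C" for B C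
  proof -
    have "\<nu> (C - B) = \<nu> (B - C)" using scale[of "-1" "B - C"] by simp
    then show ?thesis
      using tri[of "B - C" C] tri[of "C - B" B] le[of "B - C"] by (simp add: dist_norm)
  qed
  have "K-lipschitz_on UNIV \<nu>"
    by (rule lipschitz_onI) (use lip K in \<open>auto simp: dist_real_def\<close>)
  then have "continuous_on UNIV \<nu>" by (rule lipschitz_on_continuous_on)
  then have "continuous_on (sphere 0 1) \<nu>" by (rule continuous_on_subset) simp
  moreover have "sphere (0 :: real ^ 'p ^ 'p) 1 \<noteq> {}" by simp
  ultimately obtain B0 where B0: "B0 \<in> sphere 0 1" "\<And>B. B \<in> sphere 0 1 \<Longrightarrow> \<nu> B0 \<le> \<nu> B"
    using continuous_attains_inf[of "sphere 0 1" \<nu>] by auto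
  have m: "0 < \<nu> B0"
  proof -
    have "B0 \<noteq> 0" using B0(1) by auto
    then show ?thesis using nn[of B0] zero[of B0] by linarith
  qed
  have norm_le: "norm B \<le> 1 / \<nu> B0 * \<nu> B" for B
  proof (cases "B = 0")
    case True
    then show ?thesis using zero[of 0] by simp
  next
    case False
    then have "(1 / norm B) *\<^sub>R B \<in> sphere 0 1" by simp
    from B0(2)[OF this] have "\<nu> B0 \<le> \<nu> B / norm B" unfolding scale by simp
    then show ?thesis using False m by (simp add: field_simps)
  qed
  have "\<bar>B $ i $ j\<bar> \<le> 1 / \<nu> B0 * \<nu> B" for B i j
  proof -
    have "\<bar>B $ i $ j\<bar> \<le> norm (B $ i)" by (rule component_le_norm_cart)
    also have "\<dots> \<le> norm B" by (rule Finite_Cartesian_Product.norm_nth_le)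
    finally show ?thesis using norm_le[of B] by linarith
  qed
  with m show ?thesis by (intro that[of "1 / \<nu> B0"]) auto
qed

lemma l1_norm_nonneg: "0 \<le> l1_norm v"
  by (simp add: l1_norm_def sum_nonneg)

lemma l1_norm_le: "l1_norm v \<le> real CARD('p) * norm v" for v :: "complex ^ 'p"
proof -
  have "l1_norm v \<le> (\<Sum>j\<in>(UNIV :: 'p set). norm v)"
    unfolding l1_norm_def by (intro sum_mono Finite_Cartesian_Product.norm_nth_le)
  then show ?thesis by simp
qed

lemma borel_measurable_l1_norm [measurable]: "l1_norm \<in> borel_measurable borel"
  unfolding l1_norm_def[abs_def] by measurable

lemma l1_norm_eq_0: "l1_norm v = 0 \<longleftrightarrow> v = 0"
  by (simp add: l1_norm_def sum_nonneg_eq_0_iff vec_eq_iff)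

context branching_marks
begin

lemma mandelbrot_increment_decay:
  assumes \<alpha>: "1 < \<alpha>"
    and int: "\<And>i j. integrable P (\<lambda>w. (\<Sum>k=1..N [] w. cmod (A [k] w $ i $ j)) powr \<alpha>)"
    and n: "1 \<le> n" "\<And>i j. 0 < mat_pow (Mhat P N A 1) n $ i $ j"
    and mean: "(\<integral>w. dev V 1 (mark N A [] w) \<partial>P) = 0"
    and cond: "\<alpha> \<le> 2 \<and> real CARD('p) powr (\<alpha> - 1) * rho_hat P N A \<alpha> < 1 \<or>
      2 < \<alpha> \<and> (\<exists>\<beta>. 1 < \<beta> \<and> \<beta> \<le> 2 \<and> real CARD('p) powr (\<alpha> - 1) * rho_hat P N A \<alpha> < 1 \<and>
        real CARD('p) powr (\<alpha> / \<beta>) * rho_hat P N A \<beta> < 1)"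
  obtains C s where "0 \<le> C" "0 \<le> s" "s < 1"
    "\<And>n. (\<integral>\<^sup>+w. ennreal (norm (mandelbrot N A V (Suc n) w - mandelbrot N A V n w) powr \<alpha>) \<partial>P) \<le> ennreal (C * s ^ n)"
proof -
  let ?p = "real CARD('p)"
  let ?gen = "\<lambda>w n. gen n w"
  let ?b = "\<lambda>w u. entry_sum (weight u w)"
  let ?H = "\<lambda>t w n. \<Sum>u\<in>?gen w n. powr_weight t u w"
  define q where "q = min \<alpha> 2"
  let ?Q = "\<lambda>n w. (\<Sum>u\<in>?gen w n. ?b w u powr q) powr (\<alpha> / q)"
  have b_le: "(\<Sum>u\<in>?gen w n. ?b w u powr t) \<le> (?p powr (t - 1))\<^sup>2 * ?H t w n" if "1 \<le> t" for t w n
    unfolding sum_distrib_left[of "(?p powr (t - 1))\<^sup>2" _ "?gen w n"]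
    by (intro sum_mono entry_sum_branch_prod_powr_le that)
  obtain K where K: "0 \<le> K"
    "\<And>n. (\<integral>\<^sup>+w. ennreal (norm (mandelbrot N A V (Suc n) w - 1 *\<^sub>R mandelbrot N A V n w) powr \<alpha>) \<partial>P)
      \<le> ennreal K * (\<integral>\<^sup>+w. ennreal (?Q n w) \<partial>P)"
    by (rule increment_moment_le[OF \<alpha> q_def mean dev_moment[OF less_imp_le[OF \<alpha>] int]]) blast
  have "\<exists>C s. 0 \<le> C \<and> 0 \<le> s \<and> s < 1 \<and>
    (\<forall>n. (\<integral>\<^sup>+w. ennreal (?Q n w) \<partial>P) \<le> ennreal (C * s ^ n))"
    using cond
  proof (elim disjE conjE exE)
    \<comment> \<open>Here q = \<alpha>, so the outer exponent \<alpha>/q is 1 and a first moment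
      decides.\<close>
    assume "\<alpha> \<le> 2" and c: "?p powr (\<alpha> - 1) * rho_hat P N A \<alpha> < 1"
    then have q: "q = \<alpha>" by (simp add: q_def)
    obtain C where C: "0 \<le> C" and r0: "0 \<le> rho_hat P N A \<alpha>"
      and C2: "\<And>n. (\<integral>\<^sup>+w. ennreal (?H \<alpha> w n) \<partial>P) \<le> ennreal (C * (?p powr (\<alpha> - 1) * rho_hat P N A \<alpha>) ^ n)"
      by (rule powr_weight_moment_le[OF int _ order_refl n]) (use \<alpha> in auto)
    define \<kappa> where "\<kappa> = (?p powr (\<alpha> - 1))\<^sup>2"
    have \<kappa>: "0 \<le> \<kappa>" by (simp add: \<kappa>_def)
    have "(\<integral>\<^sup>+w. ennreal (?Q n w) \<partial>P)
      \<le> ennreal (\<kappa> * C * (?p powr (\<alpha> - 1) * rho_hat P N A \<alpha>) ^ n)" for n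
      unfolding mult.assoc[of \<kappa>]
      by (rule nn_integral_le_mult[OF _ \<kappa> _ C2])
         (use b_le[of \<alpha>] \<alpha> in \<open>simp_all add: q \<kappa>_def sum_nonneg measurable_sum_abs_powr_prod\<close>)
    then show ?thesis
      using \<kappa> C r0 c
      by (intro exI[of _ "\<kappa> * C"] exI[of _ "?p powr (\<alpha> - 1) * rho_hat P N A \<alpha>"]) auto
  next
    fix \<beta> assume \<alpha>2: "2 < \<alpha>" and \<beta>: "1 < \<beta>" "\<beta> \<le> 2"
      and c\<alpha>: "?p powr (\<alpha> - 1) * rho_hat P N A \<alpha> < 1" and c\<beta>: "?p powr (\<alpha> / \<beta>) * rho_hat P N A \<beta> < 1"
    then have q: "q = 2" by (simp add: q_def)
    have r0: "0 \<le> rho_hat P N A \<beta>"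
      by (rule powr_weight_moment_le[OF int _ _ n]) (use \<alpha>2 \<beta> in auto)
    \<comment> \<open>Because \<beta> - 1 <= 1 <= \<alpha>/\<beta> and p >= 1, the condition on
      \<beta> gives p^(\<beta>-1) \<rho>(\<beta>) < 1, that is, the contraction factor of the
      auxiliary process is below 1.\<close>
    have "\<beta> - 1 \<le> 1" "1 \<le> \<alpha> / \<beta>" using \<alpha>2 \<beta> by auto
    then have "?p powr (\<beta> - 1) \<le> ?p powr (\<alpha> / \<beta>)" by (intro powr_mono) auto
    then have c\<beta>': "?p powr (\<beta> - 1) * rho_hat P N A \<beta> < 1"
      using mult_right_mono[OF _ r0] c\<beta> by (meson le_less_trans)
    obtain R s where R: "0 \<le> R" "0 \<le> s" "s < 1" "\<And>n. (\<integral>\<^sup>+w. ennreal (?H \<beta> w n powr (\<alpha> / \<beta>)) \<partial>P) \<le> ennreal (R * s ^ n)"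
      by (rule powr_sum_moment_decay[OF \<beta>(1) _ int n c\<alpha> c\<beta>']) (use \<alpha>2 \<beta> in auto)
    define \<kappa> where "\<kappa> = ((?p powr (\<beta> - 1))\<^sup>2) powr (\<alpha> / \<beta>)"
    have \<kappa>: "0 \<le> \<kappa>" by (simp add: \<kappa>_def)
    have "(\<integral>\<^sup>+w. ennreal (?Q n w) \<partial>P) \<le> ennreal (\<kappa> * R * s ^ n)" for n
      unfolding mult.assoc[of \<kappa>]
    proof (rule nn_integral_le_mult[OF _ \<kappa> _ R(4)])
      show "(\<lambda>w. ?H \<beta> w n powr (\<alpha> / \<beta>)) \<in> borel_measurable P" by measurable
      fix w
      \<comment> \<open>As 2/\<beta> >= 1, the sum of squares is at most the power 2/\<beta> of the
        sum of \<beta>-th powers; with the outer exponent \<alpha>/2 this becomes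
        \<alpha>/\<beta>.\<close>
      have "(\<Sum>u\<in>?gen w n. ?b w u powr q) = (\<Sum>u\<in>?gen w n. (?b w u powr \<beta>) powr (2 / \<beta>))"
        using \<beta> by (simp add: q powr_powr)
      also have "\<dots> \<le> (\<Sum>u\<in>?gen w n. ?b w u powr \<beta>) powr (2 / \<beta>)"
        using \<beta> by (intro sum_powr_le_powr_sum) auto
      finally have "(\<Sum>u\<in>?gen w n. ?b w u powr q) powr (\<alpha> / q) \<le> ((\<Sum>u\<in>?gen w n. ?b w u powr \<beta>) powr (2 / \<beta>)) powr (\<alpha> / q)"
        using \<alpha> by (intro powr_mono2) (auto simp: q sum_nonneg)
      also have "\<dots> = (\<Sum>u\<in>?gen w n. ?b w u powr \<beta>) powr (\<alpha> / \<beta>)" by (simp add: q powr_powr)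
      also have "\<dots> \<le> ((?p powr (\<beta> - 1))\<^sup>2 * ?H \<beta> w n) powr (\<alpha> / \<beta>)"
        using \<alpha> \<beta> b_le by (intro powr_mono2) (auto simp: sum_nonneg)
      also have "\<dots> = \<kappa> * ?H \<beta> w n powr (\<alpha> / \<beta>)"
        unfolding \<kappa>_def by (rule powr_mult)
      finally show "?Q n w \<le> \<kappa> * ?H \<beta> w n powr (\<alpha> / \<beta>)" .
    qed
    then show ?thesis using \<kappa> R by (intro exI[of _ "\<kappa> * R"] exI[of _ s]) auto
  qed
  then obtain C s where C: "0 \<le> C" "0 \<le> s" "s < 1"
    "\<And>n. (\<integral>\<^sup>+w. ennreal (?Q n w) \<partial>P) \<le> ennreal (C * s ^ n)" by blast
  show ?thesis
  proof (rule that[of "K * C" s])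
    fix n
    have "(\<integral>\<^sup>+w. ennreal (norm (mandelbrot N A V (Suc n) w - mandelbrot N A V n w) powr \<alpha>) \<partial>P) \<le> ennreal K * ennreal (C * s ^ n)"
      using order_trans[OF K(2) mult_left_mono[OF C(4)]] by simp
    then show "(\<integral>\<^sup>+w. ennreal (norm (mandelbrot N A V (Suc n) w - mandelbrot N A V n w) powr \<alpha>) \<partial>P) \<le> ennreal (K * C * s ^ n)"
      using K by (simp add: mult.assoc flip: ennreal_mult')
  qed (use K C in auto)
qed

end

section \<open>Convergence, mean and non-degeneracy of the limit\<close>

theorem theorem6p1:
  fixes P :: "'w measure"
    and N :: "nat list \<Rightarrow> 'w \<Rightarrow> nat"
    and A :: "nat list \<Rightarrow> 'w \<Rightarrow> complex ^ 'p ^ 'p"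
    and M :: "complex ^ 'p ^ 'p"
    and U V :: "real ^ 'p"
    and \<nu> :: "real ^ 'p ^ 'p \<Rightarrow> real"
    and \<alpha> :: real
  assumes prob: "prob_space P"
    and indep: "prob_space.indep_vars P (\<lambda>_. mark_space) (mark N A) nodes"
    and copies: "\<forall>u\<in>nodes. distr P mark_space (mark N A u) = distr P mark_space (mark N A [])"
    and zero: "\<forall>\<omega>\<in>space P. \<forall>k > N [] \<omega>. A [k] \<omega> = 0"
    and M_finite: "integrable P (offspring_sum N A)"
    and M_def: "M = integral\<^sup>L P (offspring_sum N A)"
    and M_pos: "strictly_positive M"
    and M_eig: "max_modulus_eigenvalue M 1"
    and U_eig: "cvec U v* M = cvec U"
    and V_eig: "M *v cvec V = cvec V"
    and U_pos: "\<forall>i. 0 < U $ i"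
    and V_pos: "\<forall>i. 0 < V $ i"
    and U_norm: "(\<Sum>i\<in>UNIV. U $ i) = 1"
    and UV_norm: "(\<Sum>i\<in>UNIV. U $ i * V $ i) = 1"
    and Mhat_finite: "integrable P (offspring_abs_sum N A)"
    and Mhat_pos: "strictly_positive (cmat (integral\<^sup>L P (offspring_abs_sum N A)))"
    and norm: "matrix_norm \<nu>"
    and alpha: "1 < \<alpha>"
    and moment: "integrable P (\<lambda>\<omega>. \<nu> (offspring_abs_sum N A \<omega>) powr \<alpha>)"
    and cond:
      "(\<alpha> \<le> 2 \<and> real CARD('p) powr (\<alpha> - 1) * rho_hat P N A \<alpha> < 1) \<or>
       (\<alpha> > 2 \<and> (\<exists>\<beta>. 1 < \<beta> \<and> \<beta> \<le> 2 \<and>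
          max (real CARD('p) powr (\<alpha> - 1) * rho_hat P N A \<alpha>)
              (real CARD('p) powr (\<alpha> / \<beta>) * rho_hat P N A \<beta>) < 1))"
  shows
    "(\<forall>n. integrable P (\<lambda>\<omega>. l1_norm (mandelbrot N A V n \<omega>) powr \<alpha>)) \<and>
     bdd_above (range (\<lambda>n. integral\<^sup>L P (\<lambda>\<omega>. l1_norm (mandelbrot N A V n \<omega>) powr \<alpha>))) \<and>
     (\<exists>Y :: 'w \<Rightarrow> complex ^ 'p.
        Y \<in> borel_measurable P \<and>
        (AE \<omega> in P. (\<lambda>n. mandelbrot N A V n \<omega>) \<longlonglongrightarrow> Y \<omega>) \<and>
        (\<forall>n. integrable P (\<lambda>\<omega>. l1_norm (mandelbrot N A V n \<omega> - Y \<omega>) powr \<alpha>)) \<and>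
        (\<lambda>n. integral\<^sup>L P (\<lambda>\<omega>. l1_norm (mandelbrot N A V n \<omega> - Y \<omega>) powr \<alpha>)) \<longlonglongrightarrow> 0 \<and>
        integrable P Y \<and> integral\<^sup>L P Y = cvec V \<and>
        integrable P (\<lambda>\<omega>. l1_norm (Y \<omega>) powr \<alpha>) \<and>
        0 < integral\<^sup>L P (\<lambda>\<omega>. l1_norm (Y \<omega>) powr \<alpha>))"
proof -
  interpret prob_space P by (rule prob)
  interpret branching_marks P N A
    by unfold_locales (use indep copies in blast)+
  let ?Y = "mandelbrot N A V"
  have T_eq: "offspring_abs_sum N A w $ i $ j = (\<Sum>k=1..N [] w. cmod (A [k] w $ i $ j))" for w i j
    by (simp add: offspring_abs_sum_def abs_mat_def)
  \<comment> \<open>The moment hypothesis concerns an arbitrary matrix norm, whereas the estimates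
    above work with single entries.\<close>
  obtain c where c: "0 \<le> c" "\<And>B i j. \<bar>B $ i $ j\<bar> \<le> c * \<nu> B"
    by (rule matrix_norm_entry_le[OF norm]) blast
  have int: "integrable P (\<lambda>w. (\<Sum>k=1..N [] w. cmod (A [k] w $ i $ j)) powr \<alpha>)" for i j
  proof (rule Bochner_Integration.integrable_bound)
    show "integrable P (\<lambda>w. c powr \<alpha> * \<nu> (offspring_abs_sum N A w) powr \<alpha>)"
      using moment by (rule integrable_mult_right)
    have [measurable]: "(\<lambda>w. \<Sum>k=1..N [] w. cmod (A [k] w $ i $ j)) \<in> borel_measurable P"
      by (rule measurable_offspring) measurable
    show "(\<lambda>w. (\<Sum>k=1..N [] w. cmod (A [k] w $ i $ j)) powr \<alpha>) \<in> borel_measurable P" by measurable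
    show "AE w in P. norm ((\<Sum>k=1..N [] w. cmod (A [k] w $ i $ j)) powr \<alpha>) \<le>
        norm (c powr \<alpha> * \<nu> (offspring_abs_sum N A w) powr \<alpha>)"
    proof (rule AE_I2)
      fix w
      have nu: "0 \<le> \<nu> (offspring_abs_sum N A w)" using norm by (simp add: matrix_norm_def)
      have "(\<Sum>k=1..N [] w. cmod (A [k] w $ i $ j)) \<le> c * \<nu> (offspring_abs_sum N A w)"
        using c(2)[of "offspring_abs_sum N A w" i j] unfolding T_eq by linarith
      then have "(\<Sum>k=1..N [] w. cmod (A [k] w $ i $ j)) powr \<alpha> \<le> (c * \<nu> (offspring_abs_sum N A w)) powr \<alpha>"
        using alpha by (intro powr_mono2) (auto simp: sum_nonneg)
      then show "norm ((\<Sum>k=1..N [] w. cmod (A [k] w $ i $ j)) powr \<alpha>) \<le>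
          norm (c powr \<alpha> * \<nu> (offspring_abs_sum N A w) powr \<alpha>)"
        using c(1) nu by (simp add: powr_mult)
    qed
  qed
  \<comment> \<open>The strictly positive mean modulus matrix is the member t = 1 of the family
    \<open>Mhat\<close>, from which positivity passes to the other exponents.\<close>
  have "Mhat P N A 1 = integral\<^sup>L P (offspring_abs_sum N A)"
  proof -
    have "integral\<^sup>L P (offspring_abs_sum N A) $ i $ j = (\<integral>w. offspring_abs_sum N A w $ i $ j \<partial>P)" for i j
      using integral_bounded_linear[OF bounded_linear_vec_nth Mhat_finite, of i]
        integral_bounded_linear[OF bounded_linear_vec_nth integrable_bounded_linear[OF bounded_linear_vec_nth Mhat_finite, of i], of j]
      by simp
    then show ?thesis by (simp add: vec_eq_iff Mhat_def T_eq)
  qed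
  with Mhat_pos obtain n where n: "1 \<le> n" "\<And>i j. 0 < mat_pow (Mhat P N A 1) n $ i $ j"
    unfolding strictly_positive_cmat by auto
  have "integral\<^sup>L P (offspring_sum N A) *v cvec V = 1 *\<^sub>R cvec V"
    using V_eig M_def by simp
  note dev = dev_mean[OF M_finite this]
  have cond': "\<alpha> \<le> 2 \<and> real CARD('p) powr (\<alpha> - 1) * rho_hat P N A \<alpha> < 1 \<or>
      2 < \<alpha> \<and> (\<exists>\<beta>. 1 < \<beta> \<and> \<beta> \<le> 2 \<and> real CARD('p) powr (\<alpha> - 1) * rho_hat P N A \<alpha> < 1 \<and>
        real CARD('p) powr (\<alpha> / \<beta>) * rho_hat P N A \<beta> < 1)"
    using cond by auto
  obtain C s where C: "0 \<le> C" "0 \<le> s" "s < 1"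
    "\<And>n. (\<integral>\<^sup>+w. ennreal (norm (?Y (Suc n) w - ?Y n w) powr \<alpha>) \<partial>P) \<le> ennreal (C * s ^ n)"
    by (rule mandelbrot_increment_decay[OF alpha int n dev(2) cond']) blast
  have Y0: "?Y 0 = (\<lambda>_. cvec V)" by (simp add: mandelbrot_def[abs_def] generation_0)
  then have "integrable P (\<lambda>w. norm (?Y 0 w) powr \<alpha>)" by simp
  from converges_of_geometric_increments[OF measurable_mandelbrot alpha this C(1-3) C(4)]
  obtain Z G where Z [measurable]: "Z \<in> borel_measurable P" and G [measurable]: "G \<in> borel_measurable P"
    and G_int: "integrable P (\<lambda>w. G w powr \<alpha>)"
    and lim: "AE w in P. (\<lambda>n. ?Y n w) \<longlonglongrightarrow> Z w" and bound: "AE w in P. \<forall>n. norm (?Y n w) \<le> G w"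
    by blast
  have Z_bound: "AE w in P. norm (Z w) \<le> G w"
    using lim bound
  proof eventually_elim
    case (elim w)
    then show ?case by (intro tendsto_upperbound[OF tendsto_norm[OF elim(1)]]) auto
  qed
  let ?p = "real CARD('p)"
  \<comment> \<open>The factor 2 lets one dominating function serve the process, its limit and their
    difference.\<close>
  have l1: "l1_norm v powr \<alpha> \<le> ?p powr \<alpha> * (2 powr \<alpha> * g powr \<alpha>)" if "norm v \<le> 2 * g" for v :: "complex ^ 'p" and g
  proof -
    have "l1_norm v \<le> ?p * (2 * g)" using order_trans[OF l1_norm_le mult_left_mono[OF that]] by simp
    then have "l1_norm v powr \<alpha> \<le> (?p * (2 * g)) powr \<alpha>"
      using alpha by (intro powr_mono2) (auto simp: l1_norm_nonneg)
    also have "0 \<le> g" using that norm_ge_zero[of v] by linarith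
    then have "(?p * (2 * g)) powr \<alpha> = ?p powr \<alpha> * (2 powr \<alpha> * g powr \<alpha>)" by (simp add: powr_mult)
    finally show ?thesis .
  qed
  let ?D = "\<lambda>w. ?p powr \<alpha> * (2 powr \<alpha> * G w powr \<alpha>)"
  have D_int: "integrable P ?D" using G_int by simp
  have l1_int: "integrable P (\<lambda>w. l1_norm (f w) powr \<alpha>)" and l1_le: "(\<integral>w. l1_norm (f w) powr \<alpha> \<partial>P) \<le> integral\<^sup>L P ?D"
    if [measurable]: "f \<in> borel_measurable P" and f: "AE w in P. norm (f w) \<le> 2 * G w" for f :: "'w \<Rightarrow> complex ^ 'p"
  proof -
    have le: "AE w in P. l1_norm (f w) powr \<alpha> \<le> ?D w" using f by eventually_elim (rule l1)
    show i: "integrable P (\<lambda>w. l1_norm (f w) powr \<alpha>)"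
    proof (rule Bochner_Integration.integrable_bound[OF D_int])
      show "AE w in P. norm (l1_norm (f w) powr \<alpha>) \<le> norm (?D w)" using le by eventually_elim simp
    qed measurable
    show "(\<integral>w. l1_norm (f w) powr \<alpha> \<partial>P) \<le> integral\<^sup>L P ?D" by (rule integral_mono_AE[OF i D_int le])
  qed
  have good: "AE w in P. norm (?Y n w) \<le> G w \<and> norm (Z w) \<le> G w \<and> 0 \<le> G w" for n
    using bound Z_bound by eventually_elim (meson norm_ge_zero order_trans)
  have Y_b: "AE w in P. norm (?Y n w) \<le> 2 * G w" for n
    using good[of n] by eventually_elim linarith
  have Z_b: "AE w in P. norm (Z w) \<le> 2 * G w"
    using good[of 0] by eventually_elim linarith
  have YZ_b: "AE w in P. norm (?Y n w - Z w) \<le> 2 * G w" for n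
    using good[of n] by eventually_elim (smt (verit) norm_triangle_ineq4)
  have conv: "(\<lambda>n. \<integral>w. l1_norm (?Y n w - Z w) powr \<alpha> \<partial>P) \<longlonglongrightarrow> (\<integral>w. 0 \<partial>P)"
  proof (rule integral_dominated_convergence[OF _ _ D_int])
    show "AE w in P. (\<lambda>n. l1_norm (?Y n w - Z w) powr \<alpha>) \<longlonglongrightarrow> 0"
      using lim
    proof eventually_elim
      case (elim w)
      have "(\<lambda>n. ?p * norm (?Y n w - Z w)) \<longlonglongrightarrow> 0"
        using elim by (intro tendsto_mult_right_zero tendsto_norm_zero) (simp add: LIM_zero_iff)
      then have "(\<lambda>n. l1_norm (?Y n w - Z w)) \<longlonglongrightarrow> 0"
        by (rule Lim_null_comparison[rotated]) (simp add: l1_norm_nonneg l1_norm_le)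
      then show ?case
        using alpha by (intro tendsto_zero_powrI[OF _ tendsto_const]) (auto simp: l1_norm_nonneg)
    qed
    show "AE w in P. norm (l1_norm (?Y n w - Z w) powr \<alpha>) \<le> ?D w" for n
      using YZ_b[of n] by eventually_elim (simp add: l1)
  qed measurable
  \<comment> \<open>Since g <= 1 + g^\<alpha>, this is an integrable bound for \<open>G\<close>
    itself; it yields convergence of the expectations.\<close>
  have w_int: "integrable P (\<lambda>w. 1 + G w powr \<alpha>)" using G_int by simp
  have w: "g \<le> 1 + g powr \<alpha>" if "0 \<le> g" for g :: real
  proof (cases "g \<le> 1")
    case True
    then show ?thesis using powr_ge_zero[of g \<alpha>] by linarith
  next
    case False
    then have "g powr 1 \<le> g powr \<alpha>" using alpha by (intro powr_mono) auto
    then show ?thesis using False by simp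
  qed
  have Y_w: "AE w in P. norm (?Y n w) \<le> 1 + G w powr \<alpha>" for n
    using good[of n] by eventually_elim (meson w order_trans)
  have Z_int: "integrable P Z"
    by (rule integrable_dominated_convergence[OF Z measurable_mandelbrot w_int lim Y_w])
  have Y_lim: "(\<lambda>n. integral\<^sup>L P (?Y n)) \<longlonglongrightarrow> integral\<^sup>L P Z"
    by (rule integral_dominated_convergence[OF Z measurable_mandelbrot w_int lim Y_w])
  \<comment> \<open>The bound at t = 1 may grow geometrically in n; \<open>mandelbrot_mean\<close>
    asks for finiteness at each n.\<close>
  have fin: "(\<integral>\<^sup>+w. ennreal (\<Sum>u\<in>gen n w. entry_sum (weight u w)) \<partial>P) < \<infinity>" for n
  proof -
    obtain C where C: "\<And>n. (\<integral>\<^sup>+w. ennreal (\<Sum>u\<in>gen n w. powr_weight 1 u w) \<partial>P) \<le> ennreal (C * (?p powr (1 - 1) * rho_hat P N A 1) ^ n)"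
      by (rule powr_weight_moment_le[OF int order_refl _ n]) (use alpha in auto)
    have "entry_sum (weight u w) \<le> powr_weight 1 u w" for w u
      using entry_sum_branch_prod_le[of "\<lambda>u. A u w" u] by (simp add: entry_powr_one abs_mat_nonneg)
    then have "(\<integral>\<^sup>+w. ennreal (\<Sum>u\<in>gen n w. entry_sum (weight u w)) \<partial>P) \<le>
      (\<integral>\<^sup>+w. ennreal (\<Sum>u\<in>gen n w. powr_weight 1 u w) \<partial>P)"
      by (intro nn_integral_mono ennreal_leI sum_mono)
    also note C
    finally show ?thesis by (rule le_less_trans) simp
  qed
  have "integral\<^sup>L P (?Y n) = cvec V" for n
    using mandelbrot_mean[OF dev(2) dev(1) fin, of n] by simp
  with Y_lim have Z_mean: "integral\<^sup>L P Z = cvec V" by (simp add: LIMSEQ_const_iff)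
  \<comment> \<open>A vanishing moment would make the limit 0 almost surely, against its mean V with
    positive entries.\<close>
  have Z_pos: "0 < integral\<^sup>L P (\<lambda>w. l1_norm (Z w) powr \<alpha>)"
  proof (rule ccontr)
    assume "\<not> 0 < integral\<^sup>L P (\<lambda>w. l1_norm (Z w) powr \<alpha>)"
    moreover have "0 \<le> integral\<^sup>L P (\<lambda>w. l1_norm (Z w) powr \<alpha>)" by simp
    ultimately have "integral\<^sup>L P (\<lambda>w. l1_norm (Z w) powr \<alpha>) = 0" by linarith
    then have "AE w in P. l1_norm (Z w) powr \<alpha> = 0"
      using l1_int[OF Z Z_b] by (subst (asm) integral_nonneg_eq_0_iff_AE) auto
    then have "AE w in P. Z w = 0" by eventually_elim (simp add: l1_norm_eq_0)
    then have "integral\<^sup>L P Z = 0" by (rule integral_eq_zero_AE)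
    then have "cvec V $ i = 0" for i using Z_mean by simp
    with V_pos show False by (simp add: cvec_def less_le)
  qed
  show ?thesis
  proof (intro conjI exI[of _ Z])
    show "\<forall>n. integrable P (\<lambda>w. l1_norm (?Y n w) powr \<alpha>)"
      using l1_int[OF measurable_mandelbrot Y_b] by blast
    show "bdd_above (range (\<lambda>n. integral\<^sup>L P (\<lambda>w. l1_norm (?Y n w) powr \<alpha>)))"
      using l1_le[OF measurable_mandelbrot Y_b] by (intro bdd_aboveI[of _ "integral\<^sup>L P ?D"]) auto
    show "\<forall>n. integrable P (\<lambda>w. l1_norm (?Y n w - Z w) powr \<alpha>)"
    proof
      fix n
      show "integrable P (\<lambda>w. l1_norm (?Y n w - Z w) powr \<alpha>)"
        by (rule l1_int[OF _ YZ_b]) measurable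
    qed
    show "(\<lambda>n. integral\<^sup>L P (\<lambda>w. l1_norm (?Y n w - Z w) powr \<alpha>)) \<longlonglongrightarrow> 0" using conv by simp
    show "integrable P (\<lambda>w. l1_norm (Z w) powr \<alpha>)" by (rule l1_int[OF Z Z_b])
  qed (rule Z lim Z_int Z_mean Z_pos)+
qed

end
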